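(* For every integer $n\ge 3$ there exists a constant $C(n)$ depending only on $n$ such that the following holds. Let $k$ be an integer with $1\le k\le n$, let $R>0$, let $B_{3R}\subset\mathbb{R}^n$ be a ball of radius $3R$, and let $u\in C^2(B_{3R})$ be a positive function satisfying $$\sigma_k(\lambda(A^u))=1\quad\text{and}\quad\lambda(A^u)\in\Gamma_k\qquad\text{in }B_{3R}.$$ Then $$\left(\max_{\overline{B}_R}u\right)\left(\min_{\overline{B}_{2R}}u\right)\le C(n)R^{2-n}.$$
   Context: $B_R$ and $B_{2R}$ denote the balls of radius $R$ and $2R$ with the same center as $B_{3R}$, and the bar denotes closure. For $1\le k\le n$ and $\lambda=(\lambda_1,\dots,\lambda_n)\in\mathbb{R}^n$, $\sigma_k(\lambda)=\sum_{1\le i_1<\cdots<i_k\le n}\lambda_{i_1}\cdots\lambda_{i_k}$ is the $k$-th elementary symmetric function, and $\Gamma_k$ is the connected component of $\{\lambda\in\mathbb{R}^n \mid \sigma_k(\lambda)>0\}$ containing the positive cone $\{\lambda\in\mathbb{R}^n\mid \lambda_1,\dots,\lambda_n>0\}$. For a positive $C^2$ function $u$ on an open subset of $\mathbb{R}^n$, $n\ge 3$, $$A^u:=-\frac{2}{n-2}u^{-\frac{n+2}{n-2}}\nabla^2u+\frac{2n}{(n-2)^2}u^{-\frac{2n}{n-2}}\nabla u\otimes\nabla u-\frac{2}{(n-2)^2}u^{-\frac{2n}{n-2}}|\nabla u|^2 I,$$ where $\nabla u$ and $\nabla^2u$ are the Euclidean gradient and Hessian and $I$ is the $n\times n$ identity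 matrix; $\lambda(A^u)$ denotes the eigenvalues (with multiplicity) of the symmetric matrix $A^u$ at each point. The order of the eigenvalues is irrelevant since $\sigma_k$ and $\Gamma_k$ are symmetric. *)

theory Defs
  imports "HOL-Analysis.Analysis"
begin

definition grad :: "(real ^ 'n \<Rightarrow> real) \<Rightarrow> real ^ 'n \<Rightarrow> real ^ 'n" where
  "grad u x = (\<chi> i. frechet_derivative u (at x) (axis i 1))"

definition hess :: "(real ^ 'n \<Rightarrow> real) \<Rightarrow> real ^ 'n \<Rightarrow> real ^ 'n ^ 'n" where
  "hess u x = matrix (frechet_derivative (grad u) (at x))"

text \<open>Intended for open \<open>S\<close>. Continuity of \<open>u\<close> and of its gradient follows from differentiability.\<close>

definition C2_on :: "(real ^ 'n) set \<Rightarrow> (real ^ 'n \<Rightarrow> real) \<Rightarrow> bool" where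
  "C2_on S u \<longleftrightarrow>
     (\<forall>x\<in>S. u differentiable (at x)) \<and>
     (\<forall>x\<in>S. grad u differentiable (at x)) \<and>
     continuous_on S (hess u)"

definition outer :: "real ^ 'n \<Rightarrow> real ^ 'n \<Rightarrow> real ^ 'n ^ 'n" where
  "outer v w = (\<chi> i j. v $ i * w $ j)"

definition A_matrix :: "(real ^ 'n \<Rightarrow> real) \<Rightarrow> real ^ 'n \<Rightarrow> real ^ 'n ^ 'n" where
  "A_matrix u x =
     (let n = real CARD('n) in
        (- (2 / (n - 2)) * u x powr (- ((n + 2) / (n - 2)))) *\<^sub>R hess u x
      + (2 * n / (n - 2)\<^sup>2 * u x powr (- (2 * n / (n - 2)))) *\<^sub>R outer (grad u x) (grad u x)
      - (2 / (n - 2)\<^sup>2 * u x powr (- (2 * n / (n - 2))) * (norm (grad u x))\<^sup>2) *\<^sub>R mat 1)"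

text \<open>\<open>l\<close> lists the eigenvalues of \<open>A\<close> with multiplicity, i.e. the roots of the characteristic
  polynomial. For symmetric \<open>A\<close> such an \<open>l\<close> exists and is unique up to permuting its entries.\<close>

definition eigenvalues_of :: "real ^ 'n ^ 'n \<Rightarrow> real ^ 'n \<Rightarrow> bool" where
  "eigenvalues_of A l \<longleftrightarrow> (\<forall>t. det (mat t - A) = (\<Prod>i\<in>UNIV. t - l $ i))"

definition sigma_k :: "nat \<Rightarrow> real ^ 'n \<Rightarrow> real" where
  "sigma_k k l = (\<Sum>S | card S = k. \<Prod>i\<in>S. l $ i)"

definition positive_cone :: "(real ^ 'n) set" where
  "positive_cone = {l. \<forall>i. 0 < l $ i}"

definition Gamma_k :: "nat \<Rightarrow> (real ^ 'n) set" where
  "Gamma_k k = (THE C. C \<in> components {l. 0 < sigma_k k l} \<and> positive_cone \<subseteq> C)"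

lemma positive_cone_subset:
  assumes "k \<le> CARD('n)"
  shows "positive_cone \<subseteq> {l :: real ^ 'n. 0 < sigma_k k l}"
proof -
  obtain S :: "'n set" where S: "card S = k"
    using obtain_subset_with_card_n[OF assms] by blast
  show ?thesis
    unfolding positive_cone_def sigma_k_def
    using S by (auto intro!: sum_pos prod_pos)
qed

lemma convex_positive_cone: "convex (positive_cone :: (real ^ 'n) set)"
proof -
  have "(positive_cone :: (real ^ 'n) set) = (\<Inter>i. {l. l $ i > 0})"
    by (auto simp: positive_cone_def)
  also have "convex \<dots>"
    using convex_halfspace_gt[of 0 "axis _ (1 :: real)"]
    by (intro convex_INT) (simp add: inner_axis')
  finally show ?thesis .
qed

text \<open>The definite description in \<^term>\<open>Gamma_k\<close> is well defined.\<close>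

lemma Gamma_k_works:
  assumes "k \<le> CARD('n)"
  shows "(Gamma_k k :: (real ^ 'n) set) \<in> components {l. 0 < sigma_k k l}"
    and "positive_cone \<subseteq> (Gamma_k k :: (real ^ 'n) set)"
proof -
  let ?S = "{l :: real ^ 'n. 0 < sigma_k k l}"
  have one: "(\<chi> i. 1) \<in> (positive_cone :: (real ^ 'n) set)"
    by (simp add: positive_cone_def)
  have "\<exists>!C. C \<in> components ?S \<and> positive_cone \<subseteq> C"
  proof (rule ex_ex1I)
    show "\<exists>C. C \<in> components ?S \<and> positive_cone \<subseteq> C"
    proof (intro exI[of _ "connected_component_set ?S (\<chi> i. 1)"] conjI)
      show "connected_component_set ?S (\<chi> i. 1) \<in> components ?S"
        using one positive_cone_subset[OF assms] by (intro componentsI) auto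
      show "positive_cone \<subseteq> connected_component_set ?S (\<chi> i. 1)"
        using one positive_cone_subset[OF assms] convex_connected[OF convex_positive_cone]
        by (intro connected_component_maximal) auto
    qed
  next
    fix C D
    assume "C \<in> components ?S \<and> positive_cone \<subseteq> C" "D \<in> components ?S \<and> positive_cone \<subseteq> D"
    then show "C = D"
      using one components_nonoverlap[of C ?S D] by blast
  qed
  from theI'[OF this]
  show "(Gamma_k k :: (real ^ 'n) set) \<in> components ?S"
    and "positive_cone \<subseteq> (Gamma_k k :: (real ^ 'n) set)"
    unfolding Gamma_k_def by auto
qed

end

(* Writing xi = u^(-2/(n-2)), the matrix A^u becomes xi Hess xi - (1/2) |grad xi|^2 I, and the claim
   becomes a lower bound c R^2 for (min of xi over the R-ball) * (max of xi over the 2R-ball).  The Kelvin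
   transform xi_l(y) = |y|^2/l^2 xi(l^2 y/|y|^2) conjugates this matrix by a reflection, so moving spheres
   compare xi with xi_l in the annulus l <= |y| <= rho.  If the product were small, then near a suitably
   selected point with value m the spheres could be moved up to a radius L that is a large multiple of m,
   around every nearby centre.  The resulting radial monotonicity of xi(y)/|y| gives xi <= 2m in the ball of
   radius L/2.  But the trace of the matrix is at least 1, so xi times its Laplacian is at least 1, which
   forces xi to grow quadratically: a contradiction.  No blow-up limit or derivative estimate for u is needed.

   The strong maximum principle and the Hopf lemma are replaced by one barrier argument on annuli
   (shell_barrier); the ellipticity that it needs comes from the algebra of elementary symmetric functions:
   Newton's inequality shows that sigma_(k-1)(l|i) > 0 on Gamma_k, and a rank-one update of a symmetric
   matrix changes sigma_k by a nonnegative combination of these numbers. *)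

theory Submission
  imports Defs "HOL-Computational_Algebra.Fundamental_Theorem_Algebra" "HOL-Library.Landau_Symbols"
begin

section \<open>Elementary symmetric functions\<close>

text \<open>The operator is fully nonlinear and its ellipticity may degenerate for unbounded
  eigenvalues. A uniform bound is recovered from compactness: on a fixed shell the larger function
  has bounded eigenvalues with sigma_k = 1, and such vectors stay away from the boundary of the
  cone. The barrier is multiplicative because sigma_k is homogeneous: at a touching point the
  smaller function equals \<kappa> times the larger one with \<kappa> \<le> 1, and the factor
  \<open>\<kappa>\<^sup>2\<close> in front of the matrix has the favourable sign. All comparisons
  take place at single points, so regularity is expressed by pointwise second-order expansions
  (\<open>jet2\<close>); products, compositions and inversions are then matters of remainder
  estimates. Continuity of the gradient and of the Hessian provides bounds on shells and limits of
  sequences of bad points. The constant obtained is C(n) = (16384 n)^((n-2)/2). In 16384 = 256 * 64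
  the factor 64 n is the square of the ratio L/m at which quadratic growth becomes impossible, and
  256 leaves room for the spheres to move up to the radius L.\<close>

definition esym :: "'a set \<Rightarrow> nat \<Rightarrow> ('a \<Rightarrow> real) \<Rightarrow> real" where
  "esym I j f = (\<Sum>S | S \<subseteq> I \<and> card S = j. \<Prod>i\<in>S. f i)"

lemma esym_0: "finite I \<Longrightarrow> esym I 0 f = 1"
proof -
  assume "finite I"
  then have "{S. S \<subseteq> I \<and> card S = 0} = {{}}"
    by (auto dest: finite_subset)
  then show ?thesis by (simp add: esym_def)
qed

lemma esym_eq_0: "finite I \<Longrightarrow> card I < j \<Longrightarrow> esym I j f = 0"
proof -
  assume "finite I" "card I < j"
  then have "{S. S \<subseteq> I \<and> card S = j} = {}"
    using card_mono leD by blast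
  then show ?thesis by (simp only: esym_def sum.empty)
qed

lemma esym_insert:
  assumes "finite I" "i \<notin> I"
  shows "esym (insert i I) (Suc j) f = esym I (Suc j) f + f i * esym I j f"
proof -
  have eq: "{S. S \<subseteq> insert i I \<and> card S = Suc j} =
     {S. S \<subseteq> I \<and> card S = Suc j} \<union> insert i ` {S. S \<subseteq> I \<and> card S = j}" (is "?L = ?A \<union> ?B")
  proof (intro equalityI subsetI)
    fix S assume S: "S \<in> ?L"
    show "S \<in> ?A \<union> ?B"
    proof (cases "i \<in> S")
      case True
      have "finite S" using S assms by (auto dest: finite_subset)
      then have "S - {i} \<subseteq> I" "card (S - {i}) = j" "insert i (S - {i}) = S"
        using S True by auto
      then show ?thesis by blast
    next
      case False
      then show ?thesis using S by auto
    qed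
  next
    fix S assume "S \<in> ?A \<union> ?B"
    then show "S \<in> ?L"
      using assms finite_subset[of _ I] by (auto simp: card_insert_if)
  qed
  have inj: "inj_on (insert i) {S. S \<subseteq> I \<and> card S = j}"
    using assms by (auto simp: inj_on_def)
  have fin: "finite ?A" "finite ?B" "finite {S. S \<subseteq> I \<and> card S = j}"
    using assms by auto
  have disj: "?A \<inter> ?B = {}"
    using assms by auto
  have "esym (insert i I) (Suc j) f = (\<Sum>S\<in>?A. \<Prod>i\<in>S. f i) + (\<Sum>S\<in>?B. \<Prod>i\<in>S. f i)"
    unfolding esym_def eq using fin disj by (simp add: sum.union_disjoint)
  also have "(\<Sum>S\<in>?B. \<Prod>i\<in>S. f i) = (\<Sum>S | S \<subseteq> I \<and> card S = j. \<Prod>i\<in>insert i S. f i)"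
    by (subst sum.reindex[OF inj]) simp
  also have "\<dots> = (\<Sum>S | S \<subseteq> I \<and> card S = j. f i * (\<Prod>i\<in>S. f i))"
    using assms by (intro sum.cong) (auto dest: finite_subset intro!: prod.insert)
  finally show ?thesis by (simp add: esym_def sum_distrib_left)
qed

lemma esym_remove:
  assumes "finite I" "i \<in> I"
  shows "esym I (Suc j) f = esym (I - {i}) (Suc j) f + f i * esym (I - {i}) j f"
  using esym_insert[of "I - {i}" i j f] assms by (simp add: insert_absorb)

section \<open>Real-rooted polynomials and Newton's inequality\<close>

lemma coeff_prod_linear:
  assumes "finite I"
  shows "coeff (\<Prod>i\<in>I. [:f i, 1:]) m = (if m \<le> card I then esym I (card I - m) f else 0)"
  using assms
proof (induction I arbitrary: m rule: finite_induct)
  case empty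
  then show ?case by (auto simp: esym_0)
next
  case (insert i I)
  have "coeff (\<Prod>i\<in>insert i I. [:f i, 1:]) m
      = f i * coeff (\<Prod>i\<in>I. [:f i, 1:]) m + (if m = 0 then 0 else coeff (\<Prod>i\<in>I. [:f i, 1:]) (m - 1))"
    using insert by (cases m) (auto simp: mult_pCons_left coeff_pCons)
  then show ?case
    using insert esym_insert[of I i "card I - m" f]
    by (cases m) (auto simp: esym_0 esym_eq_0 not_le le_Suc_eq Suc_diff_Suc less_eq_Suc_le[symmetric])
qed

text \<open>A list records roots with multiplicity and supports induction; the ring is general so
  that a list of real roots can be mapped into the complex numbers.\<close>

primrec lin_prod :: "'a::comm_ring_1 list \<Rightarrow> 'a poly" where
  "lin_prod [] = 1"
| "lin_prod (x # xs) = [:- x, 1:] * lin_prod xs"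

lemma prod_mset_lin_prod: "(\<Prod>x\<in>#mset xs. [:- x, 1:]) = lin_prod xs"
  by (induction xs) (simp_all del: mult_pCons_left)

lemma poly_lin_prod_eq_0: "poly (lin_prod xs) (z :: 'a :: idom) = 0 \<longleftrightarrow> z \<in> set xs"
  by (induction xs) (auto simp del: mult_pCons_left)

lemma prod_lin_prod: "distinct xs \<Longrightarrow> (\<Prod>i\<in>set xs. [:f i, 1:]) = lin_prod (map (\<lambda>i. - f i) xs)"
  by (induction xs) (simp_all del: mult_pCons_left)

text \<open>Formally the expression is \<open>- Q\<^sup>2 * (log Q)''\<close>, the sum of
  \<open>Q\<^sup>2 / (z - x)\<^sup>2\<close> over the roots x. The recursion \<open>step\<close>
  expresses this without division: a further root multiplies the expression by
  \<open>(z - x)\<^sup>2\<close> and adds the square of the old polynomial.\<close>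

lemma laguerre:
  fixes xs :: "real list" and z :: real
  defines "Q \<equiv> lin_prod xs"
  shows "0 \<le> (poly (pderiv Q) z)\<^sup>2 - poly Q z * poly (pderiv (pderiv Q)) z"
    and "xs \<noteq> [] \<Longrightarrow> poly Q z \<noteq> 0 \<Longrightarrow> 0 < (poly (pderiv Q) z)\<^sup>2 - poly Q z * poly (pderiv (pderiv Q)) z"
proof -
  have step: "(poly (pderiv (lin_prod (x # xs))) z)\<^sup>2 - poly (lin_prod (x # xs)) z * poly (pderiv (pderiv (lin_prod (x # xs)))) z
     = (z - x)\<^sup>2 * ((poly (pderiv (lin_prod xs)) z)\<^sup>2 - poly (lin_prod xs) z * poly (pderiv (pderiv (lin_prod xs))) z) + (poly (lin_prod xs) z)\<^sup>2"
    for x :: real and xs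
    by (simp add: pderiv_mult pderiv_pCons pderiv_add power2_eq_square algebra_simps del: mult_pCons_left mult_pCons_right)
  have 1: "0 \<le> (poly (pderiv (lin_prod xs)) z)\<^sup>2 - poly (lin_prod xs) z * poly (pderiv (pderiv (lin_prod xs))) z" for xs :: "real list"
  proof (induction xs)
    case (Cons x xs)
    show ?case unfolding step using Cons by (intro add_nonneg_nonneg mult_nonneg_nonneg) simp_all
  qed simp
  then show "0 \<le> (poly (pderiv Q) z)\<^sup>2 - poly Q z * poly (pderiv (pderiv Q)) z"
    unfolding Q_def .
  assume "xs \<noteq> []" "poly Q z \<noteq> 0"
  then obtain x ys where xs: "xs = x # ys" and W: "poly (lin_prod ys) z \<noteq> 0"
    unfolding Q_def by (cases xs) auto
  show "0 < (poly (pderiv Q) z)\<^sup>2 - poly Q z * poly (pderiv (pderiv Q)) z"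
    unfolding Q_def xs step using W 1[of ys] by (intro add_nonneg_pos mult_nonneg_nonneg) simp_all
qed

text \<open>The logarithmic derivative is the sum of \<open>1 / (z - x)\<close> over the real roots,
  and each summand has imaginary part of sign opposite to \<open>Im z\<close>. So the derivative has
  no zero off the real axis, which is Gauss-Lucas for real-rooted polynomials.\<close>

lemma Im_log_deriv:
  fixes xs :: "complex list"
  assumes "\<And>x. x \<in> set xs \<Longrightarrow> Im x = 0" "Im z \<noteq> 0" "xs \<noteq> []"
  shows "poly (lin_prod xs) z \<noteq> 0 \<and> Im z * Im (poly (pderiv (lin_prod xs)) z / poly (lin_prod xs) z) < 0"
  using assms
proof (induction xs)
  case (Cons x xs)
  have x: "Im x = 0" "z - x \<noteq> 0" using Cons.prems by auto
  have "Im z * Im (1 / (z - x)) = - (Im z)\<^sup>2 / ((Re z - Re x)\<^sup>2 + (Im z)\<^sup>2)"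
    using x by (simp add: Im_divide power2_eq_square)
  also have "\<dots> < 0"
    using Cons.prems by (intro divide_neg_pos) (simp_all add: sum_power2_gt_zero_iff)
  finally have inv: "Im z * Im (1 / (z - x)) < 0" .
  show ?case
  proof (cases "xs = []")
    case True
    then show ?thesis using x inv by (simp add: pderiv_pCons)
  next
    case False
    then have W: "poly (lin_prod xs) z \<noteq> 0" "Im z * Im (poly (pderiv (lin_prod xs)) z / poly (lin_prod xs) z) < 0"
      using Cons by auto
    have "poly (pderiv (lin_prod (x # xs))) z = poly (lin_prod xs) z + (z - x) * poly (pderiv (lin_prod xs)) z"
      by (simp add: pderiv_mult pderiv_pCons algebra_simps del: mult_pCons_left mult_pCons_right)
    moreover have "poly (lin_prod (x # xs)) z = (z - x) * poly (lin_prod xs) z"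
      by (simp add: algebra_simps)
    ultimately have "poly (pderiv (lin_prod (x # xs))) z / poly (lin_prod (x # xs)) z
        = 1 / (z - x) + poly (pderiv (lin_prod xs)) z / poly (lin_prod xs) z"
      using W x by (simp add: field_simps)
    moreover have "poly (lin_prod (x # xs)) z \<noteq> 0"
      using W x by simp
    ultimately show ?thesis using W inv by (simp add: distrib_left)
  qed
qed simp

lemma poly_lin_prod_of_real:
  fixes t :: real
  shows "poly (lin_prod (map of_real xs)) (of_real t) = (of_real (poly (lin_prod xs) t) :: complex)"
    and "poly (pderiv (lin_prod (map of_real xs))) (of_real t) = (of_real (poly (pderiv (lin_prod xs)) t) :: complex)"
proof -
  show 1: "poly (lin_prod (map of_real xs)) (of_real t) = (of_real (poly (lin_prod xs) t) :: complex)" for xs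
    by (induction xs) (simp_all del: mult_pCons_left mult_pCons_right)
  show "poly (pderiv (lin_prod (map of_real xs))) (of_real t) = (of_real (poly (pderiv (lin_prod xs)) t) :: complex)"
    by (induction xs) (simp_all add: pderiv_mult pderiv_pCons 1 del: mult_pCons_left mult_pCons_right)
qed

lemma degree_lin_prod: "degree (lin_prod (xs :: 'a::idom list)) = length xs"
  and lead_coeff_lin_prod: "lead_coeff (lin_prod (xs :: 'a::idom list)) = 1"
proof -
  have "lead_coeff (lin_prod xs) = 1 \<and> degree (lin_prod xs) = length xs"
  proof (induction xs)
    case (Cons x xs)
    then have nz: "lin_prod xs \<noteq> 0" by auto
    then have "degree ([:- x, 1:] * lin_prod xs) = length (x # xs)"
      using Cons by (subst degree_mult_eq) auto
    moreover have "lead_coeff ([:- x, 1:] * lin_prod xs) = 1"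
      using Cons by (subst lead_coeff_mult) auto
    ultimately show ?case by simp
  qed simp
  then show "degree (lin_prod xs) = length xs" "lead_coeff (lin_prod xs) = 1" by auto
qed

text \<open>Factoring the derivative over the complex numbers and excluding non-real roots gives all
  roots with multiplicity at once; nothing has to be counted with Rolle's theorem.\<close>

lemma pderiv_real_rooted:
  fixes xs :: "real list"
  assumes "xs \<noteq> []"
  obtains ys where "pderiv (lin_prod xs) = smult (real (length xs)) (lin_prod ys)" "length xs = Suc (length ys)"
proof -
  define C where "C = pderiv (lin_prod (map complex_of_real xs))"
  have degC: "degree C = length xs - 1"
    unfolding C_def by (simp add: degree_pderiv degree_lin_prod)
  have leadC: "lead_coeff C = of_nat (length xs)"
    using assms lead_coeff_lin_prod[of "map complex_of_real xs"] degC
    unfolding C_def by (simp add: coeff_pderiv degree_lin_prod)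
  then have "C \<noteq> 0" using assms by auto
  then obtain A where A: "size A = degree C" "C = smult (lead_coeff C) (\<Prod>x\<in>#A. [:-x, 1:])"
    using alg_closed_imp_factorization by blast
  obtain zs where zs: "mset zs = A" by (metis ex_mset)
  have im: "Im z = 0" if z: "z \<in># A" for z
  proof (rule ccontr)
    assume "Im z \<noteq> 0"
    moreover have "poly C z = 0"
      using z zs prod_mset_lin_prod[of zs] poly_lin_prod_eq_0[of zs z] by (subst A(2)) auto
    moreover have "Im x = 0" if "x \<in> set (map complex_of_real xs)" for x
      using that by auto
    ultimately show False
      using Im_log_deriv[of "map complex_of_real xs" z] assms unfolding C_def by simp
  qed
  have "map complex_of_real (map Re zs) = zs"
  proof -
    have "complex_of_real (Re z) = z" if "z \<in> set zs" for z
    proof -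
      have "z \<in># A" using that zs by auto
      then show ?thesis using im[of z] by (simp add: complex_eq_iff)
    qed
    then show ?thesis by (simp add: map_idI)
  qed
  then obtain ys where ys: "zs = map complex_of_real ys" by metis
  have Cfac: "C = smult (of_nat (length xs)) (lin_prod (map complex_of_real ys))"
    using A(2) leadC zs ys prod_mset_lin_prod[of zs] by simp
  have "poly (pderiv (lin_prod xs)) t = poly (smult (real (length xs)) (lin_prod ys)) t" for t
  proof -
    have "complex_of_real (poly (pderiv (lin_prod xs)) t) = poly C (of_real t)"
      unfolding C_def by (rule poly_lin_prod_of_real(2)[symmetric])
    also have "\<dots> = complex_of_real (poly (smult (real (length xs)) (lin_prod ys)) t)"
      unfolding Cfac by (simp only: poly_smult poly_lin_prod_of_real(1) of_real_mult of_real_of_nat_eq)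
    finally show ?thesis by (simp only: of_real_eq_iff)
  qed
  then have "pderiv (lin_prod xs) = smult (real (length xs)) (lin_prod ys)"
    by (subst poly_eq_poly_eq_iff[symmetric]) auto
  moreover have "length xs = Suc (length ys)"
    using A(1) degC zs ys assms by (metis One_nat_def Suc_pred length_greater_0_conv length_map size_mset)
  ultimately show ?thesis using that by blast
qed

lemma higher_pderiv_real_rooted:
  fixes xs :: "real list"
  assumes "m \<le> length xs"
  shows "\<exists>c ys. c \<noteq> 0 \<and> (pderiv ^^ m) (lin_prod xs) = smult c (lin_prod ys) \<and> length ys = length xs - m"
  using assms
proof (induction m)
  case 0
  then show ?case by (intro exI[of _ 1] exI[of _ xs]) auto
next
  case (Suc m)
  then obtain c ys where c: "c \<noteq> 0" "(pderiv ^^ m) (lin_prod xs) = smult c (lin_prod ys)" "length ys = length xs - m"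
    by auto
  then have "ys \<noteq> []" using Suc.prems by auto
  then obtain zs where zs: "pderiv (lin_prod ys) = smult (real (length ys)) (lin_prod zs)" "length ys = Suc (length zs)"
    by (rule pderiv_real_rooted)
  show ?case
    using c zs by (intro exI[of _ "c * real (length ys)"] exI[of _ zs]) (auto simp: pderiv_smult)
qed

lemma coeff_0_higher_pderiv:
  "coeff ((pderiv ^^ m) p) 0 = fact m * coeff (p :: real poly) m"
proof (induction m arbitrary: p)
  case (Suc m)
  have "(pderiv ^^ Suc m) p = (pderiv ^^ m) (pderiv p)"
    by (simp only: funpow_Suc_right comp_def)
  then show ?case using Suc[of "pderiv p"] by (simp add: coeff_pderiv algebra_simps)
qed simp

text \<open>The m-th derivative is again real-rooted, and its value and first two derivatives at 0
  are factorial multiples of the coefficients m, m+1 and m+2. Laguerre's inequality at 0 is strict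
  because the coefficient m does not vanish.\<close>

lemma newton_coeff:
  fixes p :: "real poly"
  assumes p: "p = lin_prod xs" and m: "m < length xs" and nz: "coeff p m \<noteq> 0"
  shows "coeff p m * coeff p (m + 2) < (coeff p (m + 1))\<^sup>2"
proof -
  obtain c ys where c: "c \<noteq> 0" "(pderiv ^^ m) p = smult c (lin_prod ys)" "length ys = length xs - m"
    using higher_pderiv_real_rooted[of m xs] m p by auto
  define Q where "Q = (pderiv ^^ m) p"
  have q: "poly Q 0 = fact m * coeff p m" "poly (pderiv Q) 0 = fact (m + 1) * coeff p (m + 1)"
    "poly (pderiv (pderiv Q)) 0 = fact (m + 2) * coeff p (m + 2)"
    using coeff_0_higher_pderiv[of m p] coeff_0_higher_pderiv[of "m+1" p] coeff_0_higher_pderiv[of "m+2" p]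
    unfolding Q_def by (simp_all add: poly_0_coeff_0)
  have "ys \<noteq> []" using c m by auto
  have "poly Q 0 \<noteq> 0" using q nz by simp
  then have "poly (lin_prod ys) 0 \<noteq> 0" using c unfolding Q_def by auto
  from laguerre(2)[OF \<open>ys \<noteq> []\<close> this]
  have "0 < c\<^sup>2 * ((poly (pderiv (lin_prod ys)) 0)\<^sup>2 - poly (lin_prod ys) 0 * poly (pderiv (pderiv (lin_prod ys))) 0)"
    using c by simp
  also have "\<dots> = (poly (pderiv Q) 0)\<^sup>2 - poly Q 0 * poly (pderiv (pderiv Q)) 0"
    unfolding Q_def c(2) by (simp add: pderiv_smult power2_eq_square algebra_simps)
  finally have *: "(fact m * coeff p m) * (fact (m + 2) * coeff p (m + 2)) < (fact (m + 1) * coeff p (m + 1))\<^sup>2"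
    using q by simp
  \<comment> \<open>Log-convexity of the factorial; it removes the factorials at the price of the
    sharper binomial factors.\<close>
  have ab: "0 < (fact (m + 1) :: real)\<^sup>2" "(fact (m + 1) :: real)\<^sup>2 \<le> fact m * fact (m + 2)"
    by simp (simp add: power2_eq_square algebra_simps)
  show ?thesis
  proof (rule ccontr)
    assume "\<not> ?thesis"
    then have le: "(coeff p (m + 1))\<^sup>2 \<le> coeff p m * coeff p (m + 2)" by (simp only: not_less)
    have "(fact (m + 1) :: real)\<^sup>2 * (coeff p (m + 1))\<^sup>2 \<le> (fact m * fact (m + 2)) * (coeff p m * coeff p (m + 2))"
      using ab le by (intro mult_mono) (simp_all only: zero_le_power2 less_imp_le order.trans[OF zero_le_power2 le])
    then show False using * by (simp only: power_mult_distrib mult.assoc mult.left_commute not_less[symmetric])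
  qed
qed

text \<open>Coefficients run against the order of the symmetric functions: e_(j+2) is the
  coefficient of lowest index m, so its nonvanishing is what makes the inequality strict.\<close>

lemma newton_esym:
  assumes "finite I" "esym I (Suc (Suc j)) f \<noteq> 0"
  shows "esym I j f * esym I (Suc (Suc j)) f < (esym I (Suc j) f)\<^sup>2"
proof -
  have le: "Suc (Suc j) \<le> card I"
    using assms esym_eq_0[of I "Suc (Suc j)" f] by force
  obtain ks where ks: "set ks = I" "distinct ks" using assms(1) finite_distinct_list by blast
  define xs where "xs = map (\<lambda>i. - f i) ks"
  have p: "(\<Prod>i\<in>I. [:f i, 1:]) = lin_prod xs"
    unfolding xs_def using ks prod_lin_prod[of ks f] by simp
  have len: "length xs = card I" unfolding xs_def using ks distinct_card by force
  define m where "m = card I - Suc (Suc j)"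
  have "card I - m = Suc (Suc j)" "card I - (m + 1) = Suc j" "card I - (m + 2) = j" "m + 2 \<le> card I"
    using le by (auto simp: m_def)
  then have "coeff (lin_prod xs) m = esym I (Suc (Suc j)) f" "coeff (lin_prod xs) (m + 1) = esym I (Suc j) f"
     "coeff (lin_prod xs) (m + 2) = esym I j f"
    using coeff_prod_linear[OF assms(1), of f m] coeff_prod_linear[OF assms(1), of f "m + 1"]
      coeff_prod_linear[OF assms(1), of f "m + 2"] p by auto
  then show ?thesis
    using newton_coeff[OF refl, of m xs] assms le len by (simp add: m_def mult.commute)
qed

section \<open>The cone described by inequalities\<close>

text \<open>\<open>\<Gamma>\<^sub>k\<close> described by inequalities; only the inclusion \<open>Gamma_k_garding\<close> is needed.\<close>

definition garding :: "nat \<Rightarrow> ('a::finite \<Rightarrow> real) \<Rightarrow> bool" where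
  "garding k f \<longleftrightarrow> (\<forall>j\<le>k. 0 < esym UNIV j f)"

text \<open>If deleting i made e_(j+1) nonpositive, the expansion of e_(j+1) would force
  \<open>f i > 0\<close>, and the expansion of e_(j+2) would make its deleted version so large that
  Newton's strict inequality fails. For j = k - 1 these numbers are the partial derivatives of
  sigma_k.\<close>

lemma esym_remove_pos:
  assumes "finite I" "i \<in> I" "\<And>j. j \<le> k \<Longrightarrow> 0 < esym I j f" "j < k"
  shows "0 < esym (I - {i}) j f"
  using assms(4)
proof (induction j)
  case 0
  then show ?case using assms by (simp add: esym_0)
next
  case (Suc j)
  let ?e = "\<lambda>j. esym (I - {i}) j f"
  have pj: "0 < ?e j" using Suc by simp
  have 1: "0 < ?e (Suc j) + f i * ?e j"
    using assms(3)[of "Suc j"] esym_remove[OF assms(1,2), of j f] Suc.prems by simp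
  have 2: "0 < ?e (Suc (Suc j)) + f i * ?e (Suc j)"
    using assms(3)[of "Suc (Suc j)"] esym_remove[OF assms(1,2), of "Suc j" f] Suc.prems by simp
  show ?case
  proof (rule ccontr)
    assume "\<not> 0 < ?e (Suc j)"
    then have np: "?e (Suc j) \<le> 0" by simp
    have fi: "0 < f i" using 1 np pj by (smt (verit) mult_nonneg_nonpos2 mult_nonpos_nonneg)
    have e2: "0 < ?e (Suc (Suc j))" using 2 np fi by (smt (verit) mult_nonneg_nonpos)
    have "?e j * ?e (Suc (Suc j)) < (?e (Suc j))\<^sup>2"
      using newton_esym[of "I - {i}" j f] e2 assms(1) by simp
    moreover have "(?e (Suc j))\<^sup>2 \<le> ?e j * ?e (Suc (Suc j))"
    proof -
      have "(?e (Suc j))\<^sup>2 = (- ?e (Suc j)) * (- ?e (Suc j))" by (simp add: power2_eq_square)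
      also have "\<dots> \<le> (f i * ?e j) * (- ?e (Suc j))" using 1 np by (intro mult_right_mono) auto
      also have "\<dots> = ?e j * (- f i * ?e (Suc j))" by simp
      also have "\<dots> \<le> ?e j * ?e (Suc (Suc j))" using 2 pj by (intro mult_left_mono) auto
      finally show ?thesis .
    qed
    ultimately show False by simp
  qed
qed

text \<open>Descending induction: e_(j+1) > 0 and e_j = 0 would give e_(j-1) e_(j+1) < 0 by Newton,
  against e_(j-1) \<ge> 0. So the cone cannot be left while e_k stays positive. This serves both the
  connectedness argument for \<open>Gamma_k\<close> and the compactness argument for
  ellipticity.\<close>

lemma garding_closure:
  assumes nonneg: "\<And>j. j < k \<Longrightarrow> 0 \<le> esym UNIV j f" and pos: "0 < esym UNIV k (f :: 'a::finite \<Rightarrow> real)"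
  shows "garding k f"
proof -
  have "0 < esym UNIV (k - i) f" for i
  proof (induction i)
    case (Suc i)
    show ?case
    proof (cases "k - i")
      case 0
      then show ?thesis using Suc by simp
    next
      case (Suc j)
      then have *: "k - Suc i = j" "0 < esym UNIV (Suc j) f" using \<open>0 < esym UNIV (k - i) f\<close> by auto
      show ?thesis
      proof (cases j)
        case 0
        then show ?thesis using * by (simp add: esym_0)
      next
        case j: (Suc j')
        have "esym UNIV j' f * esym UNIV (Suc (Suc j')) f < (esym UNIV (Suc j') f)\<^sup>2"
          using newton_esym[of "UNIV :: 'a set" j' f] * j by simp
        moreover have "0 \<le> esym UNIV j' f" using nonneg[of j'] Suc j by simp
        moreover have "0 \<le> esym UNIV j f" using nonneg[of j] Suc by simp
        ultimately show ?thesis using * j by (smt (verit) mult_nonneg_nonneg power2_eq_square zero_eq_power2)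
      qed
    qed
  qed (use pos in simp)
  from this[of "k - j" for j] show ?thesis
    unfolding garding_def by (metis diff_diff_cancel)
qed

lemma sigma_k_esym: "sigma_k k l = esym UNIV k (\<lambda>i. l $ i)"
  by (simp add: sigma_k_def esym_def)

lemma continuous_on_esym: "continuous_on A (\<lambda>l :: real^'n. esym I k (\<lambda>i. l $ i))"
  unfolding esym_def by (intro continuous_intros)

text \<open>Within the component, the set where all e_j are positive and the set where some lower
  e_j is negative are open and disjoint, and \<open>garding_closure\<close> shows that they cover
  it. Connectedness and the point (1,...,1) select the first.\<close>

lemma Gamma_k_garding:
  assumes "k \<le> CARD('n::finite)" "l \<in> (Gamma_k k :: (real ^ 'n) set)"
  shows "garding k (\<lambda>i. l $ i)"
proof -
  let ?G = "Gamma_k k :: (real ^ 'n) set"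
  have comp: "?G \<in> components {l. 0 < sigma_k k l}" and pc: "positive_cone \<subseteq> ?G"
    using Gamma_k_works[OF assms(1)] by auto
  have conn: "connected ?G" using comp by (rule in_components_connected)
  have pos: "0 < esym UNIV k (\<lambda>i. l $ i)" if "l \<in> ?G" for l
    using in_components_subset[OF comp] that by (auto simp: sigma_k_esym)
  define A where "A = {l :: real^'n. \<forall>j\<le>k. 0 < esym UNIV j (\<lambda>i. l $ i)}"
  define B where "B = {l :: real^'n. \<exists>j<k. esym UNIV j (\<lambda>i. l $ i) < 0}"
  have "A = (\<Inter>j\<in>{..k}. {l. 0 < esym UNIV j (\<lambda>i. l $ i)})" by (auto simp: A_def)
  then have oA: "open A"
    by (auto intro!: open_INT open_Collect_less continuous_on_esym)
  have "B = (\<Union>j\<in>{..<k}. {l. esym UNIV j (\<lambda>i. l $ i) < 0})" by (auto simp: B_def)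
  then have oB: "open B"
    by (auto intro!: open_UN open_Collect_less continuous_on_esym)
  have "A \<inter> B \<inter> ?G = {}"
  proof -
    have "l \<notin> B" if "l \<in> A" for l 
    proof
      assume "l \<in> B"
      then obtain j where "j < k" "esym UNIV j (\<lambda>i. l $ i) < 0" unfolding B_def by blast
      moreover have "0 < esym UNIV j (\<lambda>i. l $ i)" using that \<open>j < k\<close> unfolding A_def by simp
      ultimately show False by linarith
    qed
    then show ?thesis by auto
  qed
  moreover have "?G \<subseteq> A \<union> B"
  proof
    fix l assume l: "l \<in> ?G"
    show "l \<in> A \<union> B"
    proof (cases "l \<in> B")
      case False
      then have "garding k (\<lambda>i. l $ i)"
        by (intro garding_closure pos[OF l]) (metis (mono_tags, lifting) B_def mem_Collect_eq not_less)
      then show ?thesis by (auto simp: A_def garding_def)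
    qed auto
  qed
  ultimately have "A \<inter> ?G = {} \<or> B \<inter> ?G = {}"
    using conn oA oB unfolding connected_def by (metis inf_commute inf_left_commute)
  moreover have one: "(\<chi> i. 1) \<in> (positive_cone :: (real ^ 'n) set)" by (simp add: positive_cone_def)
  moreover have "(\<chi> i. 1) \<in> A"
  proof -
    have "0 < sigma_k j ((\<chi> i. 1) :: real^'n)" if "j \<le> k" for j
    proof -
      have "j \<le> CARD('n)" using that assms(1) by simp
      from subsetD[OF positive_cone_subset[OF this] one] show ?thesis by simp
    qed
    then show ?thesis unfolding A_def sigma_k_esym by blast
  qed
  ultimately have "?G \<subseteq> A" using pc \<open>?G \<subseteq> A \<union> B\<close> by blast
  then show ?thesis using assms(2) by (auto simp: A_def garding_def)
qed

text \<open>Newton's inequality makes the ratios e_(j+1) / e_j decrease, so each is at most e_1. It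
  will turn sigma_k = 1 into a lower bound for the trace.\<close>

lemma esym_le_power:
  assumes "garding k (f :: 'a::finite \<Rightarrow> real)"
  shows "esym UNIV k f \<le> (esym UNIV 1 f) ^ k"
proof -
  let ?e = "\<lambda>j. esym UNIV j f"
  have pos: "0 < ?e j" if "j \<le> k" for j using assms that by (simp add: garding_def)
  have ratio: "?e (Suc j) \<le> ?e 1 * ?e j" if "Suc j \<le> k" for j
    using that
  proof (induction j)
    case 0
    then show ?case by (simp add: esym_0)
  next
    case (Suc j)
    have "?e j * ?e (Suc (Suc j)) < (?e (Suc j))\<^sup>2"
      using newton_esym[of "UNIV :: 'a set" j f] pos[of "Suc (Suc j)"] Suc.prems by simp
    also have "\<dots> \<le> ?e (Suc j) * (?e 1 * ?e j)"
      using Suc pos[of "Suc j"] by (simp add: power2_eq_square)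
    finally have "?e j * ?e (Suc (Suc j)) < ?e j * (?e 1 * ?e (Suc j))" by (simp add: ac_simps)
    then show ?case using pos[of j] Suc.prems by simp
  qed
  have "?e j \<le> ?e 1 ^ j" if "j \<le> k" for j
    using that
  proof (induction j)
    case (Suc j)
    have "0 < ?e 1" using pos[of 1] Suc.prems by simp
    have "?e (Suc j) \<le> ?e 1 * ?e j" using ratio Suc.prems by simp
    also have "\<dots> \<le> ?e 1 * ?e 1 ^ j" using Suc \<open>0 < ?e 1\<close> by (intro mult_left_mono) auto
    finally show ?case by simp
  qed (simp add: esym_0)
  then show ?thesis by simp
qed

lemma esym_1: "esym UNIV 1 (f :: 'a::finite \<Rightarrow> real) = (\<Sum>i\<in>UNIV. f i)"
proof -
  have "{S :: 'a set. S \<subseteq> UNIV \<and> card S = 1} = (\<lambda>i. {i}) ` UNIV"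
    by (auto simp: card_1_singleton_iff)
  then show ?thesis
    unfolding esym_def by (simp add: sum.reindex inj_on_def)
qed

section \<open>Symmetric matrices\<close>

definition diagm :: "real ^ 'n \<Rightarrow> real ^ 'n ^ 'n" where
  "diagm l = (\<chi> i j. if i = j then l $ i else 0)"

lemma symmetric_inner: "transpose A = A \<Longrightarrow> x \<bullet> (A *v y) = (A *v x) \<bullet> (y :: real ^ 'n)"
  by (metis dot_lmul_matrix vector_transpose_matrix)

text \<open>The quadratic form attains a maximum on the unit sphere of the orthogonal complement W
  of B. Since A is symmetric and B consists of eigenvectors, the residual
  \<open>A *v v - \<mu> *\<^sub>R v\<close> lies in W, and the first variation in its direction
  forces it to vanish.\<close>

lemma symmetric_eigenvector_orthogonal:
  fixes A :: "real ^ 'n ^ 'n"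
  assumes sym: "transpose A = A" and B: "finite B" "card B < CARD('n)"
    and eig: "\<And>b. b \<in> B \<Longrightarrow> \<exists>c. A *v b = c *\<^sub>R b"
  shows "\<exists>v. norm v = 1 \<and> (\<forall>b\<in>B. b \<bullet> v = 0) \<and> (\<exists>c. A *v v = c *\<^sub>R v)"
proof -
  define W where "W = {x :: real ^ 'n. \<forall>b\<in>B. b \<bullet> x = 0}"
  have "dim (span B) < DIM(real ^ 'n)"
    using dim_le_card'[OF B(1)] B(2) by simp
  then obtain w where w: "w \<noteq> 0" "\<And>y. y \<in> span (span B) \<Longrightarrow> orthogonal w y"
    using orthogonal_to_subspace_exists by blast
  have "w \<in> W"
    unfolding W_def using w(2) by (auto simp: orthogonal_def inner_commute span_base)
  define S where "S = W \<inter> sphere 0 1"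
  have "closed W"
  proof -
    have "W = (\<Inter>b\<in>B. {x. b \<bullet> x = 0})" by (auto simp: W_def)
    then show ?thesis by (simp add: closed_INT closed_hyperplane)
  qed
  then have "compact S" unfolding S_def by (intro closed_Int_compact) auto
  moreover have "w /\<^sub>R norm w \<in> S"
    using \<open>w \<in> W\<close> w(1) by (simp add: S_def W_def)
  then have "S \<noteq> {}" by auto
  moreover have "continuous_on S (\<lambda>x. x \<bullet> (A *v x))"
    by (intro continuous_intros matrix_vector_mult_linear_continuous_on)
  ultimately obtain v where v: "v \<in> S" and max: "\<And>y. y \<in> S \<Longrightarrow> y \<bullet> (A *v y) \<le> v \<bullet> (A *v v)"
    using continuous_attains_sup[of S] by metis
  define \<mu> where "\<mu> = v \<bullet> (A *v v)"
  have nv: "norm v = 1" "v \<bullet> v = 1" and vW: "v \<in> W" using v by (auto simp: S_def dot_square_norm)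
  have le: "y \<bullet> (A *v y) \<le> \<mu> * (y \<bullet> y)" if "y \<in> W" for y
  proof (cases "y = 0")
    case False
    then have "y /\<^sub>R norm y \<in> S" using that by (simp add: S_def W_def)
    from max[OF this] have "(y \<bullet> (A *v y)) / (norm y)\<^sup>2 \<le> \<mu>"
      by (simp add: \<mu>_def matrix_vector_mult_scaleR power2_eq_square field_simps)
    then show ?thesis using False by (simp add: dot_square_norm pos_divide_le_eq)
  qed simp
  define z where "z = A *v v - \<mu> *\<^sub>R v"
  have zW: "z \<in> W"
    unfolding W_def
  proof (clarify)
    fix b assume "b \<in> B"
    then obtain c where c: "A *v b = c *\<^sub>R b" using eig by blast
    have "b \<bullet> v = 0" using vW \<open>b \<in> B\<close> by (simp add: W_def)
    then show "b \<bullet> z = 0"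
      unfolding z_def by (simp add: inner_diff_right symmetric_inner[OF sym] c)
  qed
  have zv: "z \<bullet> v = 0"
  proof -
    have "v \<bullet> z = 0" unfolding z_def using nv by (simp add: inner_diff_right \<mu>_def)
    then show ?thesis by (simp add: inner_commute)
  qed
  \<comment> \<open>Obtained by inserting \<open>v + t *\<^sub>R z\<close> into \<open>le\<close>:
    terms of order 0 cancel and those of order 1 give the left side, so a small positive t rules out
    a nonzero residual.\<close>
  have "2 * (z \<bullet> z) * t \<le> (\<mu> * (z \<bullet> z) - z \<bullet> (A *v z)) * t\<^sup>2" for t :: real
  proof -
    have "v + t *\<^sub>R z \<in> W" using vW zW by (simp add: W_def inner_add_right)
    from le[OF this] have "(v + t *\<^sub>R z) \<bullet> (A *v v + t *\<^sub>R (A *v z)) \<le> \<mu> * ((v + t *\<^sub>R z) \<bullet> (v + t *\<^sub>R z))"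
      by (simp add: matrix_vector_right_distrib matrix_vector_mult_scaleR)
    moreover have "A *v v = z + \<mu> *\<^sub>R v" by (simp add: z_def)
    moreover have "v \<bullet> (A *v z) = z \<bullet> z"
      using symmetric_inner[OF sym, of v z] zv \<open>A *v v = z + \<mu> *\<^sub>R v\<close>
      by (metis add.right_neutral inner_add_left inner_commute inner_scaleR_left mult_zero_right)
    ultimately show ?thesis
      using zv nv by (simp add: inner_add_left inner_add_right inner_commute power2_eq_square algebra_simps)
  qed
  note quad = this
  have "z \<bullet> z = 0"
  proof (rule ccontr)
    assume "z \<bullet> z \<noteq> 0"
    then have zz: "0 < z \<bullet> z" by (metis inner_gt_zero_iff inner_eq_zero_iff)
    define K where "K = \<bar>\<mu> * (z \<bullet> z) - z \<bullet> (A *v z)\<bar> + 1"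
    define t where "t = (z \<bullet> z) / K"
    have K: "0 < K" by (simp add: K_def add_nonneg_pos)
    have t: "0 < t" using zz K by (simp add: t_def)
    have "2 * (z \<bullet> z) * t \<le> K * t\<^sup>2"
      using quad[of t] by (rule order_trans) (auto simp: K_def intro!: mult_right_mono)
    then have "2 * (z \<bullet> z) \<le> K * t" using t by (simp add: power2_eq_square)
    then show False using zz K by (simp add: t_def)
  qed
  then have "A *v v = \<mu> *\<^sub>R v" by (simp add: z_def)
  then show ?thesis using nv vW by (auto simp: W_def)
qed

lemma symmetric_eigenbasis_set:
  fixes A :: "real ^ 'n ^ 'n"
  assumes sym: "transpose A = A" and "m \<le> CARD('n)"
  shows "\<exists>B. finite B \<and> card B = m \<and> (\<forall>b\<in>B. norm b = 1 \<and> (\<exists>c. A *v b = c *\<^sub>R b)) \<and>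
    (\<forall>b\<in>B. \<forall>b'\<in>B. b \<noteq> b' \<longrightarrow> b \<bullet> b' = 0)"
  using assms(2)
proof (induction m)
  case (Suc m)
  then obtain B where B: "finite B" "card B = m" "\<And>b. b \<in> B \<Longrightarrow> norm b = 1" "\<And>b. b \<in> B \<Longrightarrow> \<exists>c. A *v b = c *\<^sub>R b"
    "\<And>b b'. b \<in> B \<Longrightarrow> b' \<in> B \<Longrightarrow> b \<noteq> b' \<Longrightarrow> b \<bullet> b' = 0"
    by auto
  obtain v where v: "norm v = 1" "\<forall>b\<in>B. b \<bullet> v = 0" "\<exists>c. A *v v = c *\<^sub>R v"
    using symmetric_eigenvector_orthogonal[OF sym B(1) _ B(4)] B(2) Suc.prems by auto
  have "v \<notin> B"
  proof
    assume "v \<in> B"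
    then have "v \<bullet> v = 0" using v by auto
    then show False using v(1) by simp
  qed
  then show ?case
    using B v by (intro exI[of _ "insert v B"]) (auto simp: inner_commute)
qed (auto intro: exI[of _ "{}"])

theorem spectral_theorem:
  fixes A :: "real ^ 'n ^ 'n"
  assumes sym: "transpose A = A"
  obtains Q l where "orthogonal_matrix Q" "transpose Q ** A ** Q = diagm l"
proof -
  obtain B where B: "finite B" "card B = CARD('n)" "\<And>b. b \<in> B \<Longrightarrow> norm b = 1" "\<And>b. b \<in> B \<Longrightarrow> \<exists>c. A *v b = c *\<^sub>R b"
    "\<And>b b'. b \<in> B \<Longrightarrow> b' \<in> B \<Longrightarrow> b \<noteq> b' \<Longrightarrow> b \<bullet> b' = 0"
    using symmetric_eigenbasis_set[OF sym order_refl] by auto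
  obtain q :: "'n \<Rightarrow> real ^ 'n" where q: "bij_betw q UNIV B"
    using B(1,2) finite_same_card_bij[of "UNIV :: 'n set" B] by auto
  have qB: "q i \<in> B" for i using q by (auto simp: bij_betw_def)
  have qq: "q i \<bullet> q j = (if i = j then 1 else 0)" for i j
    using B(3)[OF qB] B(5)[OF qB qB, of i j] q by (auto simp: bij_betw_def inj_on_def dot_square_norm)
  obtain c where c: "\<And>i. A *v q i = c i *\<^sub>R q i" using B(4)[OF qB] by metis
  define Q :: "real ^ 'n ^ 'n" where "Q = (\<chi> i j. q j $ i)"
  have col: "column j Q = q j" for j by (simp add: Q_def column_def vec_eq_iff)
  have "transpose Q ** Q = mat 1"
    by (simp add: matrix_matrix_mult_def transpose_def Q_def mat_def vec_eq_iff qq[unfolded inner_vec_def, simplified])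
  then have "orthogonal_matrix Q" by (simp add: orthogonal_matrix)
  moreover have "transpose Q ** A ** Q = diagm (\<chi> i. c i)"
  proof -
    have "(transpose Q ** A ** Q) $ i $ j = q i \<bullet> (A *v q j)" for i j
      unfolding matrix_mul_assoc[symmetric]
      by (simp add: matrix_matrix_mult_def transpose_def Q_def inner_vec_def matrix_vector_mult_def)
    then show ?thesis by (simp add: vec_eq_iff diagm_def c qq)
  qed
  ultimately show ?thesis using that by blast
qed


section \<open>Orthogonal conjugation, determinants and rank-one updates\<close>

lemma matrix_add_rdistrib: "(A + B) ** C = A ** C + B ** (C :: real ^ 'n ^ 'm)"
  by (simp add: matrix_matrix_mult_def vec_eq_iff sum.distrib distrib_right)

lemma conj_add: "transpose Q ** (A + B) ** Q = transpose Q ** A ** Q + transpose Q ** B ** (Q :: real ^ 'n ^ 'n)"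
  by (simp add: matrix_add_ldistrib matrix_add_rdistrib)

lemma conj_scaleR: "transpose Q ** (c *\<^sub>R A) ** Q = c *\<^sub>R (transpose Q ** A ** (Q :: real ^ 'n ^ 'n))"
  by (simp add: matrix_scalar_ac scalar_matrix_assoc)

lemma mat_scaleR: "(mat t :: real ^ 'n ^ 'n) = t *\<^sub>R mat 1"
  by (simp add: mat_def vec_eq_iff)

lemma conj_mat:
  assumes "orthogonal_matrix (Q :: real ^ 'n ^ 'n)"
  shows "transpose Q ** mat t ** Q = mat t"
  using assms by (subst (1 2) mat_scaleR) (simp add: conj_scaleR orthogonal_matrix_def)

lemma conj_outer: "transpose Q ** outer v w ** Q = outer (v v* Q) (w v* (Q :: real ^ 'n ^ 'n))"
proof -
  have "(transpose Q ** outer v w ** Q) $ i $ j = outer (v v* Q) (w v* Q) $ i $ j" for i j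
  proof -
    have "(transpose Q ** outer v w ** Q) $ i $ j = (\<Sum>b\<in>UNIV. (\<Sum>a\<in>UNIV. Q $ a $ i * (v $ a * w $ b)) * Q $ b $ j)"
      by (simp add: matrix_matrix_mult_def transpose_def outer_def)
    also have "\<dots> = (\<Sum>b\<in>UNIV. (\<Sum>a\<in>UNIV. v $ a * Q $ a $ i) * (w $ b * Q $ b $ j))"
      by (simp add: sum_distrib_right sum_distrib_left mult_ac)
    also have "\<dots> = (\<Sum>a\<in>UNIV. v $ a * Q $ a $ i) * (\<Sum>b\<in>UNIV. w $ b * Q $ b $ j)"
      by (simp add: sum_distrib_left)
    finally show ?thesis by (simp add: outer_def vector_matrix_mult_def mult.commute)
  qed
  then show ?thesis by (simp add: vec_eq_iff)
qed

lemma det_conj: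
  assumes "orthogonal_matrix (Q :: real ^ 'n ^ 'n)"
  shows "det (transpose Q ** A ** Q) = det A"
  using det_orthogonal_matrix[OF assms] by (auto simp: det_mul)

lemma det_diagm: "det (diagm l) = (\<Prod>i\<in>UNIV. l $ i)"
  by (subst det_diagonal) (auto simp: diagm_def)

lemma diagm_add_mat: "mat t + diagm l = diagm (\<chi> i. t + l $ i)"
  by (simp add: vec_eq_iff diagm_def mat_def)

text \<open>In an orthonormal basis containing the direction of v the matrix is diagonal with a
  single entry different from 1.\<close>

lemma det_mat_1_plus_outer:
  fixes v :: "real ^ 'n"
  shows "det (mat 1 + s *\<^sub>R outer v v) = 1 + s * (v \<bullet> v)"
proof (cases "v = 0")
  case True
  then have "outer v v = 0" by (simp add: outer_def vec_eq_iff)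
  with True show ?thesis by simp
next
  case False
  define k :: 'n where "k = undefined"
  obtain Q :: "real ^ 'n ^ 'n" where Q: "orthogonal_matrix Q" "Q *v axis k 1 = v /\<^sub>R norm v"
    using orthogonal_matrix_exists_basis[of "v /\<^sub>R norm v" k] False by auto
  have "v v* Q = transpose Q *v (norm v *\<^sub>R (Q *v axis k 1))"
    using Q(2) False by simp
  also have "\<dots> = norm v *\<^sub>R ((transpose Q ** Q) *v axis k 1)"
    by (simp add: matrix_vector_mult_scaleR matrix_vector_mul_assoc del: transpose_matrix_vector)
  finally have vQ: "v v* Q = norm v *\<^sub>R axis k 1"
    using Q(1) by (simp add: orthogonal_matrix_def)
  have "det (mat 1 + s *\<^sub>R outer v v) = det (mat 1 + s *\<^sub>R outer (norm v *\<^sub>R axis k 1) (norm v *\<^sub>R axis k (1 :: real)))"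
    unfolding det_conj[OF Q(1), of "mat 1 + s *\<^sub>R outer v v", symmetric]
    unfolding conj_add conj_scaleR conj_mat[OF Q(1)] conj_outer vQ ..
  also have "mat 1 + s *\<^sub>R outer (norm v *\<^sub>R axis k 1) (norm v *\<^sub>R axis k (1 :: real))
      = diagm (\<chi> i. if i = k then 1 + s * (v \<bullet> v) else 1)"
    by (auto simp: vec_eq_iff mat_def outer_def diagm_def axis_def dot_square_norm power2_eq_square)
  also have "det \<dots> = 1 + s * (v \<bullet> v)"
    by (simp add: det_diagm prod.delta)
  finally show ?thesis .
qed

text \<open>Extracting the square root of the diagonal on both sides reduces this to a rank-one
  perturbation of the identity. In the application the positive entries are produced by adding a
  large multiple of the identity.\<close>

lemma det_diagm_plus_outer:
  assumes pos: "\<And>i. 0 < d $ i"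
  shows "det (diagm d + s *\<^sub>R outer c c) = (\<Prod>i\<in>UNIV. d $ i) + s * (\<Sum>i\<in>UNIV. (c $ i)\<^sup>2 * (\<Prod>j\<in>UNIV - {i}. d $ j))"
proof -
  define R where "R = diagm (\<chi> i. sqrt (d $ i))"
  define v where "v = (\<chi> i. c $ i / sqrt (d $ i))"
  have sq: "sqrt (d $ i) * sqrt (d $ i) = d $ i" "\<bar>d $ i\<bar> = d $ i" for i
    using less_imp_le[OF pos[of i]] by simp_all
  have RMR: "(R ** M ** R) $ i $ j = sqrt (d $ i) * M $ i $ j * sqrt (d $ j)" for M i j
    unfolding R_def diagm_def by (simp add: matrix_matrix_mult_def if_distrib if_distribR sum.delta cong: if_cong)
  have vc: "sqrt (d $ i) * v $ i = c $ i" for i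
    using pos[of i] by (simp add: v_def)
  have "diagm d + s *\<^sub>R outer c c = R ** (mat 1 + s *\<^sub>R outer v v) ** R"
    unfolding vec_eq_iff RMR
  proof (intro allI)
    fix i j
    have "sqrt (d $ i) * (mat 1 + s *\<^sub>R outer v v) $ i $ j * sqrt (d $ j)
        = (if i = j then d $ i else 0) + s * ((sqrt (d $ i) * v $ i) * (sqrt (d $ j) * v $ j))"
    proof -
      have "sqrt (d $ i) * (m + s * (v $ i * v $ j)) * sqrt (d $ j) = sqrt (d $ i) * m * sqrt (d $ j)
          + s * ((sqrt (d $ i) * v $ i) * (sqrt (d $ j) * v $ j))" for m
        by (simp add: algebra_simps)
      from this[of "if i = j then 1 else 0"] show ?thesis
        by (auto simp: mat_def outer_def sq)
    qed
    then show "(diagm d + s *\<^sub>R outer c c) $ i $ j = sqrt (d $ i) * (mat 1 + s *\<^sub>R outer v v) $ i $ j * sqrt (d $ j)"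
      unfolding vc by (simp add: diagm_def outer_def)
  qed
  then have "det (diagm d + s *\<^sub>R outer c c) = det R * (1 + s * (v \<bullet> v)) * det R"
    by (simp add: det_mul det_mat_1_plus_outer)
  also have "\<dots> = (\<Prod>i\<in>UNIV. d $ i) * (1 + s * (v \<bullet> v))"
  proof -
    have "det R * det R = (\<Prod>i\<in>UNIV. d $ i)"
      unfolding R_def det_diagm by (simp add: prod.distrib[symmetric] sq)
    then show ?thesis by (simp add: mult.commute mult.left_commute)
  qed
  also have "v \<bullet> v = (\<Sum>i\<in>UNIV. (c $ i)\<^sup>2 / d $ i)"
    by (simp add: inner_vec_def v_def power2_eq_square sq)
  also have "(\<Prod>i\<in>UNIV. d $ i) * (1 + s * \<dots>) = (\<Prod>i\<in>UNIV. d $ i) + s * (\<Sum>i\<in>UNIV. (\<Prod>i\<in>UNIV. d $ i) * ((c $ i)\<^sup>2 / d $ i))"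
    by (simp add: distrib_left sum_distrib_left mult.left_commute)
  also have "(\<Sum>i\<in>UNIV. (\<Prod>i\<in>UNIV. d $ i) * ((c $ i)\<^sup>2 / d $ i)) = (\<Sum>i\<in>UNIV. (c $ i)\<^sup>2 * (\<Prod>j\<in>UNIV - {i}. d $ j))"
  proof (intro sum.cong refl)
    fix i
    have "(\<Prod>i\<in>UNIV. d $ i) = d $ i * (\<Prod>j\<in>UNIV - {i}. d $ j)"
      by (rule prod.remove) auto
    then show "(\<Prod>i\<in>UNIV. d $ i) * ((c $ i)\<^sup>2 / d $ i) = (c $ i)\<^sup>2 * (\<Prod>j\<in>UNIV - {i}. d $ j)"
      using pos[of i] by simp
  qed
  finally show ?thesis .
qed

lemma eigenvalues_of_spectral:
  assumes "orthogonal_matrix Q" "transpose Q ** A ** Q = diagm l"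
  shows "eigenvalues_of A l"
  unfolding eigenvalues_of_def
proof
  fix t
  have "det (mat t - A) = det (transpose Q ** (mat t + (-1) *\<^sub>R A) ** Q)"
    by (simp add: det_conj[OF assms(1)])
  also have "transpose Q ** (mat t + (-1) *\<^sub>R A) ** Q = diagm (\<chi> i. t - l $ i)"
    unfolding conj_add conj_scaleR conj_mat[OF assms(1)] assms(2)
    by (simp add: vec_eq_iff mat_def diagm_def)
  finally show "det (mat t - A) = (\<Prod>i\<in>UNIV. t - l $ i)"
    by (simp add: det_diagm)
qed

lemma det_mat: "det (mat t :: real ^ 'n ^ 'n) = (\<Prod>i\<in>(UNIV :: 'n set). t)"
  by (subst det_diagonal) (auto simp: mat_def)

lemma det_mat_add:
  fixes A :: "real ^ 'n ^ 'n"
  assumes "eigenvalues_of A l"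
  shows "det (mat t + A) = (\<Prod>i\<in>UNIV. t + l $ i)"
proof -
  have neg: "- M = mat (- 1) ** M" for M :: "real ^ 'n ^ 'n"
  proof -
    have "mat (- 1) ** M = (- 1) *\<^sub>R (mat 1 ** M)"
      unfolding mat_scaleR[of "- 1"] by (simp only: scalar_matrix_assoc)
    then show ?thesis by simp
  qed
  have "mat t + A = - (mat (- t) - A)"
    by (simp add: mat_def vec_eq_iff)
  also have "\<dots> = mat (- 1) ** (mat (- t) - A)" by (rule neg)
  also have "det \<dots> = (\<Prod>i\<in>(UNIV :: 'n set). - 1) * (\<Prod>i\<in>UNIV. - t - l $ i)"
    using assms unfolding det_mul det_mat eigenvalues_of_def by simp
  also have "\<dots> = (\<Prod>i\<in>UNIV. t + l $ i)"
    unfolding prod.distrib[symmetric] by (intro prod.cong) auto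
  finally show ?thesis .
qed

text \<open>The determinant formula for rank-one updates is available only for large t, where
  \<open>mat t + A\<close> is positive definite; polynomials are therefore compared on a
  half-line.\<close>

lemma poly_eqI_eventually:
  assumes "\<And>t. t > T \<Longrightarrow> poly p t = poly q (t :: real)"
  shows "p = q"
proof (rule ccontr)
  assume "p \<noteq> q"
  then have "finite {t. poly (p - q) t = 0}" by (intro poly_roots_finite) auto
  moreover have "{T<..} \<subseteq> {t. poly (p - q) t = 0}" using assms by auto
  ultimately have "finite {T<..}" by (rule rev_finite_subset)
  then show False using infinite_Ioi by blast
qed

text \<open>\<open>eigenvalues_of\<close> leaves the order of the entries open. Comparing
  coefficients of \<open>det (mat t + A)\<close> shows that symmetric functions of the eigenvalues
  depend on the matrix alone.\<close>

lemma esym_eigenvalues_unique: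
  assumes "eigenvalues_of A l" "eigenvalues_of A l'"
  shows "esym UNIV j (\<lambda>i. l $ i) = esym UNIV j (\<lambda>i. l' $ i)"
proof (cases "j \<le> CARD('a)")
  case True
  have "(\<Prod>i\<in>UNIV. [:l $ i, 1:]) = (\<Prod>i\<in>UNIV. [:l' $ i, 1:])"
    using det_mat_add[OF assms(1)] det_mat_add[OF assms(2)]
    by (intro poly_eqI_eventually[of 0]) (simp add: poly_prod add.commute)
  then show ?thesis
    using coeff_prod_linear[of "UNIV :: 'a set" "\<lambda>i. l $ i" "CARD('a) - j"]
      coeff_prod_linear[of "UNIV :: 'a set" "\<lambda>i. l' $ i" "CARD('a) - j"] True by simp
qed (simp add: esym_eq_0)

text \<open>Expand \<open>det (mat t + A + s *\<^sub>R outer e e)\<close> in an eigenbasis of A and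
  compare coefficients in t. Because the perturbation has rank one, the dependence on s is exactly
  affine, and the slope is a combination of the deleted symmetric functions controlled by
  \<open>esym_remove_pos\<close>.\<close>

theorem esym_rank_one_update:
  fixes A :: "real ^ 'n ^ 'n"
  assumes Q: "orthogonal_matrix Q" "transpose Q ** A ** Q = diagm l"
    and l': "eigenvalues_of (A + s *\<^sub>R outer e e) l'"
  shows "esym UNIV (Suc j) (\<lambda>i. l' $ i) = esym UNIV (Suc j) (\<lambda>i. l $ i)
     + s * (\<Sum>i\<in>UNIV. ((e v* Q) $ i)\<^sup>2 * esym (UNIV - {i}) j (\<lambda>i. l $ i))"
proof (cases "Suc j \<le> CARD('n)")
  case True
  let ?c = "e v* Q"
  let ?q = "(\<Prod>i\<in>UNIV. [:l $ i, 1:]) + smult s (\<Sum>i\<in>UNIV. smult ((?c $ i)\<^sup>2) (\<Prod>j\<in>UNIV - {i}. [:l $ j, 1:]))"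
  define T where "T = (\<Sum>i\<in>UNIV. \<bar>l $ i\<bar>)"
  have eq: "(\<Prod>i\<in>UNIV. [:l' $ i, 1:]) = ?q"
  proof (rule poly_eqI_eventually[of T])
    fix t assume t: "t > T"
    have pos: "0 < t + l $ i" for i
    proof -
      have "\<bar>l $ i\<bar> \<le> T" unfolding T_def by (rule member_le_sum) auto
      then show ?thesis using t by linarith
    qed
    have "poly (\<Prod>i\<in>UNIV. [:l' $ i, 1:]) t = det (mat t + (A + s *\<^sub>R outer e e))"
      by (simp add: det_mat_add[OF l'] poly_prod add.commute)
    also have "\<dots> = det (transpose Q ** ((mat t + A) + s *\<^sub>R outer e e) ** Q)"
      by (simp add: det_conj[OF Q(1)] add.assoc)
    also have "\<dots> = det (diagm (\<chi> i. t + l $ i) + s *\<^sub>R outer ?c ?c)"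
      unfolding conj_add conj_scaleR conj_mat[OF Q(1)] conj_outer Q(2) diagm_add_mat ..
    also have "\<dots> = poly ?q t"
      by (subst det_diagm_plus_outer) (simp_all add: pos poly_prod poly_sum add.commute)
    finally show "poly (\<Prod>i\<in>UNIV. [:l' $ i, 1:]) t = poly ?q t" .
  qed
  \<comment> \<open>The inner product has one factor fewer, so the same coefficient index belongs to
    e_j instead of e_(j+1).\<close>
  have "CARD('n) - Suc j \<le> CARD('n) - 1" "CARD('n) - Suc 0 - (CARD('n) - Suc j) = j" using True by auto
  then have c: "coeff (\<Prod>j\<in>UNIV - {i}. [:l $ j, 1:]) (CARD('n) - Suc j) = esym (UNIV - {i}) j (\<lambda>i. l $ i)" for i
    by (subst coeff_prod_linear) auto
  have "esym UNIV (Suc j) (\<lambda>i. l' $ i) = coeff ?q (CARD('n) - Suc j)"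
    unfolding eq[symmetric] using True by (subst coeff_prod_linear) auto
  also have "\<dots> = esym UNIV (Suc j) (\<lambda>i. l $ i) + s * (\<Sum>i\<in>UNIV. (?c $ i)\<^sup>2 * esym (UNIV - {i}) j (\<lambda>i. l $ i))"
    using True by (simp add: coeff_sum c coeff_prod_linear)
  finally show ?thesis .
next
  case False
  then have "card (UNIV - {i :: 'n}) < j" if "j \<noteq> 0" for i using that by auto
  moreover have "j \<noteq> 0" using False zero_less_card_finite[where 'a = 'n] by (intro notI) simp
  ultimately show ?thesis using False by (simp add: esym_eq_0)
qed

lemma symmetric_spectral:
  fixes A :: "real ^ 'n ^ 'n"
  assumes "transpose A = A"
  obtains l where "eigenvalues_of A l"
  using spectral_theorem[OF assms] eigenvalues_of_spectral by metis

lemma garding_cong: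
  assumes "eigenvalues_of A l" "eigenvalues_of A l'" "garding k (\<lambda>i. l $ i)"
  shows "garding k (\<lambda>i. l' $ i)"
  using assms esym_eigenvalues_unique[OF assms(1,2)] by (simp add: garding_def)

lemma transpose_add: "transpose (A + B) = transpose A + transpose (B :: real ^ 'n ^ 'm)"
  by (simp add: transpose_def vec_eq_iff)

lemma transpose_outer: "transpose (outer v v) = outer v v"
  by (simp add: transpose_def vec_eq_iff outer_def)

lemma garding_rank_one:
  fixes A :: "real ^ 'n ^ 'n"
  assumes sym: "transpose A = A" and l: "eigenvalues_of A l" "garding k (\<lambda>i. l $ i)" and "0 \<le> s"
    and l': "eigenvalues_of (A + s *\<^sub>R outer e e) l'"
  shows "garding k (\<lambda>i. l' $ i)" "esym UNIV k (\<lambda>i. l $ i) \<le> esym UNIV k (\<lambda>i. l' $ i)"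
proof -
  obtain Q m where Q: "orthogonal_matrix Q" "transpose Q ** A ** Q = diagm m"
    using spectral_theorem[OF sym] .
  have m: "eigenvalues_of A m" using Q by (rule eigenvalues_of_spectral)
  then have gm: "garding k (\<lambda>i. m $ i)" using garding_cong l by blast
  have le: "esym UNIV j (\<lambda>i. m $ i) \<le> esym UNIV j (\<lambda>i. l' $ i)" if "j \<le> k" for j
  proof (cases j)
    case (Suc i)
    have "0 < esym (UNIV - {x}) i (\<lambda>i. m $ i)" for x
      using gm that Suc by (intro esym_remove_pos[where k = k]) (auto simp: garding_def)
    then show ?thesis
      unfolding Suc esym_rank_one_update[OF Q l'] using \<open>0 \<le> s\<close>
      by (simp add: mult_nonneg_nonneg sum_nonneg less_imp_le)
  qed (simp add: esym_0)
  show "garding k (\<lambda>i. l' $ i)"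
    using le gm unfolding garding_def by (meson order_less_le_trans)
  show "esym UNIV k (\<lambda>i. l $ i) \<le> esym UNIV k (\<lambda>i. l' $ i)"
    using le[of k] esym_eigenvalues_unique[OF l(1) m, of k] by simp
qed


lemma spectral_quadratic:
  "l $ i = (Q *v axis i 1) \<bullet> (A *v (Q *v axis i (1 :: real)))" if "transpose Q ** A ** Q = diagm l"
proof -
  have "l $ i = axis i 1 \<bullet> ((transpose Q ** A ** Q) *v axis i 1)"
    unfolding that by (simp add: inner_axis' matrix_vector_mult_basis column_def diagm_def)
  also have "\<dots> = (Q *v axis i 1) \<bullet> (A *v (Q *v axis i 1))"
    unfolding matrix_vector_mul_assoc[symmetric]
    by (metis dot_lmul_matrix transpose_transpose vector_transpose_matrix)
  finally show ?thesis .
qed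

text \<open>B - A is a sum of rank-one matrices with nonnegative coefficients, which are added one
  at a time. That B lies in the cone is part of the conclusion; in \<open>ellipticity\<close>
  nothing is known beforehand about the larger matrix.\<close>

theorem garding_mono:
  fixes A B :: "real ^ 'n ^ 'n"
  assumes sym: "transpose A = A" "transpose B = B"
    and l: "eigenvalues_of A l" "garding k (\<lambda>i. l $ i)" and l': "eigenvalues_of B l'"
    and le: "\<And>v. v \<bullet> (A *v v) \<le> v \<bullet> (B *v v)"
  shows "garding k (\<lambda>i. l' $ i)" "esym UNIV k (\<lambda>i. l $ i) \<le> esym UNIV k (\<lambda>i. l' $ i)"
proof -
  have "transpose (B - A) = B - A"
    using sym by (simp add: transpose_def vec_eq_iff)
  then obtain Q d where Q: "orthogonal_matrix Q" "transpose Q ** (B - A) ** Q = diagm d"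
    by (rule spectral_theorem)
  have d: "0 \<le> d $ i" for i
  proof -
    have "0 \<le> (Q *v axis i 1) \<bullet> ((B - A) *v (Q *v axis i 1))"
      using le[of "Q *v axis i 1"] by (simp add: matrix_vector_mult_diff_rdistrib inner_diff_right)
    then show ?thesis using spectral_quadratic[OF Q(2), of i] by simp
  qed
  have BA: "B - A = (\<Sum>i\<in>UNIV. d $ i *\<^sub>R outer (column i Q) (column i Q))"
  proof -
    have "B - A = (Q ** transpose Q) ** (B - A) ** (Q ** transpose Q)"
      using Q(1) by (simp add: orthogonal_matrix_def)
    also have "\<dots> = Q ** (transpose Q ** (B - A) ** Q) ** transpose Q"
      by (simp only: matrix_mul_assoc)
    also have "\<dots> = (\<Sum>i\<in>UNIV. d $ i *\<^sub>R outer (column i Q) (column i Q))"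
      unfolding Q(2)
      by (simp add: vec_eq_iff matrix_matrix_mult_def diagm_def outer_def column_def transpose_def
          if_distrib if_distribR sum.delta mult_ac cong: if_cong)
    finally show ?thesis .
  qed
  define P where "P S = A + (\<Sum>i\<in>S. d $ i *\<^sub>R outer (column i Q) (column i Q))" for S
  have "transpose (P S) = P S \<and> (\<forall>m. eigenvalues_of (P S) m \<longrightarrow>
     garding k (\<lambda>i. m $ i) \<and> esym UNIV k (\<lambda>i. l $ i) \<le> esym UNIV k (\<lambda>i. m $ i))" if "finite S" for S
    using that
  proof (induction S rule: finite_induct)
    case empty
    then show ?case
      using sym l garding_cong[OF l(1)] esym_eigenvalues_unique[OF l(1)] by (auto simp: P_def)
  next
    case (insert i S)
    have P: "P (insert i S) = P S + d $ i *\<^sub>R outer (column i Q) (column i Q)"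
      using insert by (simp add: P_def algebra_simps)
    obtain m where m: "eigenvalues_of (P S) m" using insert.IH symmetric_spectral by blast
    show ?case
      using insert.IH m garding_rank_one[of "P S" m k "d $ i" "column i Q"] d[of i]
      unfolding P by (auto simp: transpose_add transpose_scalar transpose_outer intro: order_trans)
  qed
  from this[of UNIV] show "garding k (\<lambda>i. l' $ i)" "esym UNIV k (\<lambda>i. l $ i) \<le> esym UNIV k (\<lambda>i. l' $ i)"
    using l' by (auto simp: P_def BA[symmetric])
qed

lemma eigenvalues_of_scaleR:
  assumes "eigenvalues_of A l" "c \<noteq> 0"
  shows "eigenvalues_of (c *\<^sub>R A) (c *\<^sub>R (l :: real ^ 'n))"
  unfolding eigenvalues_of_def
proof
  fix t
  have "mat t - c *\<^sub>R A = mat c ** (mat (t / c) - A)"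
  proof -
    have "mat c ** (mat (t / c) - A) = c *\<^sub>R (mat 1 ** (mat (t / c) - A))"
      unfolding mat_scaleR[of c] by (simp only: scalar_matrix_assoc)
    then show ?thesis using assms(2)
      unfolding matrix_mul_lid by (simp add: vec_eq_iff mat_def right_diff_distrib)
  qed
  then have "det (mat t - c *\<^sub>R A) = (\<Prod>i\<in>(UNIV :: 'n set). c) * (\<Prod>i\<in>UNIV. t / c - l $ i)"
    using assms(1) by (simp only: det_mul det_mat eigenvalues_of_def)
  also have "\<dots> = (\<Prod>i\<in>UNIV. t - (c *\<^sub>R l) $ i)"
    unfolding prod.distrib[symmetric] using assms(2) by (intro prod.cong) (auto simp: algebra_simps)
  finally show "det (mat t - c *\<^sub>R A) = (\<Prod>i\<in>UNIV. t - (c *\<^sub>R l) $ i)" .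
qed

section \<open>Quantitative ellipticity\<close>

lemma esym_scale:
  "esym I j (\<lambda>i. c * f i) = c ^ j * esym I j f"
proof -
  have "esym I j (\<lambda>i. c * f i) = (\<Sum>S | S \<subseteq> I \<and> card S = j. c ^ j * (\<Prod>i\<in>S. f i))"
    unfolding esym_def by (intro sum.cong) (auto simp: prod.distrib)
  then show ?thesis by (simp add: esym_def sum_distrib_left)
qed

lemma garding_scale:
  "0 < c \<Longrightarrow> garding k f \<Longrightarrow> garding k (\<lambda>i. c * f i)"
  by (simp add: garding_def esym_scale)

text \<open>Induction on the index set. The bound for the product itself is carried along because
  the increment of \<open>f x * \<Prod>\<close> consists of a bounded factor times the old increment
  and of \<open>t * c\<close> times the old product; this is the origin of L.\<close>

lemma prod_shift_bound:
  fixes \<Lambda> c :: real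
  assumes "finite S"
  shows "\<exists>K\<ge>0. \<forall>f t. (\<forall>i\<in>S. \<bar>f i\<bar> \<le> \<Lambda>) \<longrightarrow> 0 \<le> t \<longrightarrow> t \<le> 1 \<longrightarrow>
     \<bar>\<Prod>i\<in>S. f i\<bar> \<le> K \<and> \<bar>(\<Prod>i\<in>S. f i + t * c) - (\<Prod>i\<in>S. f i)\<bar> \<le> K * t"
  using assms
proof (induction S rule: finite_induct)
  case empty
  show ?case by (intro exI[of _ 1]) auto
next
  case (insert x S)
  then obtain K where K: "K \<ge> 0" "\<And>f t. (\<And>i. i \<in> S \<Longrightarrow> \<bar>f i\<bar> \<le> \<Lambda>) \<Longrightarrow> 0 \<le> t \<Longrightarrow> t \<le> 1 \<Longrightarrow>
     \<bar>\<Prod>i\<in>S. f i\<bar> \<le> K \<and> \<bar>(\<Prod>i\<in>S. f i + t * c) - (\<Prod>i\<in>S. f i)\<bar> \<le> K * t"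
    by blast
  define L where "L = (\<bar>\<Lambda>\<bar> + \<bar>c\<bar>) * K + \<bar>c\<bar> * K"
  show ?case
  proof (intro exI[of _ L] conjI allI impI)
    show "0 \<le> L" using K by (simp add: L_def)
    fix f t assume f: "\<forall>i\<in>insert x S. \<bar>f i\<bar> \<le> \<Lambda>" and t: "0 \<le> t" "t \<le> (1 :: real)"
    let ?p = "\<Prod>i\<in>S. f i" and ?q = "\<Prod>i\<in>S. f i + t * c"
    have b: "\<bar>?p\<bar> \<le> K" "\<bar>?q - ?p\<bar> \<le> K * t" using K(2)[of f t] f t by auto
    have fx: "\<bar>f x\<bar> \<le> \<bar>\<Lambda>\<bar>" using f by auto
    have tc: "\<bar>t * c\<bar> \<le> \<bar>c\<bar>" using t by (simp add: abs_mult mult_left_le_one_le)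
    have "\<bar>f x * ?p\<bar> \<le> \<bar>\<Lambda>\<bar> * K" unfolding abs_mult using b fx by (intro mult_mono) auto
    also have "\<dots> \<le> L" using K(1) by (simp add: L_def distrib_right)
    finally show "\<bar>\<Prod>i\<in>insert x S. f i\<bar> \<le> L" using insert by simp
    have "\<bar>(f x + t * c) * (?q - ?p)\<bar> \<le> (\<bar>\<Lambda>\<bar> + \<bar>c\<bar>) * (K * t)"
      unfolding abs_mult using b fx tc by (intro mult_mono) auto
    moreover have "\<bar>t * c * ?p\<bar> \<le> \<bar>c\<bar> * K * t"
      using mult_left_mono[OF b(1), of "t * \<bar>c\<bar>"] t by (simp add: abs_mult mult_ac)
    moreover have "(f x + t * c) * ?q - f x * ?p = (f x + t * c) * (?q - ?p) + t * c * ?p"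
      by (simp add: algebra_simps)
    ultimately have "\<bar>(f x + t * c) * ?q - f x * ?p\<bar> \<le> L * t"
      unfolding L_def by (simp add: algebra_simps abs_le_iff)
    then show "\<bar>(\<Prod>i\<in>insert x S. f i + t * c) - (\<Prod>i\<in>insert x S. f i)\<bar> \<le> L * t"
      using insert by simp
  qed
qed

lemma esym_shift_bound:
  fixes \<Lambda> c :: real
  shows "\<exists>K\<ge>0. \<forall>(f :: 'a::finite \<Rightarrow> real) t. (\<forall>i. \<bar>f i\<bar> \<le> \<Lambda>) \<longrightarrow> 0 \<le> t \<longrightarrow> t \<le> 1 \<longrightarrow>
     esym UNIV k (\<lambda>i. f i + t * c) \<le> esym UNIV k f + K * t"
proof -
  define P where "P S L \<longleftrightarrow> 0 \<le> L \<and> (\<forall>f (t :: real). (\<forall>i\<in>S. \<bar>f i\<bar> \<le> \<Lambda>) \<longrightarrow> 0 \<le> t \<longrightarrow> t \<le> 1 \<longrightarrow>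
     \<bar>\<Prod>i\<in>S. f i\<bar> \<le> L \<and> \<bar>(\<Prod>i\<in>S. f i + t * c) - (\<Prod>i\<in>S. f i)\<bar> \<le> L * t)" for S :: "'a set" and L :: real
  have "\<exists>L. P S L" for S
    unfolding P_def by (rule prod_shift_bound) simp
  then obtain K where "\<And>S. P S (K S)" by metis
  then have K: "0 \<le> K S" for S
    unfolding P_def by auto
  have K': "\<bar>(\<Prod>i\<in>S. f i + t * c) - (\<Prod>i\<in>S. f i)\<bar> \<le> K S * t"
    if "\<forall>i\<in>S. \<bar>f i\<bar> \<le> \<Lambda>" "0 \<le> t" "t \<le> 1" for S f and t :: real
    using \<open>\<And>S. P S (K S)\<close> that unfolding P_def by auto
  show ?thesis
  proof (intro exI[of _ "\<Sum>S\<in>{S. S \<subseteq> UNIV \<and> card S = k}. K S"] conjI allI impI)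
    show "0 \<le> (\<Sum>S\<in>{S. S \<subseteq> UNIV \<and> card S = k}. K S)" by (intro sum_nonneg K)
    fix f :: "'a \<Rightarrow> real" and t :: real assume f: "\<forall>i. \<bar>f i\<bar> \<le> \<Lambda>" and t: "0 \<le> t" "t \<le> 1"
    have "(\<Prod>i\<in>S. f i + t * c) \<le> (\<Prod>i\<in>S. f i) + K S * t" for S
      using K'[of S f t] f t by (simp add: abs_le_iff)
    then show "esym UNIV k (\<lambda>i. f i + t * c) \<le> esym UNIV k f + (\<Sum>S\<in>{S. S \<subseteq> UNIV \<and> card S = k}. K S) * t"
      unfolding esym_def sum_distrib_right sum.distrib[symmetric] by (intro sum_mono)
  qed
qed

text \<open>Compactness: bounded vectors with e_j \<ge> 0 for j < k and e_k \<ge> 1 form a compact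
  set, which by \<open>garding_closure\<close> lies in the open cone, where the partial derivatives
  of sigma_k are positive.\<close>

lemma esym_deriv_lower_bound:
  fixes \<Lambda> :: real
  assumes "1 \<le> k"
  obtains b where "0 < b"
    "\<And>(l :: real ^ 'n) i. \<lbrakk>\<And>i. \<bar>l $ i\<bar> \<le> \<Lambda>; garding k (\<lambda>i. l $ i); 1 \<le> esym UNIV k (\<lambda>i. l $ i)\<rbrakk>
       \<Longrightarrow> b \<le> esym (UNIV - {i}) (k - 1) (\<lambda>i. l $ i)"
proof -
  define C where "C = {l :: real ^ 'n. \<forall>i. \<bar>l $ i\<bar> \<le> \<Lambda>} \<inter>
     ((\<Inter>j\<in>{..<k}. {l. 0 \<le> esym UNIV j (\<lambda>i. l $ i)}) \<inter> {l. 1 \<le> esym UNIV k (\<lambda>i. l $ i)})"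
  have "{l :: real ^ 'n. \<forall>i. \<bar>l $ i\<bar> \<le> \<Lambda>} = cbox (\<chi> i. - \<Lambda>) (\<chi> i. \<Lambda>)"
    by (auto simp: mem_box_cart abs_le_iff) (metis minus_le_iff)+
  then have cC: "compact C"
    unfolding C_def
    by (auto intro!: compact_Int_closed closed_Int closed_INT closed_Collect_le continuous_on_esym)
  have gC: "garding k (\<lambda>i. l $ i)" if "l \<in> C" for l
    using that unfolding C_def by (intro garding_closure) auto
  have pos: "0 < esym (UNIV - {i}) (k - 1) (\<lambda>i. l $ i)" if "l \<in> C" for l i
    using gC[OF that] assms by (intro esym_remove_pos[where k = k]) (auto simp: garding_def)
  have "\<exists>b>0. \<forall>l\<in>C. b \<le> esym (UNIV - {i}) (k - 1) (\<lambda>i. l $ i)" for i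
  proof (cases "C = {}")
    case False
    then obtain l where "l \<in> C" "\<forall>y\<in>C. esym (UNIV - {i}) (k - 1) (\<lambda>i. l $ i) \<le> esym (UNIV - {i}) (k - 1) (\<lambda>i. y $ i)"
      using continuous_attains_inf[OF cC False continuous_on_esym] by blast
    then show ?thesis using pos by blast
  qed (auto intro: exI[of _ 1])
  then obtain b where b: "\<And>i. 0 < b i" "\<And>i l. l \<in> C \<Longrightarrow> b i \<le> esym (UNIV - {i}) (k - 1) (\<lambda>i. l $ i)"
    by metis
  show ?thesis
  proof (rule that[of "Min (range b)"])
    show "0 < Min (range b)" using b(1) by (subst Min_gr_iff) auto
    fix l :: "real ^ 'n" and i
    assume "\<And>i. \<bar>l $ i\<bar> \<le> \<Lambda>" "garding k (\<lambda>i. l $ i)" "1 \<le> esym UNIV k (\<lambda>i. l $ i)"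
    then have "l \<in> C" by (auto simp: C_def garding_def intro: less_imp_le)
    have "Min (range b) \<le> b i" by (rule Min_le) auto
    also have "\<dots> \<le> esym (UNIV - {i}) (k - 1) (\<lambda>i. l $ i)" by (rule b(2)[OF \<open>l \<in> C\<close>])
    finally show "Min (range b) \<le> esym (UNIV - {i}) (k - 1) (\<lambda>i. l $ i)" .
  qed
qed


lemma inner_outer: "v \<bullet> (outer a b *v w) = (a \<bullet> v) * (b \<bullet> (w :: real ^ 'n))"
proof -
  have "v \<bullet> (outer a b *v w) = (\<Sum>i\<in>UNIV. v $ i * (\<Sum>j\<in>UNIV. a $ i * b $ j * w $ j))"
    by (simp add: inner_vec_def matrix_vector_mult_def outer_def)
  also have "\<dots> = (\<Sum>i\<in>UNIV. v $ i * a $ i * (\<Sum>j\<in>UNIV. b $ j * w $ j))"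
    by (simp add: sum_distrib_left mult_ac)
  also have "\<dots> = (\<Sum>i\<in>UNIV. v $ i * a $ i) * (\<Sum>j\<in>UNIV. b $ j * w $ j)"
    by (simp only: sum_distrib_right)
  also have "\<dots> = (a \<bullet> v) * (b \<bullet> w)"
    by (simp add: inner_vec_def mult.commute)
  finally show ?thesis .
qed

lemma orthogonal_matrix_norm:
  assumes "orthogonal_matrix (Q :: real ^ 'n ^ 'n)"
  shows "(Q *v x) \<bullet> (Q *v x) = x \<bullet> x" "(x v* Q) \<bullet> (x v* Q) = x \<bullet> x"
proof -
  have *: "(M *v x) \<bullet> (M *v x) = x \<bullet> x" if "transpose M ** M = mat 1" for M :: "real ^ 'n ^ 'n"
  proof -
    have "(M *v x) \<bullet> (M *v x) = x \<bullet> ((transpose M ** M) *v x)"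
      unfolding matrix_vector_mul_assoc[symmetric]
      by (metis dot_lmul_matrix transpose_transpose vector_transpose_matrix)
    then show ?thesis using that by simp
  qed
  show "(Q *v x) \<bullet> (Q *v x) = x \<bullet> x"
    using assms by (intro *) (simp add: orthogonal_matrix_def)
  show "(x v* Q) \<bullet> (x v* Q) = x \<bullet> x"
    using assms *[of "transpose Q"] by (simp add: orthogonal_matrix_def)
qed

definition admissible :: "nat \<Rightarrow> real ^ 'n ^ 'n \<Rightarrow> bool" where
  "admissible k A \<longleftrightarrow> transpose A = A \<and>
     (\<exists>l. eigenvalues_of A l \<and> garding k (\<lambda>i. l $ i) \<and> esym UNIV k (\<lambda>i. l $ i) = 1)"

text \<open>After division by \<theta>, the matrix A' lies below A raised by \<tau> c in all
  directions and lowered by \<tau> N in the direction e. Raising adds at most K \<tau> to sigma_k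
  and lowering removes at least N b \<tau>, so \<open>N = (K + 1) / b\<close> makes the result
  smaller than 1. But sigma_k of A'/\<theta> is \<theta>^(-k) \<ge> 1. As N sees A only through
  \<Lambda>, it can be fixed before the barrier is built.\<close>

theorem ellipticity:
  fixes \<Lambda> c :: real
  assumes k: "1 \<le> k" and c: "0 \<le> c"
  obtains N where "0 < N"
    "\<And>(A :: real ^ 'n ^ 'n) A' \<theta> \<tau> e.
      \<lbrakk>admissible k A; admissible k A'; 0 < \<theta>; \<theta> \<le> 1; 0 < \<tau>; \<tau> \<le> 1; e \<bullet> e = 1;
       \<And>v. \<bar>v \<bullet> (A *v v)\<bar> \<le> \<Lambda> * (v \<bullet> v);
       \<And>v. v \<bullet> (A' *v v) \<le> \<theta> * (v \<bullet> (A *v v) + \<tau> * (c * (v \<bullet> v) - N * (e \<bullet> v)\<^sup>2))\<rbrakk> \<Longrightarrow> False"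
proof -
  obtain b where b: "0 < b" "\<And>(l :: real ^ 'n) i. \<lbrakk>\<And>i. \<bar>l $ i\<bar> \<le> \<Lambda> + c; garding k (\<lambda>i. l $ i); 1 \<le> esym UNIV k (\<lambda>i. l $ i)\<rbrakk>
       \<Longrightarrow> b \<le> esym (UNIV - {i}) (k - 1) (\<lambda>i. l $ i)"
    using esym_deriv_lower_bound[OF k, of "\<Lambda> + c"] by blast
  obtain K where K: "K \<ge> 0" "\<And>(f :: 'n \<Rightarrow> real) t. (\<forall>i. \<bar>f i\<bar> \<le> \<Lambda>) \<Longrightarrow> 0 \<le> t \<Longrightarrow> t \<le> 1 \<Longrightarrow>
     esym UNIV k (\<lambda>i. f i + t * c) \<le> esym UNIV k f + K * t"
    using esym_shift_bound[of \<Lambda> k c] by blast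
  define N where "N = (K + 1) / b"
  show ?thesis
  proof (rule that[of N])
    show "0 < N" using b(1) K(1) by (simp add: N_def add_nonneg_pos)
    fix A A' :: "real ^ 'n ^ 'n" and e :: "real ^ 'n" and \<theta> \<tau> :: real
    assume adm: "admissible k A" "admissible k A'"
      and \<theta>: "0 < \<theta>" "\<theta> \<le> 1" and \<tau>: "0 < \<tau>" "\<tau> \<le> 1" and e: "e \<bullet> e = 1"
      and bd: "\<And>v. \<bar>v \<bullet> (A *v v)\<bar> \<le> \<Lambda> * (v \<bullet> v)"
      and le: "\<And>v. v \<bullet> (A' *v v) \<le> \<theta> * (v \<bullet> (A *v v) + \<tau> * (c * (v \<bullet> v) - N * (e \<bullet> v)\<^sup>2))"
    obtain l where A: "transpose A = A" "eigenvalues_of A l" "garding k (\<lambda>i. l $ i)" "esym UNIV k (\<lambda>i. l $ i) = 1"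
      using adm(1) by (auto simp: admissible_def)
    obtain l' where A': "transpose A' = A'" "eigenvalues_of A' l'" "garding k (\<lambda>i. l' $ i)" "esym UNIV k (\<lambda>i. l' $ i) = 1"
      using adm(2) by (auto simp: admissible_def)
    obtain Q m where Q: "orthogonal_matrix Q" "transpose Q ** A ** Q = diagm m"
      using spectral_theorem[OF A(1)] .
    have m: "eigenvalues_of A m" using Q by (rule eigenvalues_of_spectral)
    have gm: "garding k (\<lambda>i. m $ i)" using garding_cong[OF A(2) m A(3)] .
    have em: "esym UNIV k (\<lambda>i. m $ i) = 1" using esym_eigenvalues_unique[OF A(2) m, of k] A(4) by simp
    have mb: "\<bar>m $ i\<bar> \<le> \<Lambda>" for i
      using bd[of "Q *v axis i 1"] spectral_quadratic[OF Q(2), of i] orthogonal_matrix_norm(1)[OF Q(1)]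
      by (simp add: inner_axis')
    \<comment> \<open>The isotropic part is added first: B stays in the cone with sigma_k \<ge> 1
      and bounded eigenvalues, so the bound b applies to it, and the rank-one subtraction from B is
      then computed exactly.\<close>
    define B where "B = A + mat (\<tau> * c)"
    define p where "p = (\<chi> i. m $ i + \<tau> * c)"
    have symB: "transpose B = B" using A(1) by (simp add: B_def transpose_add)
    have QB: "transpose Q ** B ** Q = diagm p"
      unfolding B_def conj_add conj_mat[OF Q(1)] Q(2) p_def
      by (simp add: vec_eq_iff mat_def diagm_def)
    have eB: "eigenvalues_of B p" using Q(1) QB by (rule eigenvalues_of_spectral)
    have qB: "v \<bullet> (B *v v) = v \<bullet> (A *v v) + \<tau> * c * (v \<bullet> v)" for v
      unfolding B_def by (subst mat_scaleR)
        (simp add: matrix_vector_mult_add_rdistrib inner_add_right scaleR_matrix_vector_assoc[symmetric])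
    have gp: "garding k (\<lambda>i. p $ i)" "1 \<le> esym UNIV k (\<lambda>i. p $ i)"
      using garding_mono[OF A(1) symB m gm eB] em qB \<tau> c by simp_all
    have pb: "\<bar>p $ i\<bar> \<le> \<Lambda> + c" for i
    proof -
      have "\<tau> * c \<le> 1 * c" "0 \<le> \<tau> * c" using \<tau> c by (intro mult_right_mono mult_nonneg_nonneg; simp)+
      then show ?thesis using mb[of i] by (simp add: p_def abs_le_iff)
    qed
    have up: "esym UNIV k (\<lambda>i. p $ i) \<le> 1 + K * \<tau>"
      using K(2)[of "\<lambda>i. m $ i" \<tau>] mb \<tau> em by (simp add: p_def)
    define M where "M = B + (- \<tau> * N) *\<^sub>R outer e e"
    have symM: "transpose M = M"
      unfolding M_def by (simp only: symB transpose_add transpose_scalar transpose_outer)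
    then obtain q where q: "eigenvalues_of M q" by (rule symmetric_spectral)
    have symA': "transpose ((1 / \<theta>) *\<^sub>R A') = (1 / \<theta>) *\<^sub>R A'" using A'(1) by (simp add: transpose_scalar)
    have eA': "eigenvalues_of ((1 / \<theta>) *\<^sub>R A') ((1 / \<theta>) *\<^sub>R l')"
      using A'(2) \<theta> by (intro eigenvalues_of_scaleR) auto
    have gA': "garding k (\<lambda>i. ((1 / \<theta>) *\<^sub>R l') $ i)"
      using garding_scale[of "1 / \<theta>", OF _ A'(3)] \<theta> by simp
    have leM: "v \<bullet> (((1 / \<theta>) *\<^sub>R A') *v v) \<le> v \<bullet> (M *v v)" for v
    proof -
      have "v \<bullet> (M *v v) = v \<bullet> (A *v v) + \<tau> * (c * (v \<bullet> v) - N * (e \<bullet> v)\<^sup>2)"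
        unfolding M_def by (simp add: matrix_vector_mult_add_rdistrib inner_add_right
            scaleR_matrix_vector_assoc[symmetric] qB inner_outer power2_eq_square algebra_simps)
      then show ?thesis
        using le[of v] \<theta> by (simp add: scaleR_matrix_vector_assoc[symmetric] pos_divide_le_eq mult.commute)
    qed
    have "1 \<le> (1 / \<theta>) ^ k" using \<theta> by (intro one_le_power) auto
    also have "\<dots> = esym UNIV k (\<lambda>i. ((1 / \<theta>) *\<^sub>R l') $ i)"
      using esym_scale[of UNIV k "1 / \<theta>" "\<lambda>i. l' $ i"] A'(4) by simp
    also have "\<dots> \<le> esym UNIV k (\<lambda>i. q $ i)"
      by (rule garding_mono(2)[OF symA' symM eA' gA' q leM])
    also have "\<dots> = esym UNIV k (\<lambda>i. p $ i)
        + - \<tau> * N * (\<Sum>i\<in>UNIV. ((e v* Q) $ i)\<^sup>2 * esym (UNIV - {i}) (k - 1) (\<lambda>i. p $ i))"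
      using esym_rank_one_update[OF Q(1) QB, of "- \<tau> * N" e q "k - 1"] q k by (simp add: M_def)
    also have "\<dots> \<le> 1 + K * \<tau> + - \<tau> * N * b"
    proof -
      have "b = (\<Sum>i\<in>UNIV. ((e v* Q) $ i)\<^sup>2 * b)"
        using orthogonal_matrix_norm(2)[OF Q(1), of e] e
        by (simp add: sum_distrib_right[symmetric] inner_vec_def power2_eq_square)
      also have "\<dots> \<le> (\<Sum>i\<in>UNIV. ((e v* Q) $ i)\<^sup>2 * esym (UNIV - {i}) (k - 1) (\<lambda>i. p $ i))"
        using b(2)[OF pb gp] by (intro sum_mono mult_left_mono) auto
      finally have "\<tau> * N * b \<le> \<tau> * N * (\<Sum>i\<in>UNIV. ((e v* Q) $ i)\<^sup>2 * esym (UNIV - {i}) (k - 1) (\<lambda>i. p $ i))"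
        using \<tau> \<open>0 < N\<close> by (intro mult_left_mono) auto
      then show ?thesis using up by simp
    qed
    also have "\<tau> * N * b = \<tau> * (K + 1)" using b(1) by (simp add: N_def)
    then have "1 + K * \<tau> + - \<tau> * N * b < 1" using \<tau> by (simp add: algebra_simps)
    finally show False by simp
  qed
qed

section \<open>Second-order expansions\<close>

text \<open>A pointwise Peano expansion of second order. It passes through products, compositions
  and inversions by estimates of remainders, and it suffices for comparing two functions at a point
  of contact.\<close>

definition jet2 :: "(real ^ 'n \<Rightarrow> real) \<Rightarrow> real ^ 'n \<Rightarrow> real ^ 'n \<Rightarrow> real ^ 'n ^ 'n \<Rightarrow> bool" where
  "jet2 f x p H \<longleftrightarrow> (\<lambda>h. f (x + h) - f x - p \<bullet> h - h \<bullet> (H *v h) / 2) \<in> o[at 0](\<lambda>h. (norm h)\<^sup>2)"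

lemma inner_bigo: "(\<lambda>h. p \<bullet> h) \<in> O[at (0 :: real ^ 'n)](norm)"
  by (rule landau_o.bigI[of "norm p + 1"])
    (auto intro!: always_eventually order_trans[OF Cauchy_Schwarz_ineq2] mult_right_mono simp: add_nonneg_pos)

lemma quadratic_bigo: "(\<lambda>h. h \<bullet> (H *v h)) \<in> O[at (0 :: real ^ 'n)](\<lambda>h. (norm h)\<^sup>2)"
proof (rule landau_o.bigI[of "onorm ((*v) H) + 1"])
  show "0 < onorm ((*v) H) + 1"
    using onorm_pos_le[OF matrix_vector_mul_bounded_linear[of H]] by linarith
  show "\<forall>\<^sub>F h in at 0. norm (h \<bullet> (H *v h)) \<le> (onorm ((*v) H) + 1) * norm ((norm h)\<^sup>2)"
  proof (intro always_eventually allI)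
    fix h :: "real ^ 'n"
    have "\<bar>h \<bullet> (H *v h)\<bar> \<le> norm h * norm (H *v h)" by (rule Cauchy_Schwarz_ineq2)
    also have "norm (H *v h) \<le> onorm ((*v) H) * norm h"
      by (rule onorm[OF matrix_vector_mul_bounded_linear])
    also have "\<dots> \<le> (onorm ((*v) H) + 1) * norm h"
      by (simp add: distrib_right)
    finally have "\<bar>h \<bullet> (H *v h)\<bar> \<le> norm h * ((onorm ((*v) H) + 1) * norm h)"
      by (simp add: mult_left_mono)
    then show "norm (h \<bullet> (H *v h)) \<le> (onorm ((*v) H) + 1) * norm ((norm h)\<^sup>2)"
      by (simp add: power2_eq_square mult_ac)
  qed
qed

lemma tendsto_norm_at_0: "(norm \<longlongrightarrow> 0) (at (0 :: 'a :: real_normed_vector))"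
  using tendsto_norm[of "\<lambda>x. x" "0 :: 'a" "at 0"] by simp

lemma norm_mult_smallo: "(\<lambda>h. norm h * f h) \<in> o[at (0 :: real ^ 'n)](f)"
proof -
  have "norm \<in> o[at (0 :: real ^ 'n)](\<lambda>_. 1)"
    by (rule smalloI_tendsto) (auto intro: tendsto_norm_at_0)
  from landau_o.small_big_mult[OF this landau_o.big_refl[of f]] show ?thesis by simp
qed

lemma norm_power2_smallo: "(\<lambda>h. (norm h)\<^sup>2) \<in> o[at (0 :: real ^ 'n)](norm)"
  using norm_mult_smallo[of norm] by (simp add: power2_eq_square)

lemma norm_power2_bigo: "(\<lambda>h. (norm h)\<^sup>2) \<in> O[at (0 :: real ^ 'n)](norm)"
  using norm_power2_smallo by (rule landau_o.small_imp_big)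

lemma norm_cube_smallo:
  assumes "f \<in> O[at (0 :: real ^ 'n)](\<lambda>h. (norm h)\<^sup>2)" "g \<in> O[at 0](norm)"
  shows "(\<lambda>h. f h * g h) \<in> o[at 0](\<lambda>h. (norm h)\<^sup>2)"
proof -
  have "(\<lambda>h. f h * g h) \<in> O[at 0](\<lambda>h. (norm h)\<^sup>2 * norm h)"
    using assms by (rule landau_o.big_mult)
  also have "(\<lambda>h :: real ^ 'n. (norm h)\<^sup>2 * norm h) \<in> o[at 0](\<lambda>h. (norm h)\<^sup>2)"
    using norm_mult_smallo[of "\<lambda>h. (norm h)\<^sup>2"] by (simp add: mult.commute)
  finally show ?thesis .
qed

lemma smallo_norm2_D:
  assumes "f \<in> o[at (0 :: real ^ 'n)](\<lambda>h. (norm h)\<^sup>2)" "0 < e" "f 0 = 0"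
  obtains d where "0 < d" "\<And>h. norm h < d \<Longrightarrow> \<bar>f h\<bar> \<le> e * (norm h)\<^sup>2"
proof -
  have "\<forall>\<^sub>F h in at 0. norm (f h) \<le> e * norm ((norm h)\<^sup>2)"
    using assms by (intro landau_o.smallD)
  then obtain d where d: "0 < d" "\<And>h. h \<noteq> 0 \<Longrightarrow> norm h < d \<Longrightarrow> \<bar>f h\<bar> \<le> e * (norm h)\<^sup>2"
    unfolding eventually_at by auto
  have "\<bar>f h\<bar> \<le> e * (norm h)\<^sup>2" if "norm h < d" for h
    using d(2)[of h] that assms(3) by (cases "h = 0") auto
  then show ?thesis using that d(1) by blast
qed

lemma smallo_norm2_I:
  assumes "\<And>e. 0 < e \<Longrightarrow> \<exists>d>0. \<forall>h. norm h < d \<longrightarrow> \<bar>f h\<bar> \<le> e * (norm h)\<^sup>2"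
  shows "f \<in> o[at (0 :: real ^ 'n)](\<lambda>h. (norm h)\<^sup>2)"
proof (rule landau_o.smallI)
  fix e :: real assume "0 < e"
  then obtain d where "0 < d" "\<forall>h. norm h < d \<longrightarrow> \<bar>f h\<bar> \<le> e * (norm h)\<^sup>2" using assms by blast
  then show "\<forall>\<^sub>F h in at 0. norm (f h) \<le> e * norm ((norm h)\<^sup>2)"
    unfolding eventually_at by (intro exI[of _ d]) auto
qed

text \<open>A quadratic remainder stays one when a map of at most linear growth is inserted. The
  space 'a is general because it is the real line in \<open>jet2_compose\<close> and the full space
  in \<open>jet2_inversion\<close>.\<close>

lemma smallo_norm2_compose:
  fixes E :: "'a::real_normed_vector \<Rightarrow> real" and g :: "real ^ 'n \<Rightarrow> 'a"
  assumes E: "\<And>e. 0 < e \<Longrightarrow> \<exists>d>0. \<forall>s. norm s < d \<longrightarrow> \<bar>E s\<bar> \<le> e * (norm s)\<^sup>2"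
    and g: "(\<lambda>h. norm (g h)) \<in> O[at 0](norm)"
  shows "(\<lambda>h. E (g h)) \<in> o[at 0](\<lambda>h. (norm h)\<^sup>2)"
proof (rule landau_o.smallI)
  fix e :: real assume e: "0 < e"
  obtain C where C: "0 < C" "\<forall>\<^sub>F h in at 0. norm (norm (g h)) \<le> C * norm (norm h)"
    using g by (rule landau_o.bigE)
  obtain d where d: "0 < d" "\<And>s. norm s < d \<Longrightarrow> \<bar>E s\<bar> \<le> e / C\<^sup>2 * (norm s)\<^sup>2"
    using E[of "e / C\<^sup>2"] e C by auto
  have "\<forall>\<^sub>F h in at (0 :: real ^ 'n). norm h < d / C"
    using d C by (intro order_tendstoD(2)[OF tendsto_norm_at_0]) simp
  with C(2) show "\<forall>\<^sub>F h in at 0. norm (E (g h)) \<le> e * norm ((norm h)\<^sup>2)"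
  proof eventually_elim
    case (elim h)
    then have gh: "norm (g h) \<le> C * norm h" by simp
    also have "\<dots> < d" using elim C by (simp add: pos_less_divide_eq mult.commute)
    finally have "\<bar>E (g h)\<bar> \<le> e / C\<^sup>2 * (norm (g h))\<^sup>2" by (rule d(2))
    also have "\<dots> \<le> e / C\<^sup>2 * (C * norm h)\<^sup>2"
      using gh e C by (intro mult_left_mono power_mono) auto
    also have "\<dots> = e * (norm h)\<^sup>2" using C by (simp add: power_mult_distrib)
    finally show ?case by simp
  qed
qed

lemma jet2_increment:
  assumes "jet2 f x p H"
  shows "(\<lambda>h. f (x + h) - f x - p \<bullet> h) \<in> O[at 0](\<lambda>h. (norm h)\<^sup>2)"
    and "(\<lambda>h. f (x + h) - f x) \<in> O[at 0](norm)"
proof -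
  have "(\<lambda>h. (f (x + h) - f x - p \<bullet> h - h \<bullet> (H *v h) / 2) + h \<bullet> (H *v h) / 2) \<in> O[at 0](\<lambda>h. (norm h)\<^sup>2)"
    using assms quadratic_bigo[of H] unfolding jet2_def
    by (intro sum_in_bigo(1)[OF landau_o.small_imp_big]) auto
  then show 1: "(\<lambda>h. f (x + h) - f x - p \<bullet> h) \<in> O[at 0](\<lambda>h. (norm h)\<^sup>2)" by simp
  have "(\<lambda>h. (f (x + h) - f x - p \<bullet> h) + p \<bullet> h) \<in> O[at 0](norm)"
    by (intro sum_in_bigo inner_bigo landau_o.big_trans[OF 1 norm_power2_bigo])
  then show "(\<lambda>h. f (x + h) - f x) \<in> O[at 0](norm)" by simp
qed

lemma jet2_mult:
  assumes "jet2 f x p H" "jet2 g x q G"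
  shows "jet2 (\<lambda>y. f y * g y) x (f x *\<^sub>R q + g x *\<^sub>R p)
    (f x *\<^sub>R G + g x *\<^sub>R H + outer p q + outer q p)"
proof -
  let ?F = "\<lambda>h. f (x + h) - f x" and ?G = "\<lambda>h. g (x + h) - g x"
  let ?E = "\<lambda>h. ?F h - p \<bullet> h - h \<bullet> (H *v h) / 2" and ?D = "\<lambda>h. ?G h - q \<bullet> h - h \<bullet> (G *v h) / 2"
  \<comment> \<open>The last bracket is the product of the increments minus
    \<open>(p \<bullet> h) * (q \<bullet> h)\<close>, split into products of a quadratic and a
    linear quantity.\<close>
  have "(\<lambda>h. f x * ?D h + g x * ?E h + ((?F h - p \<bullet> h) * ?G h + (?G h - q \<bullet> h) * (p \<bullet> h)))
     \<in> o[at 0](\<lambda>h. (norm h)\<^sup>2)"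
  proof (intro sum_in_smallo)
    show "(\<lambda>h. f x * ?D h) \<in> o[at 0](\<lambda>h. (norm h)\<^sup>2)" "(\<lambda>h. g x * ?E h) \<in> o[at 0](\<lambda>h. (norm h)\<^sup>2)"
      using assms unfolding jet2_def by simp_all
    show "(\<lambda>h. (?F h - p \<bullet> h) * ?G h) \<in> o[at 0](\<lambda>h. (norm h)\<^sup>2)"
      by (rule norm_cube_smallo[OF jet2_increment(1)[OF assms(1)] jet2_increment(2)[OF assms(2)]])
    show "(\<lambda>h. (?G h - q \<bullet> h) * (p \<bullet> h)) \<in> o[at 0](\<lambda>h. (norm h)\<^sup>2)"
      by (rule norm_cube_smallo[OF jet2_increment(1)[OF assms(2)] inner_bigo])
  qed
  moreover have "f (x + h) * g (x + h) - f x * g x - (f x *\<^sub>R q + g x *\<^sub>R p) \<bullet> h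
      - h \<bullet> ((f x *\<^sub>R G + g x *\<^sub>R H + outer p q + outer q p) *v h) / 2
    = f x * ?D h + g x * ?E h + ((?F h - p \<bullet> h) * ?G h + (?G h - q \<bullet> h) * (p \<bullet> h))" for h
    by (simp add: matrix_vector_mult_add_rdistrib scaleR_matrix_vector_assoc[symmetric] inner_add_left inner_add_right
        inner_outer algebra_simps)
  ultimately show ?thesis unfolding jet2_def by presburger
qed

text \<open>Mean value theorem for g minus its quadratic polynomial on the segment from a to a + s:
  the derivative is s times the first-order remainder of g1 at a.\<close>

lemma taylor_peano:
  fixes g :: "real \<Rightarrow> real"
  assumes "0 < r" "\<And>y. \<bar>y - a\<bar> < r \<Longrightarrow> (g has_real_derivative g1 y) (at y)"
    and "(g1 has_real_derivative g2) (at a)" and "0 < e"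
  shows "\<exists>d>0. \<forall>s. \<bar>s\<bar> < d \<longrightarrow> \<bar>g (a + s) - g a - g1 a * s - g2 * s\<^sup>2 / 2\<bar> \<le> e * s\<^sup>2"
proof -
  have "(g1 has_derivative (\<lambda>h. g2 * h)) (at a)"
    using assms(3) by (simp add: has_field_derivative_def)
  then obtain d0 where d0: "0 < d0" "\<And>y. \<bar>y - a\<bar> < d0 \<Longrightarrow> \<bar>g1 y - g1 a - g2 * (y - a)\<bar> \<le> e * \<bar>y - a\<bar>"
    unfolding has_derivative_at_alt using \<open>0 < e\<close> by auto
  define d where "d = min d0 r"
  show ?thesis
  proof (intro exI[of _ d] conjI allI impI)
    show "0 < d" using d0 assms(1) by (simp add: d_def)
    fix s assume s: "\<bar>s\<bar> < d"
    define k where "k t = g (a + t * s) - g1 a * s * t - g2 * s\<^sup>2 * t\<^sup>2 / 2" for t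
    have "(k has_real_derivative (g1 (a + t * s) * s - g1 a * s - g2 * s\<^sup>2 * t)) (at t)" if "0 \<le> t" "t \<le> 1" for t
    proof -
      have "\<bar>a + t * s - a\<bar> < r"
        using that s by (simp add: d_def abs_mult) (meson abs_ge_zero le_less_trans mult_left_le_one_le order_trans)
      from assms(2)[OF this] show ?thesis
        unfolding k_def by (auto intro!: derivative_eq_intros DERIV_chain2[of g] simp: power2_eq_square)
    qed
    from MVT2[of 0 1 k, OF _ this] obtain t where t: "0 < t" "t < 1"
      "k 1 - k 0 = g1 (a + t * s) * s - g1 a * s - g2 * s\<^sup>2 * t" by auto
    have ts: "\<bar>t * s\<bar> \<le> \<bar>s\<bar>" using t by (simp add: abs_mult mult_left_le_one_le)
    have "\<bar>g1 (a + t * s) - g1 a - g2 * (t * s)\<bar> \<le> e * \<bar>t * s\<bar>"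
      using d0(2)[of "a + t * s"] ts s by (simp add: d_def)
    also have "\<dots> \<le> e * \<bar>s\<bar>" using ts \<open>0 < e\<close> by simp
    finally have "\<bar>(g1 (a + t * s) - g1 a - g2 * (t * s)) * s\<bar> \<le> e * \<bar>s\<bar> * \<bar>s\<bar>"
      unfolding abs_mult[of _ s] by (rule mult_right_mono) simp
    moreover have "g (a + s) - g a - g1 a * s - g2 * s\<^sup>2 / 2 = (g1 (a + t * s) - g1 a - g2 * (t * s)) * s"
      using t(3) by (simp add: k_def power2_eq_square algebra_simps)
    ultimately show "\<bar>g (a + s) - g a - g1 a * s - g2 * s\<^sup>2 / 2\<bar> \<le> e * s\<^sup>2"
      by (simp add: power2_eq_square)
  qed
qed

lemma jet2_compose:
  fixes g :: "real \<Rightarrow> real"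
  assumes f: "jet2 f x p H" and g: "0 < r" "\<And>y. \<bar>y - f x\<bar> < r \<Longrightarrow> (g has_real_derivative g1 y) (at y)"
    "(g1 has_real_derivative g2) (at (f x))"
  shows "jet2 (\<lambda>y. g (f y)) x (g1 (f x) *\<^sub>R p) (g1 (f x) *\<^sub>R H + g2 *\<^sub>R outer p p)"
proof -
  let ?d = "\<lambda>h. f (x + h) - f x"
  let ?E = "\<lambda>h. ?d h - p \<bullet> h - h \<bullet> (H *v h) / 2"
  let ?R = "\<lambda>s. g (f x + s) - g (f x) - g1 (f x) * s - g2 * s\<^sup>2 / 2"
  have dO: "?d \<in> O[at 0](norm)" by (rule jet2_increment(2)[OF f])
  have R: "(\<lambda>h. ?R (?d h)) \<in> o[at 0](\<lambda>h. (norm h)\<^sup>2)"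
  proof (rule smallo_norm2_compose[where E = ?R and g = ?d])
    show "\<exists>d>0. \<forall>s. norm s < d \<longrightarrow> \<bar>?R s\<bar> \<le> e * (norm s)\<^sup>2" if "0 < e" for e
      using taylor_peano[OF g that] by simp
    show "(\<lambda>h. norm (?d h)) \<in> O[at 0](norm)" using dO by simp
  qed
  \<comment> \<open>The second-order term of g contributes \<open>(?d h)\<^sup>2\<close> in place of
    \<open>(p \<bullet> h)\<^sup>2\<close>; the difference of the squares factors into a quadratic
    and a linear quantity.\<close>
  have "(\<lambda>h. ?R (?d h) + g1 (f x) * ?E h + g2 / 2 * ((?d h - p \<bullet> h) * (?d h + p \<bullet> h))) \<in> o[at 0](\<lambda>h. (norm h)\<^sup>2)"
  proof (rule sum_in_smallo(1)[OF sum_in_smallo(1)[OF R]])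
    show "(\<lambda>h. g1 (f x) * ?E h) \<in> o[at 0](\<lambda>h. (norm h)\<^sup>2)"
      using f unfolding jet2_def by simp
    have "(\<lambda>h. (?d h - p \<bullet> h) * (?d h + p \<bullet> h)) \<in> o[at 0](\<lambda>h. (norm h)\<^sup>2)"
      by (intro norm_cube_smallo jet2_increment(1)[OF f] sum_in_bigo dO inner_bigo)
    then show "(\<lambda>h. g2 / 2 * ((?d h - p \<bullet> h) * (?d h + p \<bullet> h))) \<in> o[at 0](\<lambda>h. (norm h)\<^sup>2)"
      by simp
  qed
  moreover have "g (f (x + h)) - g (f x) - (g1 (f x) *\<^sub>R p) \<bullet> h
      - h \<bullet> ((g1 (f x) *\<^sub>R H + g2 *\<^sub>R outer p p) *v h) / 2
    = ?R (?d h) + g1 (f x) * ?E h + g2 / 2 * ((?d h - p \<bullet> h) * (?d h + p \<bullet> h))" for h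
    by (simp add: matrix_vector_mult_add_rdistrib scaleR_matrix_vector_assoc[symmetric] inner_add_left inner_add_right
        inner_outer power2_eq_square algebra_simps add_divide_distrib diff_divide_distrib)
  ultimately show ?thesis unfolding jet2_def by presburger
qed

lemma jet2_norm_sq: "jet2 (\<lambda>y. y \<bullet> y) x (2 *\<^sub>R x) (2 *\<^sub>R mat 1)"
  unfolding jet2_def
  by (simp add: inner_add_left inner_add_right inner_commute scaleR_matrix_vector_assoc[symmetric])

lemma jet2_const: "jet2 (\<lambda>y. c) x 0 0"
  unfolding jet2_def by simp

lemma jet2_has_derivative:
  assumes "jet2 f x p H"
  shows "(f has_derivative (\<lambda>h. p \<bullet> h)) (at x)"
proof -
  have "(\<lambda>h. f (x + h) - f x - p \<bullet> h) \<in> o[at 0](norm)"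
    using jet2_increment(1)[OF assms] norm_power2_smallo by (rule landau_o.big_small_trans)
  then have "((\<lambda>h. (f (x + h) - f x - p \<bullet> h) / norm h) \<longlongrightarrow> 0) (at 0)"
    by (rule smalloD_tendsto)
  then have "((\<lambda>h. norm (f (x + h) - f x - p \<bullet> h) / norm h) \<longlongrightarrow> 0) (at 0)"
    using tendsto_norm_zero by (fastforce simp: norm_divide)
  then show ?thesis
    unfolding has_derivative_at by (simp add: bounded_linear_inner_right)
qed

lemma jet2_isCont: "jet2 f x p H \<Longrightarrow> isCont f x"
  using has_derivative_continuous[OF jet2_has_derivative] by auto

text \<open>On the ray x + t v the nonnegative difference g - f has a linear term
  \<open>t * ((q - p) \<bullet> v)\<close>, which must be nonnegative for every v, in particular for
  v = p - q. Once the gradients agree, the terms of order t^2 compare the Hessians.\<close>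

lemma jet2_touching:
  assumes f: "jet2 f x p H" and g: "jet2 g x q G" and eq: "f x = g x"
    and le: "\<forall>\<^sub>F y in nhds x. f y \<le> g y"
  shows "p = q" "v \<bullet> (H *v v) \<le> v \<bullet> (G *v v)"
proof -
  let ?a = "\<lambda>v. (q - p) \<bullet> v" and ?b = "\<lambda>v. v \<bullet> (G *v v) - v \<bullet> (H *v v)"
  have key: "\<exists>d>0. \<forall>t. 0 < t \<longrightarrow> t < d \<longrightarrow> 0 \<le> ?a v + t * (?b v / 2 + e)" if e: "0 < e" for v e
  proof (cases "v = 0")
    case True
    then show ?thesis using e by (intro exI[of _ 1]) auto
  next
    case False
    define e' where "e' = e / (norm v)\<^sup>2"
    have e': "0 < e'" using e False by (simp add: e'_def)
    have "(\<lambda>h. (g (x + h) - g x - q \<bullet> h - h \<bullet> (G *v h) / 2) - (f (x + h) - f x - p \<bullet> h - h \<bullet> (H *v h) / 2))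
       \<in> o[at 0](\<lambda>h. (norm h)\<^sup>2)"
      using g f unfolding jet2_def by (rule sum_in_smallo(2))
    then obtain d where d: "0 < d" "\<And>h. norm h < d \<Longrightarrow>
      \<bar>(g (x + h) - g x - q \<bullet> h - h \<bullet> (G *v h) / 2) - (f (x + h) - f x - p \<bullet> h - h \<bullet> (H *v h) / 2)\<bar> \<le> e' * (norm h)\<^sup>2"
      by (rule smallo_norm2_D[OF _ e']) auto
    obtain d2 where d2: "0 < d2" "\<And>y. dist y x < d2 \<Longrightarrow> f y \<le> g y"
      using le unfolding eventually_nhds_metric by blast
    show ?thesis
    proof (intro exI[of _ "min d d2 / norm v"] conjI allI impI)
      show "0 < min d d2 / norm v" using d d2 False by simp
      fix t assume t: "0 < t" "t < min d d2 / norm v"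
      then have n: "norm (t *\<^sub>R v) < d" "norm (t *\<^sub>R v) < d2"
        using False by (simp_all add: pos_less_divide_eq)
      have "f (x + t *\<^sub>R v) \<le> g (x + t *\<^sub>R v)"
        using d2(2)[of "x + t *\<^sub>R v"] n by (simp add: dist_norm)
      moreover have "(norm (t *\<^sub>R v))\<^sup>2 * e' = t\<^sup>2 * e"
        using False by (simp add: e'_def power_mult_distrib)
      ultimately have "0 \<le> t * ?a v + t\<^sup>2 * (?b v / 2) + t\<^sup>2 * e"
        using d(2)[OF n(1)] eq
        by (simp add: inner_diff_left matrix_vector_mult_scaleR power2_eq_square mult_ac algebra_simps abs_le_iff diff_divide_distrib)
      also have "\<dots> = t * (?a v + t * (?b v / 2 + e))"
        by (simp add: power2_eq_square algebra_simps)
      finally show "0 \<le> ?a v + t * (?b v / 2 + e)"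
        using t by (simp add: zero_le_mult_iff)
    qed
  qed
  have lim: "((\<lambda>t. ?a v + t * (?b v / 2 + e)) \<longlongrightarrow> ?a v + 0 * (?b v / 2 + e)) (at_right 0)" for v e
    by (intro tendsto_intros)
  have a: "0 \<le> ?a v" for v
  proof -
    obtain d where "0 < d" "\<forall>t. 0 < t \<longrightarrow> t < d \<longrightarrow> 0 \<le> ?a v + t * (?b v / 2 + 1)"
      using key[of 1 v] by auto
    then have "\<forall>\<^sub>F t in at_right 0. 0 \<le> ?a v + t * (?b v / 2 + 1)"
      unfolding eventually_at_right_field by auto
    from tendsto_lowerbound[OF lim this] show ?thesis by simp
  qed
  from a[of "p - q"] have "(q - p) \<bullet> (q - p) \<le> 0" by (simp add: inner_diff_left inner_diff_right algebra_simps)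
  then show pq: "p = q" by (metis inner_eq_zero_iff inner_ge_zero order_antisym right_minus_eq)
  have "0 \<le> ?b v / 2 + e" if e: "0 < e" for e
  proof -
    obtain d where d: "0 < d" "\<forall>t. 0 < t \<longrightarrow> t < d \<longrightarrow> 0 \<le> t * (?b v / 2 + e)"
      using key[OF e, of v] pq by auto
    have "0 \<le> (d / 2) * (?b v / 2 + e)"
      by (rule d(2)[rule_format]) (use d(1) in auto)
    then show ?thesis using d(1) by (simp only: zero_le_mult_iff) linarith
  qed
  then have "0 \<le> ?b v / 2" by (rule field_le_epsilon)
  then show "v \<bullet> (H *v v) \<le> v \<bullet> (G *v v)" by simp
qed


section \<open>From Frechet derivatives to jets, and symmetry of the Hessian\<close>

lemma grad_has_derivative:
  assumes "u differentiable (at x)"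
  shows "(u has_derivative (\<lambda>h. grad u x \<bullet> h)) (at x)"
proof -
  have d: "(u has_derivative frechet_derivative u (at x)) (at x)"
    using assms by (simp add: frechet_derivative_works)
  then have lin: "linear (frechet_derivative u (at x))" by (rule has_derivative_linear)
  have "frechet_derivative u (at x) h = grad u x \<bullet> h" for h
  proof -
    have "frechet_derivative u (at x) h = frechet_derivative u (at x) (\<Sum>i\<in>UNIV. h $ i *\<^sub>R axis i 1)"
      using basis_expansion[of h] by (simp add: scalar_mult_eq_scaleR)
    also have "\<dots> = (\<Sum>i\<in>UNIV. h $ i * frechet_derivative u (at x) (axis i 1))"
      using lin by (simp add: linear_sum linear_scale)
    finally show ?thesis by (simp add: grad_def inner_vec_def mult.commute)
  qed
  then show ?thesis using d by presburger
qed

lemma hess_has_derivative: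
  assumes "grad u differentiable (at x)"
  shows "(grad u has_derivative (\<lambda>h. hess u x *v h)) (at x)"
proof -
  have d: "(grad u has_derivative frechet_derivative (grad u) (at x)) (at x)"
    using assms by (simp add: frechet_derivative_works)
  then have "linear (frechet_derivative (grad u) (at x))" by (rule has_derivative_linear)
  then have "frechet_derivative (grad u) (at x) h = hess u x *v h" for h
    by (simp add: hess_def matrix_works linear_linear linear_matrix_vector_mul_eq)
  then show ?thesis using d by presburger
qed

lemma gradient_expansion:
  assumes "((p :: real ^ 'n \<Rightarrow> real ^ 'n) has_derivative (\<lambda>h. H *v h)) (at x)" "0 < e"
  obtains d where "0 < d" "\<And>h. norm h < d \<Longrightarrow> norm (p (x + h) - p x - H *v h) \<le> e * norm h"
proof -
  obtain d where d: "0 < d" "\<And>y. norm (y - x) < d \<Longrightarrow> norm (p y - p x - H *v (y - x)) \<le> e * norm (y - x)"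
    using assms unfolding has_derivative_at_alt by blast
  show ?thesis by (rule that[OF d(1)]) (use d(2)[of "x + _"] in simp)
qed

lemma line_deriv:
  assumes "(u has_derivative (\<lambda>h. q \<bullet> h)) (at (x + t *\<^sub>R (h :: real ^ 'n)))"
  shows "((\<lambda>t. u (x + t *\<^sub>R h)) has_real_derivative q \<bullet> h) (at t)"
proof -
  have "((\<lambda>t. x + t *\<^sub>R h) has_derivative (\<lambda>s. s *\<^sub>R h)) (at t)"
    by (auto intro!: derivative_eq_intros)
  from has_derivative_compose[OF this assms] show ?thesis
    by (simp add: has_field_derivative_def mult_commute_abs)
qed

lemma jet2_of_derivatives:
  fixes x :: "real ^ 'n"
  assumes S: "open S" "x \<in> S" and u: "\<And>y. y \<in> S \<Longrightarrow> (u has_derivative (\<lambda>h. p y \<bullet> h)) (at y)"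
    and p: "(p has_derivative (\<lambda>h. H *v h)) (at x)"
  shows "jet2 u x (p x) H"
  unfolding jet2_def
proof (rule smallo_norm2_I)
  fix e :: real assume "0 < e"
  then obtain d0 where d0: "0 < d0" "\<And>h. norm h < d0 \<Longrightarrow> norm (p (x + h) - p x - H *v h) \<le> e * norm h"
    using gradient_expansion[OF p] by blast
  obtain r where r: "0 < r" "ball x r \<subseteq> S" using S openE by blast
  show "\<exists>d>0. \<forall>h. norm h < d \<longrightarrow> \<bar>u (x + h) - u x - p x \<bullet> h - h \<bullet> (H *v h) / 2\<bar> \<le> e * (norm h)\<^sup>2"
  proof (intro exI[of _ "min d0 r"] conjI allI impI)
    show "0 < min d0 r" using d0 r by simp
    fix h :: "real ^ 'n" assume h: "norm h < min d0 r"
    \<comment> \<open>Constructed so that its derivative at t is the first-order remainder of the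
      gradient p at \<open>t *\<^sub>R h\<close>, paired with h.\<close>
    define k where "k t = u (x + t *\<^sub>R h) - (p x \<bullet> h) * t - (h \<bullet> (H *v h)) * t\<^sup>2 / 2" for t
    have "(k has_real_derivative (p (x + t *\<^sub>R h) \<bullet> h - p x \<bullet> h - (h \<bullet> (H *v h)) * t)) (at t)" if "0 \<le> t" "t \<le> 1" for t
    proof -
      have "\<bar>t\<bar> * norm h \<le> norm h" using that by (simp add: mult_left_le_one_le)
      then have "x + t *\<^sub>R h \<in> S" using h r by (auto simp: dist_norm)
      from line_deriv[OF u[OF this]] show ?thesis
        unfolding k_def by (auto intro!: derivative_eq_intros)
    qed
    from MVT2[of 0 1 k, OF _ this] obtain t where t: "0 < t" "t < 1"
      "k 1 - k 0 = p (x + t *\<^sub>R h) \<bullet> h - p x \<bullet> h - (h \<bullet> (H *v h)) * t" by auto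
    have th: "norm (t *\<^sub>R h) \<le> norm h" using t by (simp add: mult_left_le_one_le)
    have "u (x + h) - u x - p x \<bullet> h - h \<bullet> (H *v h) / 2 = (p (x + t *\<^sub>R h) - p x - H *v (t *\<^sub>R h)) \<bullet> h"
      using t(3) by (simp add: k_def inner_diff_left matrix_vector_mult_scaleR inner_commute[of h] mult.commute[of t])
    also have "\<bar>\<dots>\<bar> \<le> norm (p (x + t *\<^sub>R h) - p x - H *v (t *\<^sub>R h)) * norm h"
      by (rule Cauchy_Schwarz_ineq2)
    also have "\<dots> \<le> (e * norm (t *\<^sub>R h)) * norm h"
      using d0(2)[of "t *\<^sub>R h"] th h by (intro mult_right_mono) auto
    also have "\<dots> \<le> (e * norm h) * norm h"
      using th \<open>0 < e\<close> by (intro mult_right_mono mult_left_mono) auto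
    finally show "\<bar>u (x + h) - u x - p x \<bullet> h - h \<bullet> (H *v h) / 2\<bar> \<le> e * (norm h)\<^sup>2"
      by (simp add: power2_eq_square)
  qed
qed

text \<open>Mean value theorem in the direction h only, followed by the first-order expansion of the
  gradient at x for both evaluation points; their difference is \<open>s *\<^sub>R (H *v k)\<close>
  whatever the intermediate t. The second difference is symmetric in h and k, hence so is the
  Hessian form.\<close>

lemma second_difference_bound:
  assumes S: "open S" "x \<in> S" and u: "\<And>y. y \<in> S \<Longrightarrow> (u has_derivative (\<lambda>h. p y \<bullet> h)) (at y)"
    and p: "(p has_derivative (\<lambda>h. H *v h)) (at (x :: real ^ 'n))" and "0 < e"
  shows "\<exists>d>0. \<forall>s. 0 < s \<longrightarrow> s < d \<longrightarrow>
    \<bar>u (x + s *\<^sub>R k + s *\<^sub>R h) - u (x + s *\<^sub>R h) - u (x + s *\<^sub>R k) + u x - s\<^sup>2 * (h \<bullet> (H *v k))\<bar> \<le> s\<^sup>2 * e"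
proof -
  define K where "K = norm h + norm k + 1"
  have K: "0 < K" "norm h \<le> K" "norm h + norm k \<le> K" by (auto simp: K_def add_nonneg_pos)
  \<comment> \<open>Both evaluation points lie within s K of x, so two remainders of size e' s K
    paired with s h of norm at most s K add up to \<open>s\<^sup>2 * e\<close>.\<close>
  define e' where "e' = e / (2 * K * K)"
  have e': "0 < e'" using \<open>0 < e\<close> K by (simp add: e'_def)
  obtain d0 where d0: "0 < d0" "\<And>h. norm h < d0 \<Longrightarrow> norm (p (x + h) - p x - H *v h) \<le> e' * norm h"
    using gradient_expansion[OF p e'] by blast
  obtain r where r: "0 < r" "ball x r \<subseteq> S" using S openE by blast
  show ?thesis
  proof (intro exI[of _ "min d0 r / K"] conjI allI impI)
    show "0 < min d0 r / K" using d0 r K by simp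
    fix s assume s: "0 < s" "s < min d0 r / K"
    then have sK: "s * K < d0" "s * K < r" using K by (simp_all add: pos_less_divide_eq)
    have n1: "norm (t *\<^sub>R (s *\<^sub>R h)) \<le> s * K" if "0 \<le> t" "t \<le> 1" for t
    proof -
      have "t * (s * norm h) \<le> s * norm h" using that s by (intro mult_left_le_one_le) auto
      also have "\<dots> \<le> s * K" using s K by (intro mult_left_mono) auto
      finally show ?thesis using that s by simp
    qed
    have n2: "norm (s *\<^sub>R k + t *\<^sub>R (s *\<^sub>R h)) \<le> s * K" if "0 \<le> t" "t \<le> 1" for t
    proof -
      have "t * (s * norm h) \<le> s * norm h" using that s by (intro mult_left_le_one_le) auto
      moreover have "norm (t *\<^sub>R (s *\<^sub>R h)) = t * (s * norm h)" "norm (s *\<^sub>R k) = s * norm k"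
        using that s by simp_all
      ultimately have "norm (s *\<^sub>R k + t *\<^sub>R (s *\<^sub>R h)) \<le> s * norm k + s * norm h"
        using norm_triangle_ineq[of "s *\<^sub>R k" "t *\<^sub>R (s *\<^sub>R h)"] by linarith
      also have "\<dots> = s * (norm h + norm k)" by (simp add: algebra_simps)
      also have "\<dots> \<le> s * K" using s K by (intro mult_left_mono) auto
      finally show ?thesis .
    qed
    define F where "F t = u ((x + s *\<^sub>R k) + t *\<^sub>R (s *\<^sub>R h)) - u (x + t *\<^sub>R (s *\<^sub>R h))" for t
    have "(F has_real_derivative (p ((x + s *\<^sub>R k) + t *\<^sub>R (s *\<^sub>R h)) \<bullet> (s *\<^sub>R h) - p (x + t *\<^sub>R (s *\<^sub>R h)) \<bullet> (s *\<^sub>R h))) (at t)"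
      if "0 \<le> t" "t \<le> 1" for t
    proof -
      have "norm (s *\<^sub>R k + t *\<^sub>R (s *\<^sub>R h)) < r" "norm (t *\<^sub>R (s *\<^sub>R h)) < r"
        using n1[OF that] n2[OF that] sK by linarith+
      moreover have "x + w \<in> S" if "norm w < r" for w
        using that r by (auto simp: dist_norm)
      ultimately have "(x + s *\<^sub>R k) + t *\<^sub>R (s *\<^sub>R h) \<in> S" "x + t *\<^sub>R (s *\<^sub>R h) \<in> S"
        unfolding add.assoc by blast+
      then show ?thesis unfolding F_def by (intro DERIV_diff line_deriv u)
    qed
    from MVT2[of 0 1 F, OF _ this] obtain t where t: "0 < t" "t < 1"
      "F 1 - F 0 = p ((x + s *\<^sub>R k) + t *\<^sub>R (s *\<^sub>R h)) \<bullet> (s *\<^sub>R h) - p (x + t *\<^sub>R (s *\<^sub>R h)) \<bullet> (s *\<^sub>R h)" by auto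
    let ?a = "s *\<^sub>R k + t *\<^sub>R (s *\<^sub>R h)" and ?b = "t *\<^sub>R (s *\<^sub>R h)"
    let ?ra = "p (x + ?a) - p x - H *v ?a" and ?rb = "p (x + ?b) - p x - H *v ?b"
    have na: "norm ?a \<le> s * K" and nb: "norm ?b \<le> s * K" using n1 n2 t by auto
    have ra: "norm ?ra \<le> e' * (s * K)"
      using d0(2)[of ?a] na sK e' by (smt (verit) mult_left_mono)
    have rb: "norm ?rb \<le> e' * (s * K)"
      using d0(2)[of ?b] nb sK e' by (smt (verit) mult_left_mono)
    have "F 1 - F 0 - s\<^sup>2 * (h \<bullet> (H *v k)) = (?ra - ?rb) \<bullet> (s *\<^sub>R h)"
      unfolding t(3)
      by (simp add: inner_diff_left inner_add_left matrix_vector_right_distrib matrix_vector_mult_scaleR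
          power2_eq_square inner_commute[of h] algebra_simps)
    also have "\<bar>\<dots>\<bar> \<le> norm (?ra - ?rb) * norm (s *\<^sub>R h)" by (rule Cauchy_Schwarz_ineq2)
    also have "\<dots> \<le> (e' * (s * K) + e' * (s * K)) * (s * K)"
    proof (intro mult_mono)
      show "norm (?ra - ?rb) \<le> e' * (s * K) + e' * (s * K)"
        using norm_triangle_ineq4[of ?ra ?rb] ra rb by linarith
      show "norm (s *\<^sub>R h) \<le> s * K" using s K by simp
      show "0 \<le> e' * (s * K) + e' * (s * K)" using e' s K by simp
    qed simp
    also have "\<dots> = s\<^sup>2 * e" using K by (simp add: e'_def power2_eq_square field_simps)
    finally have "\<bar>F 1 - F 0 - s\<^sup>2 * (h \<bullet> (H *v k))\<bar> \<le> s\<^sup>2 * e" .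
    moreover have "F 1 - F 0 = u (x + s *\<^sub>R k + s *\<^sub>R h) - u (x + s *\<^sub>R h) - u (x + s *\<^sub>R k) + u x"
      by (simp add: F_def)
    ultimately show "\<bar>u (x + s *\<^sub>R k + s *\<^sub>R h) - u (x + s *\<^sub>R h) - u (x + s *\<^sub>R k) + u x - s\<^sup>2 * (h \<bullet> (H *v k))\<bar> \<le> s\<^sup>2 * e"
      by simp
  qed
qed

lemma hessian_symmetric:
  assumes S: "open S" "x \<in> S" and u: "\<And>y. y \<in> S \<Longrightarrow> (u has_derivative (\<lambda>h. p y \<bullet> h)) (at y)"
    and p: "(p has_derivative (\<lambda>h. H *v h)) (at (x :: real ^ 'n))"
  shows "transpose H = H"
proof -
  have sym: "h \<bullet> (H *v k) = k \<bullet> (H *v h)" for h k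
  proof -
    have "\<bar>h \<bullet> (H *v k) - k \<bullet> (H *v h)\<bar> \<le> 0 + e" if e: "0 < e" for e
    proof -
      obtain d1 where d1: "0 < d1" "\<forall>s. 0 < s \<longrightarrow> s < d1 \<longrightarrow>
        \<bar>u (x + s *\<^sub>R k + s *\<^sub>R h) - u (x + s *\<^sub>R h) - u (x + s *\<^sub>R k) + u x - s\<^sup>2 * (h \<bullet> (H *v k))\<bar> \<le> s\<^sup>2 * (e / 2)"
        using second_difference_bound[OF S u p, of "e / 2" k h] e by auto
      obtain d2 where d2: "0 < d2" "\<forall>s. 0 < s \<longrightarrow> s < d2 \<longrightarrow>
        \<bar>u (x + s *\<^sub>R h + s *\<^sub>R k) - u (x + s *\<^sub>R k) - u (x + s *\<^sub>R h) + u x - s\<^sup>2 * (k \<bullet> (H *v h))\<bar> \<le> s\<^sup>2 * (e / 2)"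
        using second_difference_bound[OF S u p, of "e / 2" h k] e by auto
      define s where "s = min d1 d2 / 2"
      have s: "0 < s" "s < d1" "s < d2" using d1 d2 by (auto simp: s_def)
      have comm: "x + s *\<^sub>R h + s *\<^sub>R k = x + s *\<^sub>R k + s *\<^sub>R h" by simp
      define D where "D = u (x + s *\<^sub>R k + s *\<^sub>R h) - u (x + s *\<^sub>R h) - u (x + s *\<^sub>R k) + u x"
      have D': "u (x + s *\<^sub>R h + s *\<^sub>R k) - u (x + s *\<^sub>R k) - u (x + s *\<^sub>R h) + u x = D"
        unfolding comm D_def by simp
      have "\<bar>D - s\<^sup>2 * (h \<bullet> (H *v k))\<bar> \<le> s\<^sup>2 * (e / 2)" "\<bar>D - s\<^sup>2 * (k \<bullet> (H *v h))\<bar> \<le> s\<^sup>2 * (e / 2)"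
        using d1(2)[rule_format, OF s(1,2)] d2(2)[rule_format, OF s(1,3)] unfolding D_def[symmetric] D' .
      then have "\<bar>s\<^sup>2 * (h \<bullet> (H *v k)) - s\<^sup>2 * (k \<bullet> (H *v h))\<bar> \<le> s\<^sup>2 * (e / 2) + s\<^sup>2 * (e / 2)"
        by linarith
      then have "s\<^sup>2 * \<bar>h \<bullet> (H *v k) - k \<bullet> (H *v h)\<bar> \<le> s\<^sup>2 * e"
        by (simp add: right_diff_distrib[symmetric] abs_mult mult.commute[of e])
      then show ?thesis using s by simp
    qed
    then have "\<bar>h \<bullet> (H *v k) - k \<bullet> (H *v h)\<bar> \<le> 0" by (rule field_le_epsilon)
    then show ?thesis by simp
  qed
  have "H $ i $ j = axis i 1 \<bullet> (H *v axis j 1)" for i j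
    by (simp add: inner_axis' matrix_vector_mult_basis column_def)
  then show ?thesis using sym by (simp add: transpose_def vec_eq_iff)
qed


section \<open>Inversion and the Kelvin transform of a jet\<close>

definition inversion :: "real \<Rightarrow> real ^ 'n \<Rightarrow> real ^ 'n" where
  "inversion l y = (l\<^sup>2 / (y \<bullet> y)) *\<^sub>R y"

definition refl_matrix :: "real ^ 'n \<Rightarrow> real ^ 'n ^ 'n" where
  "refl_matrix y = mat 1 - (2 / (y \<bullet> y)) *\<^sub>R outer y y"

lemma refl_matrix_vector: "refl_matrix y *v h = h - (2 * (y \<bullet> h) / (y \<bullet> y)) *\<^sub>R y"
proof -
  have "outer y y *v h = (y \<bullet> h) *\<^sub>R y"
    by (simp add: vec_eq_iff outer_def matrix_vector_mult_def inner_vec_def sum_distrib_left mult_ac)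
  then show ?thesis
    by (simp add: refl_matrix_def matrix_vector_mult_diff_rdistrib scaleR_matrix_vector_assoc[symmetric])
qed

lemma transpose_refl_matrix: "transpose (refl_matrix y) = refl_matrix y"
  by (simp add: refl_matrix_def transpose_def outer_def mat_def vec_eq_iff mult.commute)

lemma refl_matrix_self: "y \<noteq> 0 \<Longrightarrow> refl_matrix y *v y = - y"
  by (simp add: refl_matrix_vector scaleR_2)

lemma refl_matrix_involution:
  assumes "y \<noteq> 0" shows "refl_matrix y *v (refl_matrix y *v h) = h"
proof -
  define c where "c = 2 * (y \<bullet> h) / (y \<bullet> y)"
  have h: "refl_matrix y *v h = h - c *\<^sub>R y" by (simp add: refl_matrix_vector c_def)
  then show ?thesis
    by (simp add: matrix_vector_mult_diff_distrib matrix_vector_mult_scaleR refl_matrix_self assms)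
qed

lemma orthogonal_refl_matrix:
  assumes "y \<noteq> 0" shows "orthogonal_matrix (refl_matrix y)"
proof -
  have "refl_matrix y ** refl_matrix y = mat 1"
    by (subst matrix_eq) (simp add: matrix_vector_mul_assoc[symmetric] refl_matrix_involution assms)
  then show ?thesis by (simp add: orthogonal_matrix transpose_refl_matrix)
qed

text \<open>Conformality of the inversion: this is why the Kelvin transform alters the matrix of a
  solution only by an orthogonal conjugation.\<close>

lemma inversion_has_derivative:
  assumes "y \<noteq> 0"
  shows "(inversion l has_derivative (\<lambda>h. ((l\<^sup>2 / (y \<bullet> y)) *\<^sub>R refl_matrix y) *v h)) (at y)"
proof -
  have yy: "y \<bullet> y \<noteq> 0" using assms by simp
  have "((\<lambda>y. y \<bullet> y) has_derivative (\<lambda>h. 2 * (y \<bullet> h))) (at y)"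
    using has_derivative_inner[OF has_derivative_ident has_derivative_ident, of y]
    by (simp add: inner_commute)
  from has_derivative_scaleR[OF has_derivative_divide'[OF has_derivative_const this yy, of "l\<^sup>2"] has_derivative_ident]
  have "((\<lambda>y. (l\<^sup>2 / (y \<bullet> y)) *\<^sub>R y) has_derivative
      (\<lambda>h. (l\<^sup>2 / (y \<bullet> y)) *\<^sub>R h + (- (l\<^sup>2 * (2 * (y \<bullet> h))) / (y \<bullet> y)\<^sup>2) *\<^sub>R y)) (at y)"
    by (simp add: power2_eq_square)
  moreover have "((l\<^sup>2 / (y \<bullet> y)) *\<^sub>R refl_matrix y) *v h
      = (l\<^sup>2 / (y \<bullet> y)) *\<^sub>R h + (- (l\<^sup>2 * (2 * (y \<bullet> h))) / (y \<bullet> y)\<^sup>2) *\<^sub>R y" for h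
    by (simp add: scaleR_matrix_vector_assoc[symmetric] refl_matrix_vector scaleR_diff_right power2_eq_square)
  ultimately show ?thesis unfolding inversion_def[abs_def] by presburger
qed

lemma inner_smallo:
  assumes "(\<lambda>h. norm (a h)) \<in> o[F](g1)" "(\<lambda>h. norm (b h)) \<in> O[F](g2)"
  shows "(\<lambda>h. a h \<bullet> b h) \<in> o[F](\<lambda>h. g1 h * g2 h)"
proof (rule landau_o.big_small_trans[OF _ landau_o.small_big_mult[OF assms]])
  show "(\<lambda>h. a h \<bullet> b h) \<in> O[F](\<lambda>h. norm (a h) * norm (b h))"
    by (rule landau_o.bigI[of 1]) (auto simp: abs_mult Cauchy_Schwarz_ineq2)
qed

lemma norm_matrix_vector_bigo: "(\<lambda>h. norm ((H :: real ^ 'n ^ 'm) *v b h)) \<in> O[F](\<lambda>h. norm (b h))"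
proof (rule landau_o.bigI[of "onorm ((*v) H) + 1"])
  show "0 < onorm ((*v) H) + 1"
    using onorm_pos_le[OF matrix_vector_mul_bounded_linear[of H]] by linarith
  show "\<forall>\<^sub>F h in F. norm (norm (H *v b h)) \<le> (onorm ((*v) H) + 1) * norm (norm (b h))"
    using onorm[OF matrix_vector_mul_bounded_linear, of H "b _"]
    by (intro always_eventually allI) (simp add: distrib_right add_increasing2)
qed

text \<open>The weight undoes the inversion: \<open>(z \<bullet> z) / l\<^sup>2\<close> times
  \<open>inversion l z\<close> is z. Hence the affine part of f at the inverted point becomes
  exactly a quadratic polynomial in z, which yields the scalar in front of y and of the identity.
  Only the Hessian term and the remainder have to be expanded.\<close>

lemma jet2_inversion:
  fixes f :: "real ^ 'n \<Rightarrow> real"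
  assumes f: "jet2 f (inversion l y) p H" and y: "y \<noteq> 0" and l: "0 < l"
  shows "jet2 (\<lambda>z. (z \<bullet> z) / l\<^sup>2 * f (inversion l z)) y
    ((2 * (f (inversion l y) - p \<bullet> inversion l y) / l\<^sup>2) *\<^sub>R y + p)
    ((2 * (f (inversion l y) - p \<bullet> inversion l y) / l\<^sup>2) *\<^sub>R mat 1
      + (l\<^sup>2 / (y \<bullet> y)) *\<^sub>R (refl_matrix y ** H ** refl_matrix y))"
proof -
  let ?\<phi> = "inversion l y" and ?R = "refl_matrix y"
  define M where "M = (l\<^sup>2 / (y \<bullet> y)) *\<^sub>R ?R"
  define \<Delta> where "\<Delta> h = inversion l (y + h) - ?\<phi>" for h
  define N where "N h = (y + h) \<bullet> (y + h)" for h
  define E where "E h = f (?\<phi> + h) - f ?\<phi> - p \<bullet> h - h \<bullet> (H *v h) / 2" for h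
  have yy: "0 < y \<bullet> y" using y by simp
  have "((\<lambda>h. norm (\<Delta> h - M *v h) / norm h) \<longlongrightarrow> 0) (at 0)"
    using inversion_has_derivative[OF y, of l] unfolding has_derivative_at \<Delta>_def M_def by blast
  then have d1: "(\<lambda>h. norm (\<Delta> h - M *v h)) \<in> o[at 0](norm)"
    by (intro smalloI_tendsto) (auto simp: eventually_at_filter)
  have MO: "(\<lambda>h. norm (M *v h)) \<in> O[at 0](norm)"
    using norm_matrix_vector_bigo[of M "\<lambda>h. h"] by simp
  have dO: "(\<lambda>h. norm (\<Delta> h)) \<in> O[at 0](norm)"
  proof (rule landau_o.big_trans)
    show "(\<lambda>h. norm (\<Delta> h)) \<in> O[at 0](\<lambda>h. norm (\<Delta> h - M *v h) + norm (M *v h))"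
      by (rule landau_o.bigI[of 1]) (auto simp: norm_triangle_sub add.commute intro: order_trans[OF norm_triangle_sub[of _ "M *v _"]])
    show "(\<lambda>h. norm (\<Delta> h - M *v h) + norm (M *v h)) \<in> O[at 0](norm)"
      by (rule sum_in_bigo(1)[OF landau_o.small_imp_big[OF d1] MO])
  qed
  have Q: "(\<lambda>h. \<Delta> h \<bullet> (H *v \<Delta> h) - (M *v h) \<bullet> (H *v (M *v h))) \<in> o[at 0](\<lambda>h. (norm h)\<^sup>2)"
  proof -
    have "(\<lambda>h. (\<Delta> h - M *v h) \<bullet> (H *v \<Delta> h)) \<in> o[at 0](\<lambda>h. norm h * norm h)"
      by (rule inner_smallo[OF d1 landau_o.big_trans[OF norm_matrix_vector_bigo dO]])
    moreover have "(\<lambda>h. (\<Delta> h - M *v h) \<bullet> (transpose H *v (M *v h))) \<in> o[at 0](\<lambda>h. norm h * norm h)"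
      by (rule inner_smallo[OF d1 landau_o.big_trans[OF norm_matrix_vector_bigo MO]])
    ultimately have "(\<lambda>h. (\<Delta> h - M *v h) \<bullet> (H *v \<Delta> h) + (\<Delta> h - M *v h) \<bullet> (transpose H *v (M *v h)))
       \<in> o[at 0](\<lambda>h. norm h * norm h)"
      by (rule sum_in_smallo(1))
    moreover have "(\<Delta> h - M *v h) \<bullet> (transpose H *v (M *v h)) = (M *v h) \<bullet> (H *v (\<Delta> h - M *v h))" for h
      by (metis dot_lmul_matrix inner_commute transpose_matrix_vector)
    ultimately show ?thesis
      by (simp add: inner_diff_left matrix_vector_mult_diff_distrib inner_diff_right power2_eq_square)
  qed
  have EO: "(\<lambda>h. E (\<Delta> h)) \<in> o[at 0](\<lambda>h. (norm h)\<^sup>2)"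
  proof (rule smallo_norm2_compose[where E = E, OF _ dO])
    fix e :: real assume "0 < e"
    moreover have "E \<in> o[at 0](\<lambda>h. (norm h)\<^sup>2)" using f unfolding jet2_def E_def .
    moreover have "E 0 = 0" by (simp add: E_def)
    ultimately show "\<exists>d>0. \<forall>h. norm h < d \<longrightarrow> \<bar>E h\<bar> \<le> e * (norm h)\<^sup>2"
      by (metis smallo_norm2_D)
  qed
  have "((\<lambda>h. N h) \<longlongrightarrow> (y + 0) \<bullet> (y + 0)) (at 0)"
    unfolding N_def by (intro tendsto_intros)
  then have NO: "N \<in> O[at 0](\<lambda>_. 1)"
    by (intro bigoI_tendsto[where c = "y \<bullet> y"]) auto
  have mult_N: "(\<lambda>h. N h * g h) \<in> o[at 0](\<lambda>h. (norm h)\<^sup>2)" if "g \<in> o[at 0](\<lambda>h. (norm h)\<^sup>2)" for g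
    using landau_o.big_small_mult[OF NO that] by simp
  have Ny: "(\<lambda>h. N h - y \<bullet> y) \<in> O[at 0](norm)"
  proof -
    have "(\<lambda>h. (2 *\<^sub>R y) \<bullet> h + (norm h)\<^sup>2) \<in> O[at 0](norm)"
      by (rule sum_in_bigo(1)[OF inner_bigo norm_power2_bigo])
    moreover have "N h - y \<bullet> y = (2 *\<^sub>R y) \<bullet> h + (norm h)\<^sup>2" for h
      unfolding N_def power2_norm_eq_inner by (simp add: inner_add_left inner_add_right inner_commute[of h y])
    ultimately show ?thesis by presburger
  qed
  have MHM: "(M *v h) \<bullet> (H *v (M *v h)) = h \<bullet> ((transpose M ** H ** M) *v h)" for h
    unfolding matrix_vector_mul_assoc[symmetric]
    by (metis dot_lmul_matrix transpose_transpose vector_transpose_matrix)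
  have "(\<lambda>h. ((M *v h) \<bullet> (H *v (M *v h))) * (N h - y \<bullet> y)) \<in> o[at 0](\<lambda>h. (norm h)\<^sup>2)"
    unfolding MHM by (rule norm_cube_smallo[OF quadratic_bigo Ny])
  then have "(\<lambda>h. 1 / (2 * l\<^sup>2) * (N h * (\<Delta> h \<bullet> (H *v \<Delta> h) - (M *v h) \<bullet> (H *v (M *v h)))
      + ((M *v h) \<bullet> (H *v (M *v h))) * (N h - y \<bullet> y)) + 1 / l\<^sup>2 * (N h * E (\<Delta> h))) \<in> o[at 0](\<lambda>h. (norm h)\<^sup>2)"
    (is "?err \<in> _")
    by (intro sum_in_smallo(1)[OF _ iffD2[OF landau_o.small.cmult_in_iff]] iffD2[OF landau_o.small.cmult_in_iff]
        sum_in_smallo(1)[OF mult_N[OF Q]] mult_N[OF EO]) (use l in auto)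
  moreover have "(y + h) \<bullet> (y + h) / l\<^sup>2 * f (inversion l (y + h)) - y \<bullet> y / l\<^sup>2 * f ?\<phi>
      - ((2 * (f ?\<phi> - p \<bullet> ?\<phi>) / l\<^sup>2) *\<^sub>R y + p) \<bullet> h
      - h \<bullet> (((2 * (f ?\<phi> - p \<bullet> ?\<phi>) / l\<^sup>2) *\<^sub>R mat 1 + (l\<^sup>2 / (y \<bullet> y)) *\<^sub>R (?R ** H ** ?R)) *v h) / 2 = ?err h" for h
  proof -
    have "inversion l (y + h) = ?\<phi> + \<Delta> h" by (simp add: \<Delta>_def)
    then have f_eq: "f (inversion l (y + h)) = f ?\<phi> + p \<bullet> \<Delta> h + \<Delta> h \<bullet> (H *v \<Delta> h) / 2 + E (\<Delta> h)"
      by (simp add: E_def)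
    \<comment> \<open>Here the weight cancels the inversion, so the linear term of f is evaluated
      without expanding \<Delta>.\<close>
    have NI: "N h / l\<^sup>2 * (p \<bullet> \<Delta> h) = p \<bullet> (y + h) - N h / l\<^sup>2 * (p \<bullet> ?\<phi>)"
    proof -
      have "(N h / l\<^sup>2) *\<^sub>R inversion l (y + h) = y + h"
        using l by (cases "y + h = 0") (auto simp: inversion_def N_def)
      then have "N h / l\<^sup>2 * (p \<bullet> inversion l (y + h)) = p \<bullet> (y + h)"
        by (metis inner_scaleR_right)
      then show ?thesis by (simp add: \<Delta>_def inner_diff_right right_diff_distrib)
    qed
    have py: "y \<bullet> y / l\<^sup>2 * (p \<bullet> ?\<phi>) = p \<bullet> y"
      using l yy by (simp add: inversion_def)
    have Nh: "N h = y \<bullet> y + 2 * (y \<bullet> h) + h \<bullet> h"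
      by (simp add: N_def inner_add_left inner_add_right inner_commute)
    have RHR: "(M *v h) \<bullet> (H *v (M *v h)) = (l\<^sup>2 / (y \<bullet> y))\<^sup>2 * (h \<bullet> ((?R ** H ** ?R) *v h))"
    proof -
      have "M *v h = (l\<^sup>2 / (y \<bullet> y)) *\<^sub>R (?R *v h)"
        by (simp add: M_def scaleR_matrix_vector_assoc)
      moreover have "(?R *v h) \<bullet> (H *v (?R *v h)) = h \<bullet> ((?R ** H ** ?R) *v h)"
        unfolding matrix_vector_mul_assoc[symmetric]
        by (metis dot_lmul_matrix transpose_refl_matrix vector_transpose_matrix)
      ultimately show ?thesis by (simp add: matrix_vector_mult_scaleR power2_eq_square mult.assoc)
    qed
    have q: "y \<bullet> y / l\<^sup>2 * ((M *v h) \<bullet> (H *v (M *v h))) = l\<^sup>2 / (y \<bullet> y) * (h \<bullet> ((?R ** H ** ?R) *v h))"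
      unfolding RHR using l yy by (simp add: field_simps power2_eq_square)
    \<comment> \<open>Bookkeeping over plain real variables: \<open>f1\<close> to \<open>f4\<close>
      and \<open>lin3\<close> split the expansion into its affine, quadratic and remainder parts,
      and \<open>gen\<close> recombines them.\<close>
    have gen: "X - Z - (A + B) - (C + D) / 2 = W"
      if "X = a + b + c / 2 + e" "Z = z + d" "a - z = A + C / 2" "W = c / 2 - D / 2 + e" "b = d + B"
      for X Z A B C D W a b c d e z :: real
      using that by (simp add: add_divide_distrib)
    have f1: "(y + h) \<bullet> (y + h) / l\<^sup>2 * f (inversion l (y + h))
       = N h / l\<^sup>2 * (f ?\<phi> - p \<bullet> ?\<phi>) + p \<bullet> (y + h) + N h / l\<^sup>2 * (\<Delta> h \<bullet> (H *v \<Delta> h)) / 2 + N h / l\<^sup>2 * E (\<Delta> h)"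
    proof -
      have "N h / l\<^sup>2 * (f ?\<phi> + p \<bullet> \<Delta> h + \<Delta> h \<bullet> (H *v \<Delta> h) / 2 + E (\<Delta> h))
        = N h / l\<^sup>2 * f ?\<phi> + N h / l\<^sup>2 * (p \<bullet> \<Delta> h) + N h / l\<^sup>2 * (\<Delta> h \<bullet> (H *v \<Delta> h)) / 2 + N h / l\<^sup>2 * E (\<Delta> h)"
        by (simp only: distrib_left times_divide_eq_right)
      then show ?thesis
        unfolding f_eq N_def[symmetric] NI right_diff_distrib by linarith
    qed
    have f2: "y \<bullet> y / l\<^sup>2 * f ?\<phi> = y \<bullet> y / l\<^sup>2 * (f ?\<phi> - p \<bullet> ?\<phi>) + p \<bullet> y"
      using py by (simp add: right_diff_distrib)
    have f3: "N h / l\<^sup>2 * (f ?\<phi> - p \<bullet> ?\<phi>) - y \<bullet> y / l\<^sup>2 * (f ?\<phi> - p \<bullet> ?\<phi>)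
        = (2 * (f ?\<phi> - p \<bullet> ?\<phi>) / l\<^sup>2) * (y \<bullet> h) + (2 * (f ?\<phi> - p \<bullet> ?\<phi>) / l\<^sup>2) * (h \<bullet> h) / 2"
    proof -
      have "(r + 2 * b + c) / L * a - r / L * a = (2 * a / L) * b + (2 * a / L) * c / 2" for r b c L a :: real
        by (cases "L = 0") (simp_all add: field_simps)
      then show ?thesis unfolding Nh .
    qed
    have "1 / (2 * l\<^sup>2) * (n * (a - b) + b * (n - y0)) + 1 / l\<^sup>2 * (n * c)
        = n / l\<^sup>2 * a / 2 - y0 / l\<^sup>2 * b / 2 + n / l\<^sup>2 * c" for n a b y0 c
      by (simp add: algebra_simps diff_divide_distrib add_divide_distrib)
    then have f4: "?err h = N h / l\<^sup>2 * (\<Delta> h \<bullet> (H *v \<Delta> h)) / 2 - (y \<bullet> y / l\<^sup>2 * ((M *v h) \<bullet> (H *v (M *v h)))) / 2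
        + N h / l\<^sup>2 * E (\<Delta> h)" .
    have lin1: "(c *\<^sub>R y + p) \<bullet> h = c * (y \<bullet> h) + p \<bullet> h" for c
      by (simp add: inner_add_left)
    have lin2: "h \<bullet> ((c *\<^sub>R mat 1 + d *\<^sub>R X) *v h) = c * (h \<bullet> h) + d * (h \<bullet> (X *v h))" for c d X
      by (simp add: inner_add_right matrix_vector_mult_add_rdistrib scaleR_matrix_vector_assoc[symmetric])
    have lin3: "p \<bullet> (y + h) = p \<bullet> y + p \<bullet> h"
      by (simp add: inner_add_right)
    show ?thesis
      unfolding lin1 lin2 by (rule gen[OF f1 f2 f3 f4[unfolded q] lin3])
  qed
  ultimately show ?thesis unfolding jet2_def by presburger
qed

section \<open>The conformal factor equation\<close>

lemma jet2_add:
  assumes "jet2 f x p H" "jet2 g x q G"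
  shows "jet2 (\<lambda>y. f y + g y) x (p + q) (H + G)"
proof -
  have "(f (x + h) + g (x + h)) - (f x + g x) - (p + q) \<bullet> h - h \<bullet> ((H + G) *v h) / 2
    = (f (x + h) - f x - p \<bullet> h - h \<bullet> (H *v h) / 2) + (g (x + h) - g x - q \<bullet> h - h \<bullet> (G *v h) / 2)" for h
    by (simp add: inner_add_left inner_add_right matrix_vector_mult_add_rdistrib add_divide_distrib)
  then show ?thesis
    using sum_in_smallo(1)[OF assms[unfolded jet2_def]] unfolding jet2_def by presburger
qed

text \<open>For value, gradient and Hessian of \<xi> this is the Schouten tensor, with one index
  raised, of the metric \<open>\<xi>\<close> to the power -2 times the flat metric.\<close>

definition schouten :: "real \<Rightarrow> real ^ 'n \<Rightarrow> real ^ 'n ^ 'n \<Rightarrow> real ^ 'n ^ 'n" where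
  "schouten a p H = a *\<^sub>R H - ((p \<bullet> p) / 2) *\<^sub>R mat 1"

lemma schouten_quadratic:
  "v \<bullet> (schouten a p H *v v) = a * (v \<bullet> (H *v v)) - (p \<bullet> p) / 2 * (v \<bullet> v)"
  by (simp add: schouten_def matrix_vector_mult_diff_rdistrib scaleR_matrix_vector_assoc[symmetric] inner_diff_right)

text \<open>Gradient and Hessian are carried as data because translations and Kelvin transforms have
  explicit formulas for them. The cone is recorded through \<open>admissible\<close>, that is, by
  inequalities rather than by a connected component.\<close>

definition solution :: "nat \<Rightarrow> (real ^ 'n) set \<Rightarrow> (real ^ 'n \<Rightarrow> real) \<Rightarrow> (real ^ 'n \<Rightarrow> real ^ 'n)
    \<Rightarrow> (real ^ 'n \<Rightarrow> real ^ 'n ^ 'n) \<Rightarrow> bool" where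
  "solution k S f p H \<longleftrightarrow> open S \<and> continuous_on S p \<and> continuous_on S H \<and>
     (\<forall>x\<in>S. 0 < f x \<and> jet2 f x (p x) (H x) \<and> admissible k (schouten (f x) (p x) (H x)))"

lemma solutionD:
  assumes "solution k S f p H"
  shows "open S" "continuous_on S p" "continuous_on S H" "continuous_on S f"
    and "\<And>x. x \<in> S \<Longrightarrow> 0 < f x" "\<And>x. x \<in> S \<Longrightarrow> jet2 f x (p x) (H x)"
    and "\<And>x. x \<in> S \<Longrightarrow> admissible k (schouten (f x) (p x) (H x))"
proof -
  show "continuous_on S f"
    using assms jet2_isCont[of f] unfolding solution_def
    by (intro continuous_at_imp_continuous_on ballI) blast
qed (use assms in \<open>auto simp: solution_def\<close>)

lemma eigenvalues_of_conj:
  assumes "orthogonal_matrix Q" "eigenvalues_of A l"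
  shows "eigenvalues_of (transpose Q ** A ** Q) l"
  unfolding eigenvalues_of_def
proof
  fix t
  have "mat t - transpose Q ** A ** Q = transpose Q ** (mat t + (-1) *\<^sub>R A) ** Q"
    unfolding conj_add conj_scaleR conj_mat[OF assms(1)] by simp
  then have "det (mat t - transpose Q ** A ** Q) = det (mat t - A)"
    by (simp add: det_conj[OF assms(1)])
  then show "det (mat t - transpose Q ** A ** Q) = (\<Prod>i\<in>UNIV. t - l $ i)"
    using assms(2) by (simp add: eigenvalues_of_def)
qed

lemma admissible_conj:
  assumes "orthogonal_matrix Q" "admissible k A"
  shows "admissible k (transpose Q ** A ** Q)"
  using assms eigenvalues_of_conj[OF assms(1)] unfolding admissible_def
  by (auto simp: matrix_transpose_mul matrix_mul_assoc)

text \<open>The conformal factors in front of the Hessian cancel, leaving a. In the multiple of the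
  identity all terms with c cancel because of the value of c, and only the original gradient term
  survives (\<open>scal\<close>).\<close>

lemma schouten_inversion:
  fixes y p :: "real ^ 'n"
  assumes y: "y \<noteq> 0" and l: "0 < l" and c: "c = 2 * (a - p \<bullet> inversion l y) / l\<^sup>2"
  shows "schouten ((y \<bullet> y) / l\<^sup>2 * a) (c *\<^sub>R y + p)
      (c *\<^sub>R mat 1 + (l\<^sup>2 / (y \<bullet> y)) *\<^sub>R (refl_matrix y ** H ** refl_matrix y))
    = transpose (refl_matrix y) ** schouten a p H ** refl_matrix y"
proof -
  let ?R = "refl_matrix y"
  define r where "r = y \<bullet> y"
  have r: "0 < r" using y by (simp add: r_def)
  have pp: "(c *\<^sub>R y + p) \<bullet> (c *\<^sub>R y + p) = c\<^sup>2 * r + 2 * c * (p \<bullet> y) + p \<bullet> p"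
    by (simp add: inner_add_left inner_add_right inner_commute r_def power2_eq_square)
  have py: "p \<bullet> y = r / l\<^sup>2 * (p \<bullet> inversion l y)"
    using r l by (simp add: inversion_def r_def)
  have scal: "r / l\<^sup>2 * a * c - (c\<^sup>2 * r + 2 * c * (p \<bullet> y) + p \<bullet> p) / 2 = - (p \<bullet> p) / 2"
  proof -
    have "r / l\<^sup>2 * a * c - (c\<^sup>2 * r + 2 * c * (p \<bullet> y) + p \<bullet> p) / 2
        = c * (r / l\<^sup>2 * a - c * r / 2 - p \<bullet> y) - (p \<bullet> p) / 2"
      by (simp add: power2_eq_square algebra_simps add_divide_distrib)
    also have "r / l\<^sup>2 * a - c * r / 2 - p \<bullet> y = 0"
      unfolding py c using l by (simp add: field_simps)
    finally show ?thesis by simp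
  qed
  have coef: "r / l\<^sup>2 * a * (l\<^sup>2 / r) = a" using r l by simp
  have "schouten (r / l\<^sup>2 * a) (c *\<^sub>R y + p) (c *\<^sub>R mat 1 + (l\<^sup>2 / r) *\<^sub>R (?R ** H ** ?R))
      = (r / l\<^sup>2 * a * (l\<^sup>2 / r)) *\<^sub>R (?R ** H ** ?R)
        + (r / l\<^sup>2 * a * c - (c\<^sup>2 * r + 2 * c * (p \<bullet> y) + p \<bullet> p) / 2) *\<^sub>R mat 1"
    unfolding schouten_def pp by (simp add: scaleR_add_right scaleR_diff_left)
  also have "\<dots> = a *\<^sub>R (?R ** H ** ?R) + (- (p \<bullet> p) / 2) *\<^sub>R mat 1"
    unfolding scal coef ..
  also have "\<dots> = transpose ?R ** (a *\<^sub>R H + (- (p \<bullet> p) / 2) *\<^sub>R mat 1) ** ?R"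
    unfolding conj_add conj_scaleR conj_mat[OF orthogonal_refl_matrix[OF y]]
    unfolding transpose_refl_matrix ..
  also have "a *\<^sub>R H + (- (p \<bullet> p) / 2) *\<^sub>R mat 1 = schouten a p H" by (simp add: schouten_def)
  finally show ?thesis by (simp add: r_def)
qed

lemma norm_inversion: "norm (inversion l y) = l\<^sup>2 / norm y"
  by (cases "y = 0") (simp_all add: inversion_def dot_square_norm power2_eq_square)

lemma continuous_on_inversion: "continuous_on (- {0}) (inversion l)"
  unfolding inversion_def[abs_def] by (intro continuous_intros) auto

lemma continuous_on_matrix_mult:
  fixes A :: "'a::topological_space \<Rightarrow> real ^ 'n ^ 'm" and B :: "'a \<Rightarrow> real ^ 'k ^ 'n"
  assumes "continuous_on S A" "continuous_on S B"
  shows "continuous_on S (\<lambda>x. A x ** B x)"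
  unfolding matrix_matrix_mult_def
  by (intro continuous_on_vec_lambda continuous_on_sum continuous_on_mult continuous_on_component assms)

lemma continuous_on_refl_matrix: "continuous_on (- {0}) refl_matrix"
proof -
  have "continuous_on (- {0}) (\<lambda>y :: real ^ 'n. (\<chi> i j. y $ i * y $ j))"
    by (intro continuous_on_vec_lambda continuous_on_mult continuous_on_component continuous_on_id)
  then show ?thesis
    unfolding refl_matrix_def[abs_def] outer_def by (intro continuous_intros) auto
qed

definition kelvin :: "real \<Rightarrow> (real ^ 'n \<Rightarrow> real) \<Rightarrow> real ^ 'n \<Rightarrow> real" where
  "kelvin l f y = (y \<bullet> y) / l\<^sup>2 * f (inversion l y)"

theorem solution_kelvin:
  assumes sol: "solution k S f p H" and l: "0 < l"
  defines "c \<equiv> \<lambda>y. 2 * (f (inversion l y) - p (inversion l y) \<bullet> inversion l y) / l\<^sup>2"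
  shows "solution k (- {0} \<inter> inversion l -` S) (kelvin l f) (\<lambda>y. c y *\<^sub>R y + p (inversion l y))
    (\<lambda>y. c y *\<^sub>R mat 1 + (l\<^sup>2 / (y \<bullet> y)) *\<^sub>R (refl_matrix y ** H (inversion l y) ** refl_matrix y))"
proof -
  note S = solutionD[OF sol]
  let ?U = "- {0} \<inter> inversion l -` S"
  have oU: "open ?U"
    using continuous_on_inversion S(1) by (intro continuous_open_preimage) auto
  have ci: "continuous_on ?U (inversion l)"
    by (rule continuous_on_subset[OF continuous_on_inversion]) auto
  have cr: "continuous_on ?U refl_matrix"
    by (rule continuous_on_subset[OF continuous_on_refl_matrix]) auto
  have cf: "continuous_on ?U (\<lambda>y. f (inversion l y))" "continuous_on ?U (\<lambda>y. p (inversion l y))"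
    "continuous_on ?U (\<lambda>y. H (inversion l y))"
    using S(2-4) ci by (auto intro: continuous_on_compose2)
  have cc: "continuous_on ?U c"
    unfolding c_def using l by (intro continuous_intros cf ci) auto
  show ?thesis
    unfolding solution_def
  proof (intro conjI ballI oU)
    show "continuous_on ?U (\<lambda>y. c y *\<^sub>R y + p (inversion l y))"
      by (intro continuous_intros cc cf)
    show "continuous_on ?U (\<lambda>y. c y *\<^sub>R mat 1 + (l\<^sup>2 / (y \<bullet> y)) *\<^sub>R (refl_matrix y ** H (inversion l y) ** refl_matrix y))"
      by (intro continuous_intros cc continuous_on_matrix_mult cr cf) auto
    fix y assume y: "y \<in> ?U"
    then have y0: "y \<noteq> 0" and yS: "inversion l y \<in> S" by auto
    show "0 < kelvin l f y"
      using S(5)[OF yS] l y0 by (simp add: kelvin_def)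
    show "jet2 (kelvin l f) y (c y *\<^sub>R y + p (inversion l y))
       (c y *\<^sub>R mat 1 + (l\<^sup>2 / (y \<bullet> y)) *\<^sub>R (refl_matrix y ** H (inversion l y) ** refl_matrix y))"
      unfolding kelvin_def[abs_def] c_def by (rule jet2_inversion[OF S(6)[OF yS] y0 l])
    show "admissible k (schouten (kelvin l f y) (c y *\<^sub>R y + p (inversion l y))
       (c y *\<^sub>R mat 1 + (l\<^sup>2 / (y \<bullet> y)) *\<^sub>R (refl_matrix y ** H (inversion l y) ** refl_matrix y)))"
      unfolding kelvin_def c_def schouten_inversion[OF y0 l refl]
      by (rule admissible_conj[OF orthogonal_refl_matrix[OF y0] S(7)[OF yS]])
  qed
qed

lemma quadratic_form_bound:
  fixes A :: "'a::topological_space \<Rightarrow> real ^ 'n ^ 'n"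
  assumes "compact K" "continuous_on K A"
  obtains \<Lambda> where "0 \<le> \<Lambda>" "\<And>y v. y \<in> K \<Longrightarrow> \<bar>v \<bullet> (A y *v v)\<bar> \<le> \<Lambda> * (v \<bullet> v)"
proof -
  obtain B where B: "0 < B" "\<And>y. y \<in> K \<Longrightarrow> norm (A y) \<le> B"
    using compact_imp_bounded[OF compact_continuous_image[OF assms(2,1)]] unfolding bounded_pos by auto
  define \<Lambda> where "\<Lambda> = real CARD('n) * real CARD('n) * B"
  have "\<bar>v \<bullet> (A y *v v)\<bar> \<le> \<Lambda> * (v \<bullet> v)" if "y \<in> K" for y v
  proof -
    have "\<bar>A y $ i $ j\<bar> \<le> B" for i j
      using component_le_norm_cart[of "A y $ i" j] Finite_Cartesian_Product.norm_nth_le[of "A y" i] B(2)[OF that] by linarith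
    then have on: "onorm ((*v) (A y)) \<le> \<Lambda>"
      unfolding \<Lambda>_def by (rule onorm_le_matrix_component)
    have "\<bar>v \<bullet> (A y *v v)\<bar> \<le> norm v * norm (A y *v v)" by (rule Cauchy_Schwarz_ineq2)
    also have "norm (A y *v v) \<le> onorm ((*v) (A y)) * norm v"
      by (rule onorm[OF matrix_vector_mul_bounded_linear])
    also have "\<dots> \<le> \<Lambda> * norm v"
      using on by (intro mult_right_mono) auto
    finally have "\<bar>v \<bullet> (A y *v v)\<bar> \<le> norm v * (\<Lambda> * norm v)"
      by (simp add: mult_left_mono)
    then show ?thesis by (simp add: dot_square_norm power2_eq_square mult_ac)
  qed
  moreover have "0 \<le> \<Lambda>" using B(1) by (simp add: \<Lambda>_def)
  ultimately show ?thesis using that by blast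
qed

section \<open>The barrier on annuli\<close>

definition shell :: "real \<Rightarrow> real \<Rightarrow> (real ^ 'n) set" where
  "shell r s = {y. r \<le> norm y \<and> norm y \<le> s}"

lemma compact_shell: "compact (shell r s :: (real ^ 'n) set)"
proof -
  have "shell r s = cball 0 s - ball (0 :: real ^ 'n) r" by (auto simp: shell_def)
  then show ?thesis by (simp add: compact_diff)
qed

text \<open>\<mu> is minus the derivative of the profile with respect to
  \<open>y \<bullet> y\<close>. First-order effects are therefore of size \<mu>, while the radial
  second derivative carries the extra large factor \<alpha>. The divisor m will be the minimum of a
  quotient, chosen so that the barrier touches.\<close>

lemma jet2_barrier:
  fixes \<alpha> \<epsilon> m r :: real
  defines "\<kappa> \<equiv> \<lambda>y :: real ^ 'n. (1 - \<epsilon> * (exp (\<alpha> * (y \<bullet> y - r)) - 1)) / m"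
    and "\<mu> \<equiv> \<lambda>y :: real ^ 'n. \<epsilon> * \<alpha> * exp (\<alpha> * (y \<bullet> y - r)) / m"
  assumes "m \<noteq> 0"
  shows "jet2 \<kappa> y (- (2 * \<mu> y) *\<^sub>R y) (- (2 * \<mu> y) *\<^sub>R mat 1 - (4 * \<alpha> * \<mu> y) *\<^sub>R outer y y)"
proof -
  let ?g = "\<lambda>s. (1 - \<epsilon> * (exp (\<alpha> * (s - r)) - 1)) / m" and ?g1 = "\<lambda>s. - (\<epsilon> * \<alpha> * exp (\<alpha> * (s - r)) / m)"
  have "(?g has_real_derivative ?g1 s) (at s)" for s
    using assms(3) by (auto intro!: derivative_eq_intros simp: field_simps)
  moreover have "(?g1 has_real_derivative - (\<epsilon> * \<alpha> * \<alpha> * exp (\<alpha> * (y \<bullet> y - r)) / m)) (at (y \<bullet> y))"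
    using assms(3) by (auto intro!: derivative_eq_intros simp: field_simps)
  ultimately have "jet2 (\<lambda>y. ?g (y \<bullet> y)) y (?g1 (y \<bullet> y) *\<^sub>R (2 *\<^sub>R y)) (?g1 (y \<bullet> y) *\<^sub>R (2 *\<^sub>R mat 1)
     + (- (\<epsilon> * \<alpha> * \<alpha> * exp (\<alpha> * (y \<bullet> y - r)) / m)) *\<^sub>R outer (2 *\<^sub>R y) (2 *\<^sub>R y))"
    by (intro jet2_compose[OF jet2_norm_sq, of 1]) auto
  moreover have "outer (2 *\<^sub>R y) (2 *\<^sub>R y) = 4 *\<^sub>R outer y y"
    by (simp add: outer_def vec_eq_iff)
  ultimately show ?thesis
    by (simp add: \<kappa>_def \<mu>_def mult_ac)
qed

lemma barrier_touching:
  fixes y :: "real ^ 'n"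
  assumes k: "1 \<le> k"
    and \<xi>: "jet2 \<xi> y p H" "admissible k (schouten (\<xi> y) p H)" "0 < \<xi> y"
    and \<zeta>: "jet2 \<zeta> y q G" "admissible k (schouten (\<zeta> y) q G)" "0 < b" "b \<le> \<zeta> y" "\<zeta> y \<le> B" "norm q \<le> B"
    and y: "0 < r0" "r0 \<le> norm y" "norm y \<le> r1"
    and quad: "\<And>v. \<bar>v \<bullet> (schouten (\<zeta> y) q G *v v)\<bar> \<le> \<Lambda> * (v \<bullet> v)"
    and \<kappa>: "jet2 \<kappa> y (- (2 * \<mu>) *\<^sub>R y) (- (2 * \<mu>) *\<^sub>R mat 1 - (4 * \<alpha> * \<mu>) *\<^sub>R outer y y)"
      "\<kappa> y * \<zeta> y = \<xi> y" "\<kappa> y \<le> 1" "0 < \<mu>" "\<mu> \<le> \<kappa> y"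
    and touch: "\<forall>\<^sub>F z in nhds y. \<xi> z \<le> \<kappa> z * \<zeta> z"
    and N: "N \<le> 4 * \<alpha> * b\<^sup>2 * r0\<^sup>2" "0 \<le> \<alpha>"
    and ell: "\<And>(A :: real ^ 'n ^ 'n) A' \<theta> \<tau> e.
      \<lbrakk>admissible k A; admissible k A';
       0 < \<theta>; \<theta> \<le> 1; 0 < \<tau>; \<tau> \<le> 1; e \<bullet> e = 1;
       \<And>v. \<bar>v \<bullet> (A *v v)\<bar> \<le> \<Lambda> * (v \<bullet> v);
       \<And>v. v \<bullet> (A' *v v) \<le> \<theta> * (v \<bullet> (A *v v) + \<tau> * (6 * B\<^sup>2 * r1 * (v \<bullet> v) - N * (e \<bullet> v)\<^sup>2))\<rbrakk> \<Longrightarrow> False"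
  shows False
proof -
  \<comment> \<open>Since \<open>a \<le> 1\<close> and \<open>\<sigma>\<^sub>k\<close> is homogeneous, the zeroth-order term has the good sign; a large \<open>\<alpha>\<close>
    lets the radial second derivative of \<open>\<kappa>\<close> beat all first-order terms.\<close>
  define a where "a = \<kappa> y"
  define z where "z = \<zeta> y"
  have z: "0 < z" "b \<le> z" "z \<le> B" using \<zeta> by (auto simp: z_def)
  have B: "0 < B" using z by linarith
  have a: "0 < a" "a \<le> 1" "\<mu> \<le> a" using \<kappa> by (auto simp: a_def)
  have az: "\<xi> y = a * z" using \<kappa>(2) by (simp add: a_def z_def)
  let ?pk = "- (2 * \<mu>) *\<^sub>R y" and ?Hk = "- (2 * \<mu>) *\<^sub>R mat 1 - (4 * \<alpha> * \<mu>) *\<^sub>R outer y y"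
  have jw: "jet2 (\<lambda>y. \<kappa> y * \<zeta> y) y (a *\<^sub>R q + z *\<^sub>R ?pk) (a *\<^sub>R G + z *\<^sub>R ?Hk + outer ?pk q + outer q ?pk)"
    unfolding a_def z_def by (rule jet2_mult[OF \<kappa>(1) \<zeta>(1)])
  have p: "p = a *\<^sub>R q + z *\<^sub>R ?pk"
    using jet2_touching(1)[OF \<xi>(1) jw _ touch] \<kappa>(2) by simp
  have Hle: "v \<bullet> (H *v v) \<le> v \<bullet> ((a *\<^sub>R G + z *\<^sub>R ?Hk + outer ?pk q + outer q ?pk) *v v)" for v
    using jet2_touching(2)[OF \<xi>(1) jw _ touch] \<kappa>(2) by simp
  have ny: "0 < norm y" using y by linarith
  define e where "e = y /\<^sub>R norm y"
  have ee: "e \<bullet> e = 1" using ny by (simp add: e_def dot_square_norm power2_eq_square)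
  let ?A = "schouten (\<zeta> y) q G" and ?A' = "schouten (\<xi> y) p H"
  \<comment> \<open>Prepared for \<open>ellipticity\<close> with \<theta> = a^2, \<tau> = \<mu>/a
    and the radial unit vector e.\<close>
  have main: "v \<bullet> (?A' *v v) \<le> a\<^sup>2 * (v \<bullet> (?A *v v) + \<mu> / a * (6 * B\<^sup>2 * r1 * (v \<bullet> v) - N * (e \<bullet> v)\<^sup>2))" for v
  proof -
    define V where "V = v \<bullet> v"
    define Y where "Y = y \<bullet> v"
    have V: "0 \<le> V" by (simp add: V_def)
    have HV: "v \<bullet> ((a *\<^sub>R G + z *\<^sub>R ?Hk + outer ?pk q + outer q ?pk) *v v)
        = a * (v \<bullet> (G *v v)) + z * (- 2 * \<mu> * V - 4 * \<alpha> * \<mu> * Y\<^sup>2) - 4 * \<mu> * Y * (q \<bullet> v)"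
      by (simp add: matrix_vector_mult_add_rdistrib matrix_vector_mult_diff_rdistrib scaleR_matrix_vector_assoc[symmetric]
          inner_add_right inner_diff_right inner_outer V_def Y_def power2_eq_square algebra_simps)
    have pp: "p \<bullet> p = a\<^sup>2 * (q \<bullet> q) - 4 * a * z * \<mu> * (q \<bullet> y) + 4 * z\<^sup>2 * \<mu>\<^sup>2 * (y \<bullet> y)"
      unfolding p by (simp add: inner_add_left inner_add_right inner_diff_left inner_diff_right inner_commute[of y q] power2_eq_square algebra_simps)
    have Q: "v \<bullet> (?A *v v) = z * (v \<bullet> (G *v v)) - (q \<bullet> q) / 2 * V"
      unfolding schouten_quadratic by (simp add: z_def V_def)
    have "v \<bullet> (?A' *v v) = a * z * (v \<bullet> (H *v v)) - (p \<bullet> p) / 2 * V"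
      unfolding schouten_quadratic az by (simp add: V_def)
    also have "\<dots> \<le> a * z * (a * (v \<bullet> (G *v v)) + z * (- 2 * \<mu> * V - 4 * \<alpha> * \<mu> * Y\<^sup>2) - 4 * \<mu> * Y * (q \<bullet> v)) - (p \<bullet> p) / 2 * V"
      using Hle[of v] a z unfolding HV by (intro diff_right_mono mult_left_mono) auto
    also have "\<dots> = a\<^sup>2 * (v \<bullet> (?A *v v)) + a * \<mu> * (- 2 * z\<^sup>2 * V - 4 * z * (Y * (q \<bullet> v)) + 2 * z * (q \<bullet> y) * V - 4 * \<alpha> * z\<^sup>2 * Y\<^sup>2)
        - 2 * z\<^sup>2 * \<mu>\<^sup>2 * (y \<bullet> y) * V"
      unfolding Q pp by (simp add: power2_eq_square algebra_simps add_divide_distrib diff_divide_distrib)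
    \<comment> \<open>In the constant 6, the mixed term with q and y contributes 4 and the cross
      term of the squared gradient contributes 2. The terms \<open>- 2 * z\<^sup>2 * V\<close> and
      the one with \<open>\<mu>\<^sup>2\<close> are nonpositive and are dropped.\<close>
    also have "\<dots> \<le> a\<^sup>2 * (v \<bullet> (?A *v v)) + a * \<mu> * (6 * B\<^sup>2 * r1 * V - N * (e \<bullet> v)\<^sup>2)"
    proof -
      have nq: "norm q * norm y \<le> B * r1"
        using \<zeta>(6) y B by (intro mult_mono) auto
      have zqy: "z * (norm q * norm y) \<le> B * (B * r1)"
        using B by (intro mult_mono[OF z(3) nq]) auto
      have "\<bar>Y * (q \<bullet> v)\<bar> \<le> (norm y * norm v) * (norm q * norm v)"
        unfolding Y_def abs_mult by (intro mult_mono Cauchy_Schwarz_ineq2) auto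
      also have "\<dots> = (norm q * norm y) * V"
        by (simp add: V_def dot_square_norm power2_eq_square)
      finally have "z * \<bar>Y * (q \<bullet> v)\<bar> \<le> z * ((norm q * norm y) * V)"
        using z by (intro mult_left_mono) auto
      also have "\<dots> \<le> (B * (B * r1)) * V"
        using mult_right_mono[OF zqy V] by (simp only: mult.assoc)
      finally have 0: "z * \<bar>Y * (q \<bullet> v)\<bar> \<le> B\<^sup>2 * r1 * V" by (simp add: power2_eq_square mult.assoc)
      have "- (z * (Y * (q \<bullet> v))) \<le> z * \<bar>Y * (q \<bullet> v)\<bar>"
        using mult_left_mono[of "- (Y * (q \<bullet> v))" "\<bar>Y * (q \<bullet> v)\<bar>" z] z by simp
      with 0 have 1: "- 4 * z * (Y * (q \<bullet> v)) \<le> 4 * (B\<^sup>2 * r1 * V)" by linarith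
      have "z * (q \<bullet> y) \<le> z * (norm q * norm y)"
        using z norm_cauchy_schwarz[of q y] by (intro mult_left_mono) auto
      also have "\<dots> \<le> B * (B * r1)" by (rule zqy)
      finally have 2: "2 * z * (q \<bullet> y) * V \<le> 2 * (B\<^sup>2 * r1 * V)"
        using V mult_right_mono[of "z * (q \<bullet> y)" "B * (B * r1)" V] by (simp add: power2_eq_square mult.assoc)
      have Ye: "Y\<^sup>2 = (norm y)\<^sup>2 * (e \<bullet> v)\<^sup>2"
      proof -
        have "Y = norm y * (e \<bullet> v)"
          unfolding Y_def e_def inner_scaleR_left mult.assoc[symmetric] using ny by simp
        then show ?thesis by (simp only: power_mult_distrib)
      qed
      have "N * (e \<bullet> v)\<^sup>2 \<le> (4 * \<alpha> * b\<^sup>2 * r0\<^sup>2) * (e \<bullet> v)\<^sup>2"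
        using N by (intro mult_right_mono) auto
      also have "\<dots> \<le> (4 * \<alpha> * z\<^sup>2 * (norm y)\<^sup>2) * (e \<bullet> v)\<^sup>2"
        using N z y \<zeta>(3) by (intro mult_right_mono mult_mono power_mono) auto
      finally have 3: "N * (e \<bullet> v)\<^sup>2 \<le> 4 * \<alpha> * z\<^sup>2 * Y\<^sup>2" unfolding Ye by (simp add: mult.assoc)
      have 4: "0 \<le> 2 * z\<^sup>2 * V" "0 \<le> 2 * z\<^sup>2 * \<mu>\<^sup>2 * (y \<bullet> y) * V" using V by auto
      have "- 2 * z\<^sup>2 * V - 4 * z * (Y * (q \<bullet> v)) + 2 * z * (q \<bullet> y) * V - 4 * \<alpha> * z\<^sup>2 * Y\<^sup>2
          \<le> 6 * B\<^sup>2 * r1 * V - N * (e \<bullet> v)\<^sup>2"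
      proof -
        have "- 2 * z\<^sup>2 * V \<le> 0" "- 4 * z * (Y * (q \<bullet> v)) = - (4 * z * (Y * (q \<bullet> v)))"
          "6 * B\<^sup>2 * r1 * V = 4 * (B\<^sup>2 * r1 * V) + 2 * (B\<^sup>2 * r1 * V)"
          using 4(1) by auto
        then show ?thesis using 1 2 3 by linarith
      qed
      then have "a * \<mu> * (- 2 * z\<^sup>2 * V - 4 * z * (Y * (q \<bullet> v)) + 2 * z * (q \<bullet> y) * V - 4 * \<alpha> * z\<^sup>2 * Y\<^sup>2)
          \<le> a * \<mu> * (6 * B\<^sup>2 * r1 * V - N * (e \<bullet> v)\<^sup>2)"
        using a \<kappa>(4) by (intro mult_left_mono) auto
      then show ?thesis using 4(2) by linarith
    qed
    also have "\<dots> = a\<^sup>2 * (v \<bullet> (?A *v v) + \<mu> / a * (6 * B\<^sup>2 * r1 * (v \<bullet> v) - N * (e \<bullet> v)\<^sup>2))"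
      using a by (simp add: V_def power2_eq_square algebra_simps)
    finally show ?thesis .
  qed
  have "0 < a\<^sup>2" "a\<^sup>2 \<le> 1" "0 < \<mu> / a" "\<mu> / a \<le> 1"
    using a \<kappa>(4) by (auto simp: power_le_one)
  from ell[OF \<zeta>(2) \<xi>(2) this ee] quad main show False by blast
qed


text \<open>Minimise the quotient of (1 - h) \<zeta> by \<xi>, where h vanishes on the inner sphere.
  A minimum m < 1 cannot lie on the inner sphere, since \<xi> \<le> \<zeta> there, nor on the outer
  one, where the gap \<delta> absorbs h. In between, \<xi> would touch \<kappa> \<zeta> from below
  with \<kappa> = (1 - h)/m, against \<open>barrier_touching\<close>.\<close>

theorem shell_barrier:
  fixes \<xi> \<zeta> :: "real ^ 'n \<Rightarrow> real"
  assumes k: "1 \<le> k" and r: "0 < r0" "r0 < r1"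
    and \<xi>: "solution k S \<xi> p H" "shell r0 r1 \<subseteq> S" and \<zeta>: "solution k T \<zeta> q G" "shell r0 r1 \<subseteq> T"
    and le: "\<And>y. y \<in> shell r0 r1 \<Longrightarrow> \<xi> y \<le> \<zeta> y"
    and less: "\<And>y. y \<in> shell r0 r1 \<Longrightarrow> r0 < norm y \<Longrightarrow> \<xi> y < \<zeta> y"
  obtains \<epsilon> where "0 < \<epsilon>" "\<And>y. y \<in> shell r0 r1 \<Longrightarrow> \<epsilon> * (y \<bullet> y - r0\<^sup>2) \<le> \<zeta> y - \<xi> y"
proof -
  let ?K = "shell r0 r1 :: (real ^ 'n) set"
  note X = solutionD[OF \<xi>(1)] and Z = solutionD[OF \<zeta>(1)]
  have cK: "compact ?K" by (rule compact_shell)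
  define i :: 'n where "i = undefined"
  have ne: "r1 *\<^sub>R axis i 1 \<in> ?K" using r by (simp add: shell_def)
  have cont\<zeta>: "continuous_on ?K \<zeta>" and cont\<xi>: "continuous_on ?K \<xi>" and contq: "continuous_on ?K q"
    and contG: "continuous_on ?K G"
    using X Z \<xi>(2) \<zeta>(2) by (auto intro: continuous_on_subset)
  obtain b0 where b0: "b0 \<in> ?K" "\<And>y. y \<in> ?K \<Longrightarrow> \<zeta> b0 \<le> \<zeta> y"
    using continuous_attains_inf[OF cK _ cont\<zeta>] ne by blast
  define b where "b = \<zeta> b0"
  have b: "0 < b" using Z(5) b0(1) \<zeta>(2) by (auto simp: b_def)
  obtain B1 where B1: "\<And>y. y \<in> ?K \<Longrightarrow> norm (\<zeta> y) \<le> B1"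
    using compact_imp_bounded[OF compact_continuous_image[OF cont\<zeta> cK]] unfolding bounded_iff by auto
  obtain B2 where B2: "\<And>y. y \<in> ?K \<Longrightarrow> norm (q y) \<le> B2"
    using compact_imp_bounded[OF compact_continuous_image[OF contq cK]] unfolding bounded_iff by auto
  define B where "B = max B1 B2"
  have B: "\<zeta> y \<le> B" "norm (q y) \<le> B" if "y \<in> ?K" for y
    using B1[OF that] B2[OF that] by (auto simp: B_def)
  have Bpos: "0 < B" using b B(1)[OF b0(1)] by (simp add: b_def)
  have "continuous_on ?K (\<lambda>y. schouten (\<zeta> y) (q y) (G y))"
    unfolding schouten_def by (intro continuous_intros cont\<zeta> contq contG) auto
  then obtain \<Lambda> where \<Lambda>: "\<And>y v. y \<in> ?K \<Longrightarrow> \<bar>v \<bullet> (schouten (\<zeta> y) (q y) (G y) *v v)\<bar> \<le> \<Lambda> * (v \<bullet> v)"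
    using quadratic_form_bound[OF cK] by blast
  have c0: "0 \<le> 6 * B\<^sup>2 * r1" using r by simp
  obtain N where N: "0 < N" and ell: "\<And>(A :: real ^ 'n ^ 'n) A' \<theta> \<tau> e.
      \<lbrakk>admissible k A; admissible k A';
       0 < \<theta>; \<theta> \<le> 1; 0 < \<tau>; \<tau> \<le> 1; e \<bullet> e = 1;
       \<And>v. \<bar>v \<bullet> (A *v v)\<bar> \<le> \<Lambda> * (v \<bullet> v);
       \<And>v. v \<bullet> (A' *v v) \<le> \<theta> * (v \<bullet> (A *v v) + \<tau> * (6 * B\<^sup>2 * r1 * (v \<bullet> v) - N * (e \<bullet> v)\<^sup>2))\<rbrakk> \<Longrightarrow> False"
    using ellipticity[OF k c0, where \<Lambda> = \<Lambda>] by blast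
  \<comment> \<open>Meets the requirement on N in \<open>barrier_touching\<close> with equality. N
    was obtained from bounds for \<zeta> on the shell alone, so the choice is not circular.\<close>
  define \<alpha> where "\<alpha> = N / (4 * b\<^sup>2 * r0\<^sup>2)"
  have \<alpha>: "0 < \<alpha>" "N \<le> 4 * \<alpha> * b\<^sup>2 * r0\<^sup>2" using N b r by (simp_all add: \<alpha>_def)
  define E where "E y = exp (\<alpha> * (y \<bullet> y - r0\<^sup>2))" for y :: "real ^ 'n"
  define M where "M = exp (\<alpha> * (r1\<^sup>2 - r0\<^sup>2))"
  have yy: "r0\<^sup>2 \<le> y \<bullet> y" "y \<bullet> y \<le> r1\<^sup>2" if "y \<in> ?K" for y
    using that r unfolding dot_square_norm by (auto simp: shell_def intro!: power_mono)
  have E: "1 \<le> E y" "E y \<le> M" if "y \<in> ?K" for y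
    using yy[OF that] \<alpha>(1) by (auto simp: E_def M_def)
  have M: "1 \<le> M" using E[OF ne] by linarith
  define K1 where "K1 = ?K \<inter> sphere 0 r1"
  have "compact K1" unfolding K1_def by (intro compact_Int cK) auto
  moreover have "K1 \<noteq> {}" using ne r unfolding K1_def by auto
  moreover have "continuous_on K1 (\<lambda>y. \<zeta> y - \<xi> y)"
    unfolding K1_def by (intro continuous_intros continuous_on_subset[OF cont\<zeta>] continuous_on_subset[OF cont\<xi>]) auto
  ultimately obtain d0 where d0: "d0 \<in> K1" "\<And>y. y \<in> K1 \<Longrightarrow> \<zeta> d0 - \<xi> d0 \<le> \<zeta> y - \<xi> y"
    using continuous_attains_inf[of K1] by blast
  define \<delta> where "\<delta> = \<zeta> d0 - \<xi> d0"
  have \<delta>: "0 < \<delta>" using less[of d0] d0(1) r by (auto simp: \<delta>_def K1_def)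
  \<comment> \<open>The three bounds serve, in this order, h \<le> 1/2, then \<mu> \<le> \<kappa> at
    the touching point, and h \<zeta> \<le> \<delta> on the outer sphere.\<close>
  define \<epsilon> where "\<epsilon> = min (1 / (2 * M)) (min (1 / (2 * \<alpha> * M)) (\<delta> / (B * M)))"
  have \<epsilon>: "0 < \<epsilon>" using M \<alpha>(1) \<delta> Bpos by (simp add: \<epsilon>_def)
  have "\<epsilon> \<le> 1 / (2 * M)" "\<epsilon> \<le> 1 / (2 * \<alpha> * M)" "\<epsilon> \<le> \<delta> / (B * M)" by (auto simp: \<epsilon>_def)
  then have \<epsilon>M: "\<epsilon> * M \<le> 1 / 2" "\<epsilon> * \<alpha> * M \<le> 1 / 2" "\<epsilon> * M * B \<le> \<delta>"
    using M \<alpha>(1) Bpos by (simp_all add: pos_le_divide_eq mult_ac)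
  define h where "h y = \<epsilon> * (E y - 1)" for y
  have h: "0 \<le> h y" "h y \<le> 1 / 2" if "y \<in> ?K" for y
  proof -
    show "0 \<le> h y" using E[OF that] \<epsilon> by (simp add: h_def)
    have "h y \<le> \<epsilon> * M" using E[OF that] \<epsilon> by (simp add: h_def)
    then show "h y \<le> 1 / 2" using \<epsilon>M by linarith
  qed
  have claim: "\<xi> y \<le> (1 - h y) * \<zeta> y" if yK: "y \<in> ?K" for y
  proof -
    define \<rho> where "\<rho> y = (1 - h y) * \<zeta> y / \<xi> y" for y
    have \<xi>pos: "0 < \<xi> y" if "y \<in> ?K" for y using X(5) \<xi>(2) that by auto
    have "continuous_on ?K \<rho>"
      unfolding \<rho>_def h_def E_def using \<xi>pos
      by (intro continuous_intros cont\<zeta> cont\<xi>) (auto simp: less_imp_neq[symmetric])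
    then obtain z where z: "z \<in> ?K" "\<And>y. y \<in> ?K \<Longrightarrow> \<rho> z \<le> \<rho> y"
      using continuous_attains_inf[OF cK _] ne by blast
    have "1 \<le> \<rho> z"
    proof (rule ccontr)
      assume "\<not> 1 \<le> \<rho> z"
      define m where "m = \<rho> z"
      have m1: "m < 1" using \<open>\<not> 1 \<le> \<rho> z\<close> by (simp add: m_def)
      have \<zeta>pos: "0 < \<zeta> y" if "y \<in> ?K" for y using b b0(2)[OF that] by (simp add: b_def)
      have m0: "0 < m" using h[OF z(1)] \<zeta>pos[OF z(1)] \<xi>pos[OF z(1)] by (simp add: m_def \<rho>_def)
      have nr0: "norm z \<noteq> r0"
      proof
        assume "norm z = r0"
        then have "h z = 0" by (simp add: h_def E_def dot_square_norm)
        then have "1 \<le> m" using le[OF z(1)] \<xi>pos[OF z(1)] by (simp add: m_def \<rho>_def)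
        then show False using m1 by simp
      qed
      have nr1: "norm z \<noteq> r1"
      proof
        assume "norm z = r1"
        then have "z \<in> K1" using z(1) by (simp add: K1_def)
        then have "\<delta> \<le> \<zeta> z - \<xi> z" using d0(2) by (simp add: \<delta>_def)
        moreover have "h z * \<zeta> z \<le> (\<epsilon> * M) * B"
          using E[OF z(1)] \<epsilon> M B(1)[OF z(1)] \<zeta>pos[OF z(1)] by (intro mult_mono) (auto simp: h_def)
        ultimately have "\<xi> z \<le> (1 - h z) * \<zeta> z" using \<epsilon>M(3) by (simp add: left_diff_distrib)
        then have "1 \<le> m" using \<xi>pos[OF z(1)] by (simp add: m_def \<rho>_def)
        then show False using m1 by simp
      qed
      have nz: "r0 < norm z" "norm z < r1" using z(1) nr0 nr1 by (auto simp: shell_def)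
      define \<kappa> where "\<kappa> y = (1 - \<epsilon> * (exp (\<alpha> * (y \<bullet> y - r0\<^sup>2)) - 1)) / m" for y :: "real ^ 'n"
      have \<kappa>h: "\<kappa> y = (1 - h y) / m" for y by (simp add: \<kappa>_def h_def E_def)
      define \<mu> where "\<mu> = \<epsilon> * \<alpha> * exp (\<alpha> * (z \<bullet> z - r0\<^sup>2)) / m"
      have jk: "jet2 \<kappa> z (- (2 * \<mu>) *\<^sub>R z) (- (2 * \<mu>) *\<^sub>R mat 1 - (4 * \<alpha> * \<mu>) *\<^sub>R outer z z)"
        unfolding \<kappa>_def[abs_def] \<mu>_def using jet2_barrier[of m \<epsilon> \<alpha> "r0\<^sup>2" z] m0 by simp
      have kz: "\<kappa> z * \<zeta> z = \<xi> z"
      proof -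
        have "m * \<xi> z = (1 - h z) * \<zeta> z" using \<xi>pos[OF z(1)] by (simp add: m_def \<rho>_def)
        then show ?thesis using m0 by (simp add: \<kappa>h field_simps)
      qed
      have k1: "\<kappa> z \<le> 1"
      proof -
        have "\<kappa> z * \<zeta> z \<le> 1 * \<zeta> z" using kz le[OF z(1)] by simp
        then show ?thesis using \<zeta>pos[OF z(1)] by (simp only: mult_le_cancel_right_pos)
      qed
      have mu: "0 < \<mu>" "\<mu> \<le> \<kappa> z"
      proof -
        show "0 < \<mu>" using \<epsilon> \<alpha>(1) m0 by (simp add: \<mu>_def)
        have "\<epsilon> * \<alpha> * E z \<le> \<epsilon> * \<alpha> * M" using E[OF z(1)] \<epsilon> \<alpha>(1) by simp
        then have "\<epsilon> * \<alpha> * E z \<le> 1 - h z" using \<epsilon>M(2) h[OF z(1)] by linarith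
        then show "\<mu> \<le> \<kappa> z" unfolding \<kappa>h \<mu>_def using m0 by (simp add: E_def divide_right_mono)
      qed
      have touch: "\<forall>\<^sub>F y in nhds z. \<xi> y \<le> \<kappa> y * \<zeta> y"
      proof -
        have "open {y :: real ^ 'n. r0 < norm y \<and> norm y < r1}"
          by (intro open_Collect_conj open_Collect_less continuous_intros)
        then have "\<forall>\<^sub>F y in nhds z. y \<in> {y. r0 < norm y \<and> norm y < r1}"
          using nz by (intro eventually_nhds_in_open) auto
        then show ?thesis
        proof eventually_elim
          case (elim y)
          then have "y \<in> ?K" by (auto simp: shell_def)
          then have "m \<le> (1 - h y) * \<zeta> y / \<xi> y" "0 < \<xi> y"
            using z(2) \<xi>pos by (auto simp: m_def \<rho>_def)
          then show ?case using m0 by (simp add: \<kappa>h field_simps)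
        qed
      qed
      have zS: "z \<in> S" "z \<in> T" using z(1) \<xi>(2) \<zeta>(2) by auto
      have "b \<le> \<zeta> z" using b0(2)[OF z(1)] by (simp add: b_def)
      show False
      proof (rule barrier_touching[where ?r1.0 = r1 and N = N and \<Lambda> = \<Lambda>, OF k X(6)[OF zS(1)] X(7)[OF zS(1)] X(5)[OF zS(1)]
            Z(6)[OF zS(2)] Z(7)[OF zS(2)] b \<open>b \<le> \<zeta> z\<close> B(1)[OF z(1)] B(2)[OF z(1)] r(1) _ _ \<Lambda>[OF z(1)] jk kz k1 mu touch \<alpha>(2)])
        fix A A' :: "real ^ 'n ^ 'n" and e :: "real ^ 'n" and \<theta> \<tau> :: real
        assume "admissible k A" "admissible k A'"
          "0 < \<theta>" "\<theta> \<le> 1" "0 < \<tau>" "\<tau> \<le> 1" "e \<bullet> e = 1"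
          "\<And>v. \<bar>v \<bullet> (A *v v)\<bar> \<le> \<Lambda> * (v \<bullet> v)"
          "\<And>v. v \<bullet> (A' *v v) \<le> \<theta> * (v \<bullet> (A *v v) + \<tau> * (6 * B\<^sup>2 * r1 * (v \<bullet> v) - N * (e \<bullet> v)\<^sup>2))"
        then show False by (rule ell)
      qed (use nz \<alpha>(1) in auto)
    qed
    then have "1 \<le> \<rho> y" using z(2)[OF yK] by linarith
    then show ?thesis using \<xi>pos[OF yK] by (simp add: \<rho>_def)
  qed
  show ?thesis
  proof (rule that[of "\<epsilon> * \<alpha> * b"])
    show "0 < \<epsilon> * \<alpha> * b" using \<epsilon> \<alpha>(1) b by simp
    fix y assume y: "y \<in> ?K"
    \<comment> \<open>The tangent line of the exponential replaces the barrier by a quadratic one,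
      and b bounds \<zeta> from below.\<close>
    have "\<alpha> * (y \<bullet> y - r0\<^sup>2) \<le> E y - 1" unfolding E_def using exp_ge_add_one_self by (simp add: le_diff_eq add.commute)
    then have "\<epsilon> * \<alpha> * b * (y \<bullet> y - r0\<^sup>2) \<le> h y * b"
      using \<epsilon> b by (simp add: h_def mult_ac mult_left_mono)
    also have "\<dots> \<le> h y * \<zeta> y" using h[OF y] b0(2)[OF y] by (intro mult_left_mono) (auto simp: b_def)
    also have "\<dots> \<le> \<zeta> y - \<xi> y" using claim[OF y] by (simp add: left_diff_distrib)
    finally show "\<epsilon> * \<alpha> * b * (y \<bullet> y - r0\<^sup>2) \<le> \<zeta> y - \<xi> y" .
  qed
qed

section \<open>Moving spheres\<close>

lemma kelvin_on_sphere: "norm y = l \<Longrightarrow> y \<noteq> 0 \<Longrightarrow> inversion l y = y"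
  by (auto simp: inversion_def dot_square_norm)

lemma norm_inversion_le:
  assumes "0 < l" "l \<le> norm y"
  shows "norm (inversion l y) \<le> l"
proof -
  have "l * l \<le> l * norm y" using assms by (intro mult_left_mono) auto
  moreover have "0 < norm y" using assms by linarith
  ultimately show ?thesis
    unfolding norm_inversion by (simp add: pos_divide_le_eq power2_eq_square)
qed

text \<open>Spheres are centred at the origin; other centres are reached by translation.
  \<open>bdry\<close> keeps contact off the outer sphere for all radii below l0, and the larger ball
  of radius \<rho>1 makes the closed shells lie in an open domain.\<close>

locale moving_spheres =
  fixes k :: nat and \<rho> \<rho>1 l0 :: real and \<xi> p and H :: "real ^ 'n \<Rightarrow> real ^ 'n ^ 'n"
  assumes k: "1 \<le> k" and \<rho>: "0 < \<rho>" "\<rho> < \<rho>1" and l0: "0 < l0" "l0 \<le> \<rho>"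
    and sol: "solution k (ball 0 \<rho>1) \<xi> p H"
    and bdry: "\<And>l y. 0 < l \<Longrightarrow> l < l0 \<Longrightarrow> norm y = \<rho> \<Longrightarrow> \<xi> y < kelvin l \<xi> y"
begin

definition good :: "real \<Rightarrow> bool" where
  "good l \<longleftrightarrow> (\<forall>y\<in>shell l \<rho>. \<xi> y \<le> kelvin l \<xi> y)"

lemmas S = solutionD[OF sol]

lemma shell_subset_ball: "0 < l \<Longrightarrow> shell l \<rho> \<subseteq> ball (0 :: real ^ 'n) \<rho>1"
  using \<rho> by (auto simp: shell_def)

lemma shell_subset_inverted:
  assumes l: "0 < l" "l \<le> \<rho>" "l \<le> r0"
  shows "shell r0 \<rho> \<subseteq> (- {0} \<inter> inversion l -` ball 0 \<rho>1 :: (real ^ 'n) set)"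
proof
  fix y :: "real ^ 'n" assume y: "y \<in> shell r0 \<rho>"
  then have n: "l \<le> norm y" using l by (simp add: shell_def)
  then have "norm (inversion l y) \<le> l" using l by (intro norm_inversion_le) auto
  then show "y \<in> - {0} \<inter> inversion l -` ball 0 \<rho>1" using n l \<rho> by auto
qed

lemma continuous_kelvin:
  assumes "0 < l" "l \<le> \<rho>" shows "continuous_on (shell l \<rho>) (kelvin l \<xi>)"
  using solutionD(4)[OF solution_kelvin[OF sol assms(1)]] shell_subset_inverted[OF assms order_refl]
  by (rule continuous_on_subset)

lemma strict_barrier:
  assumes l: "0 < l" "l < l0" and good: "good l"
  obtains \<epsilon> where "0 < \<epsilon>" "\<And>y. y \<in> shell l \<rho> \<Longrightarrow> \<epsilon> * (y \<bullet> y - l\<^sup>2) \<le> kelvin l \<xi> y - \<xi> y"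
proof -
  have l\<rho>: "l < \<rho>" using l l0 by simp
  define i :: 'n where "i = undefined"
  \<comment> \<open>Beyond the farthest contact point \<open>z\<close> the inequality is strict, so the barrier applies from radius \<open>norm z\<close>
    on; contact at \<open>z\<close> outside the sphere of radius \<open>l\<close> would force equal gradients there.\<close>
  define Z where "Z = {y \<in> shell l \<rho>. kelvin l \<xi> y - \<xi> y = 0}"
  have c: "continuous_on (shell l \<rho>) (\<lambda>y. kelvin l \<xi> y - \<xi> y)"
    using l\<rho> l by (intro continuous_intros continuous_kelvin continuous_on_subset[OF S(4) shell_subset_ball]) auto
  have "compact Z"
  proof -
    have "closed Z" unfolding Z_def
      using continuous_closed_preimage_constant[OF c compact_imp_closed[OF compact_shell], of 0] by simp
    moreover have "Z \<subseteq> shell l \<rho>" by (auto simp: Z_def)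
    ultimately show ?thesis using compact_shell by (metis compact_Int_closed inf.absorb_iff2)
  qed
  moreover have "l *\<^sub>R axis i 1 \<in> Z"
    using l l\<rho> kelvin_on_sphere[of "l *\<^sub>R axis i 1 :: real ^ 'n" l]
    by (auto simp: Z_def shell_def kelvin_def dot_square_norm)
  then have "Z \<noteq> {}" by auto
  moreover have "continuous_on Z norm" by (intro continuous_intros)
  ultimately obtain z where z: "z \<in> Z" "\<And>y. y \<in> Z \<Longrightarrow> norm y \<le> norm z"
    using continuous_attains_sup[of Z norm] by blast
  define r0 where "r0 = norm z"
  have zs: "z \<in> shell l \<rho>" and zeq: "kelvin l \<xi> z = \<xi> z" using z(1) by (auto simp: Z_def)
  have r0: "l \<le> r0" "r0 \<le> \<rho>" using zs by (auto simp: r0_def shell_def)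
  have "r0 \<noteq> \<rho>" using bdry[OF l, of z] zeq by (auto simp: r0_def)
  then have r0\<rho>: "r0 < \<rho>" using r0 by simp
  have r0pos: "0 < r0" using r0 l by simp
  have sub: "shell r0 \<rho> \<subseteq> shell l \<rho>" using r0 by (auto simp: shell_def)
  have le: "\<xi> y \<le> kelvin l \<xi> y" if "y \<in> shell l \<rho>" for y using good that by (simp add: good_def)
  have less: "\<xi> y < kelvin l \<xi> y" if "y \<in> shell r0 \<rho>" "r0 < norm y" for y
  proof -
    have "y \<notin> Z" using z(2)[of y] that by (auto simp: r0_def)
    then show ?thesis using le[of y] that sub by (force simp: Z_def)
  qed
  obtain \<epsilon> where \<epsilon>: "0 < \<epsilon>" "\<And>y. y \<in> shell r0 \<rho> \<Longrightarrow> \<epsilon> * (y \<bullet> y - r0\<^sup>2) \<le> kelvin l \<xi> y - \<xi> y"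
    using shell_barrier[OF k r0pos r0\<rho> sol shell_subset_ball[OF r0pos] solution_kelvin[OF sol l(1)]
        shell_subset_inverted[OF l(1) less_imp_le[OF l\<rho>] r0(1)] le less] sub by blast
  have "r0 = l"
  proof (rule ccontr)
    assume "r0 \<noteq> l"
    then have lr0: "l < r0" using r0 by simp
    have zU: "z \<in> - {0} \<inter> inversion l -` ball 0 \<rho>1"
      using shell_subset_inverted[OF l(1) less_imp_le[OF l\<rho>] order_refl] zs by blast
    have zb: "z \<in> ball 0 \<rho>1" using shell_subset_ball[OF l(1)] zs by blast
    let ?q = "(2 * (\<xi> (inversion l z) - p (inversion l z) \<bullet> inversion l z) / l\<^sup>2) *\<^sub>R z + p (inversion l z)"
    obtain G where jk: "jet2 (kelvin l \<xi>) z ?q G"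
      using solutionD(6)[OF solution_kelvin[OF sol l(1)] zU] by blast
    have j\<xi>: "jet2 \<xi> z (p z) (H z)" using S(6)[OF zb] .
    have "open {y :: real ^ 'n. l < norm y \<and> norm y < \<rho>}"
      by (intro open_Collect_conj open_Collect_less continuous_intros)
    then have near: "\<forall>\<^sub>F y in nhds z. y \<in> {y. l < norm y \<and> norm y < \<rho>}"
      using lr0 r0\<rho> by (intro eventually_nhds_in_open) (auto simp: r0_def)
    have p1: "p z = ?q"
    proof (rule jet2_touching(1)[OF j\<xi> jk])
      show "\<forall>\<^sub>F y in nhds z. \<xi> y \<le> kelvin l \<xi> y"
        using near by eventually_elim (auto simp: shell_def intro!: le)
    qed (simp add: zeq)
    \<comment> \<open>Adding \<epsilon> (|y|^2 - r0^2) to \<xi> keeps it below the Kelvin transform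
      near z: outside radius r0 by the barrier, inside because the added term is nonpositive. Both
      functions touch at z, so their gradients agree there and \<open>2 * \<epsilon>\<close> times z
      would vanish.\<close>
    have "jet2 (\<lambda>y. \<epsilon> * (y \<bullet> y) + (- (\<epsilon> * r0\<^sup>2))) z (\<epsilon> *\<^sub>R (2 *\<^sub>R z)) (\<epsilon> *\<^sub>R (2 *\<^sub>R mat 1) + 0 *\<^sub>R outer (2 *\<^sub>R z) (2 *\<^sub>R z))"
      by (rule jet2_compose[OF jet2_norm_sq, where r = 1 and ?g1.0 = "\<lambda>_. \<epsilon>"]) (auto intro!: derivative_eq_intros)
    from jet2_add[OF j\<xi> this]
    have "p z + \<epsilon> *\<^sub>R (2 *\<^sub>R z) = ?q"
    proof (rule jet2_touching(1)[OF _ jk])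
      show "\<forall>\<^sub>F y in nhds z. \<xi> y + (\<epsilon> * (y \<bullet> y) + - (\<epsilon> * r0\<^sup>2)) \<le> kelvin l \<xi> y"
        using near
      proof eventually_elim
        case (elim y)
        show ?case
        proof (cases "r0 \<le> norm y")
          case True
          then have "\<epsilon> * (y \<bullet> y - r0\<^sup>2) \<le> kelvin l \<xi> y - \<xi> y"
            using elim by (intro \<epsilon>(2)) (auto simp: shell_def)
          then show ?thesis by (simp add: right_diff_distrib)
        next
          case False
          then have "y \<bullet> y \<le> r0\<^sup>2" unfolding dot_square_norm by (intro power_mono) auto
          then have "\<epsilon> * (y \<bullet> y) \<le> \<epsilon> * r0\<^sup>2" using \<epsilon>(1) by simp
          moreover have "\<xi> y \<le> kelvin l \<xi> y" using elim by (intro le) (auto simp: shell_def)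
          ultimately show ?thesis by linarith
        qed
      qed
    qed (simp add: zeq r0_def dot_square_norm)
    then have "\<epsilon> *\<^sub>R (2 *\<^sub>R z) = 0" using p1 by simp
    then show False using \<epsilon>(1) r0pos by (simp add: r0_def)
  qed
  then show ?thesis using that \<epsilon> by blast
qed

text \<open>On the sphere of inversion the gradients of \<open>kelvin l \<xi>\<close> and \<xi>
  differ by \<open>2 * (\<xi> z - p z \<bullet> z) / l\<^sup>2\<close> times z, and the barrier
  forces their difference to grow outward at a positive linear rate. Equivalently, s -> \<xi>(s z)/s
  has negative derivative at s = 1.\<close>

lemma radial_derivative_neg:
  assumes l: "0 < l" "l < l0" and good: "good l" and z: "norm z = l"
  shows "p z \<bullet> z < \<xi> z"
proof -
  have l\<rho>: "l < \<rho>" using l l0 by simp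
  obtain \<epsilon> where \<epsilon>: "0 < \<epsilon>" "\<And>y. y \<in> shell l \<rho> \<Longrightarrow> \<epsilon> * (y \<bullet> y - l\<^sup>2) \<le> kelvin l \<xi> y - \<xi> y"
    using strict_barrier[OF l good] by blast
  have z0: "z \<noteq> 0" using z l by auto
  have inv: "inversion l z = z" using kelvin_on_sphere[OF z z0] .
  have zU: "z \<in> - {0} \<inter> inversion l -` ball 0 \<rho>1" using inv z0 z l l0 \<rho> by auto
  have zb: "z \<in> ball 0 \<rho>1" using zU inv by auto
  let ?c = "2 * (\<xi> z - p z \<bullet> z) / l\<^sup>2"
  obtain G where jk: "jet2 (kelvin l \<xi>) z (?c *\<^sub>R z + p z) G"
    using solutionD(6)[OF solution_kelvin[OF sol l(1)] zU] unfolding inv by blast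
  have "((\<lambda>y. kelvin l \<xi> y - \<xi> y) has_derivative (\<lambda>h. (?c *\<^sub>R z + p z) \<bullet> h - p z \<bullet> h)) (at z)"
    by (intro has_derivative_diff jet2_has_derivative[OF jk] jet2_has_derivative[OF S(6)[OF zb]])
  then have "((\<lambda>y. kelvin l \<xi> y - \<xi> y) has_derivative (\<lambda>h. (?c *\<^sub>R z) \<bullet> h)) (at (z + 0 *\<^sub>R z))"
    by (simp add: inner_add_left)
  from line_deriv[OF this]
  have "((\<lambda>t. kelvin l \<xi> (z + t *\<^sub>R z) - \<xi> (z + t *\<^sub>R z)) has_real_derivative (?c *\<^sub>R z) \<bullet> z) (at 0)" .
  then have "((\<lambda>t. ((kelvin l \<xi> (z + t *\<^sub>R z) - \<xi> (z + t *\<^sub>R z)) - (kelvin l \<xi> z - \<xi> z)) / t) \<longlongrightarrow> (?c *\<^sub>R z) \<bullet> z) (at 0)"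
    by (simp add: has_field_derivative_iff)
  moreover have "kelvin l \<xi> z = \<xi> z" using l z unfolding kelvin_def inv by (simp add: dot_square_norm)
  ultimately have lim: "((\<lambda>t. (kelvin l \<xi> (z + t *\<^sub>R z) - \<xi> (z + t *\<^sub>R z)) / t) \<longlongrightarrow> (?c *\<^sub>R z) \<bullet> z) (at_right 0)"
    by (auto intro: tendsto_mono[OF at_le])
  have "\<forall>\<^sub>F t in at_right 0. 2 * \<epsilon> * l\<^sup>2 \<le> (kelvin l \<xi> (z + t *\<^sub>R z) - \<xi> (z + t *\<^sub>R z)) / t"
    unfolding eventually_at_right_field
  proof (intro exI[of _ "\<rho> / l - 1"] conjI allI impI)
    show "0 < \<rho> / l - 1" using l l\<rho> by simp
    fix t assume t: "0 < t" "t < \<rho> / l - 1"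
    have e: "z + t *\<^sub>R z = (1 + t) *\<^sub>R z" by (simp add: scaleR_add_left)
    have n: "norm (z + t *\<^sub>R z) = (1 + t) * l" using t z unfolding e by simp
    have "(1 + t) * l \<le> \<rho>" using t l by (simp add: field_simps)
    then have "z + t *\<^sub>R z \<in> shell l \<rho>" using t l by (simp add: shell_def n)
    from \<epsilon>(2)[OF this] have "\<epsilon> * (((1 + t) * l)\<^sup>2 - l\<^sup>2) \<le> kelvin l \<xi> (z + t *\<^sub>R z) - \<xi> (z + t *\<^sub>R z)"
      unfolding dot_square_norm n .
    moreover have "\<epsilon> * (((1 + t) * l)\<^sup>2 - l\<^sup>2) = 2 * \<epsilon> * l\<^sup>2 * t + \<epsilon> * l\<^sup>2 * t\<^sup>2"
      by (simp add: power2_eq_square algebra_simps)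
    moreover have "0 \<le> \<epsilon> * l\<^sup>2 * t\<^sup>2" using \<epsilon>(1) by simp
    ultimately show "2 * \<epsilon> * l\<^sup>2 \<le> (kelvin l \<xi> (z + t *\<^sub>R z) - \<xi> (z + t *\<^sub>R z)) / t"
      using t by (simp add: pos_le_divide_eq)
  qed
  from tendsto_lowerbound[OF lim this] have "2 * \<epsilon> * l\<^sup>2 \<le> ?c * (z \<bullet> z)" by simp
  then have "2 * \<epsilon> * l\<^sup>2 \<le> 2 * (\<xi> z - p z \<bullet> z)" using l z by (simp add: dot_square_norm)
  moreover have "0 < 2 * \<epsilon> * l\<^sup>2" using \<epsilon>(1) l by simp
  ultimately have "0 < 2 * (\<xi> z - p z \<bullet> z)" by (rule less_le_trans[rotated])
  then show ?thesis by simp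
qed

text \<open>With s0 = l^2/|y|^2 a violation reads \<xi>(s0 y)/s0 < \<xi>(y), so s -> \<xi>(s y)/s
  has positive derivative somewhere between s0 and 1. This converts a violation into a closed
  first-order condition that survives limits, even when y approaches the sphere of
  inversion.\<close>

lemma bad_radial_derivative:
  assumes l: "0 < l" "l < l0" and y: "y \<in> shell l \<rho>" and bad: "kelvin l \<xi> y < \<xi> y"
  obtains s where "l\<^sup>2 / (norm y)\<^sup>2 \<le> s" "s \<le> 1" "\<xi> (s *\<^sub>R y) \<le> p (s *\<^sub>R y) \<bullet> (s *\<^sub>R y)"
proof -
  define s0 where "s0 = l\<^sup>2 / (norm y)\<^sup>2"
  have ny: "l \<le> norm y" "norm y \<le> \<rho>" "0 < norm y" using y l by (auto simp: shell_def)
  have s0: "0 < s0" "s0 \<le> 1" using ny l by (auto simp: s0_def intro!: power_mono)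
  have k0: "kelvin l \<xi> y = \<xi> (s0 *\<^sub>R y) / s0"
    by (simp add: kelvin_def inversion_def s0_def dot_square_norm)
  have "s0 \<noteq> 1" using k0 bad by auto
  then have s1: "s0 < 1" using s0 by simp
  define g where "g s = \<xi> (s *\<^sub>R y) / s" for s
  have deriv: "(g has_real_derivative (p (s *\<^sub>R y) \<bullet> y * s - \<xi> (s *\<^sub>R y)) / (s * s)) (at s)" if "s0 \<le> s" "s \<le> 1" for s
  proof -
    have "norm (s *\<^sub>R y) \<le> norm y" using that s0 by (simp add: mult_left_le_one_le)
    then have "norm (s *\<^sub>R y) < \<rho>1" using ny \<rho> by linarith
    then have "s *\<^sub>R y \<in> ball 0 \<rho>1" by (simp only: mem_ball_0)
    then have "(\<xi> has_derivative (\<lambda>h. p (s *\<^sub>R y) \<bullet> h)) (at (0 + s *\<^sub>R y))"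
      using jet2_has_derivative[OF S(6)] by simp
    from line_deriv[OF this] have "((\<lambda>s. \<xi> (s *\<^sub>R y)) has_real_derivative p (s *\<^sub>R y) \<bullet> y) (at s)" by simp
    from DERIV_divide[OF this DERIV_ident] show ?thesis using that s0 by (simp add: g_def[abs_def])
  qed
  from MVT2[OF s1 deriv] obtain s where s: "s0 < s" "s < 1"
    "g 1 - g s0 = (1 - s0) * ((p (s *\<^sub>R y) \<bullet> y * s - \<xi> (s *\<^sub>R y)) / (s * s))" by auto
  have "0 < g 1 - g s0" using bad k0 by (simp add: g_def)
  then have "0 < (p (s *\<^sub>R y) \<bullet> y * s - \<xi> (s *\<^sub>R y)) / (s * s)"
    unfolding s(3) using s1 by (simp only: zero_less_mult_iff) linarith
  then have "0 < p (s *\<^sub>R y) \<bullet> y * s - \<xi> (s *\<^sub>R y)"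
    using s s0 by (simp add: zero_less_divide_iff)
  then show ?thesis using that[of s] s by (simp add: s0_def mult.commute)
qed

lemma kelvin_sequence:
  assumes "ls \<longlonglongrightarrow> l" "l \<noteq> 0" "ys \<longlonglongrightarrow> y" "y \<noteq> 0" "norm (inversion l y) < \<rho>1"
  shows "(\<lambda>m. kelvin (ls m) \<xi> (ys m)) \<longlonglongrightarrow> kelvin l \<xi> y"
proof -
  have inv: "(\<lambda>m. inversion (ls m) (ys m)) \<longlonglongrightarrow> inversion l y"
    unfolding inversion_def using assms by (intro tendsto_intros) auto
  have "isCont \<xi> (inversion l y)"
    using S(6)[of "inversion l y"] assms(5) jet2_isCont by auto
  then have "(\<lambda>m. \<xi> (inversion (ls m) (ys m))) \<longlonglongrightarrow> \<xi> (inversion l y)"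
    using inv by (rule isCont_tendsto_compose)
  then show ?thesis
    unfolding kelvin_def using assms by (intro tendsto_intros) auto
qed

lemma tendsto_ball:
  assumes "ys \<longlonglongrightarrow> y" "norm y < \<rho>1"
  shows "(\<lambda>m. \<xi> (ys m)) \<longlonglongrightarrow> \<xi> y" "(\<lambda>m. p (ys m)) \<longlonglongrightarrow> p y"
proof -
  show "(\<lambda>m. \<xi> (ys m)) \<longlonglongrightarrow> \<xi> y"
    by (rule isCont_tendsto_compose[OF jet2_isCont[OF S(6)] assms(1)]) (use assms(2) in simp)
  have "isCont p y" using S(1,2) assms(2) by (auto simp: continuous_on_eq_continuous_at)
  then show "(\<lambda>m. p (ys m)) \<longlonglongrightarrow> p y" using assms(1) by (rule isCont_tendsto_compose)
qed

theorem all_good: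
  assumes "0 < l" "l < l0" shows "good l"
proof (rule ccontr)
  assume "\<not> good l"
  define Bd where "Bd = {l. 0 < l \<and> l < l0 \<and> \<not> good l}"
  have ne: "l \<in> Bd" using assms \<open>\<not> good l\<close> by (simp add: Bd_def)
  have bdd: "bdd_below Bd" by (rule bdd_belowI[of _ 0]) (auto simp: Bd_def)
  \<comment> \<open>\<open>L = 0\<close> is not excluded: starting the process and continuing it are treated together.\<close>
  define L where "L = Inf Bd"
  have L0: "0 \<le> L" unfolding L_def using ne by (intro cInf_greatest) (auto simp: Bd_def)
  have Ll: "L \<le> l" unfolding L_def using ne bdd by (rule cInf_lower)
  have "\<exists>l'\<in>Bd. l' < L + 1 / (real m + 1)" for m
    using ne bdd by (intro cInf_lessD) (auto simp: L_def[symmetric])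
  then obtain ls where ls: "\<And>m. ls m \<in> Bd" "\<And>m. ls m < L + 1 / (real m + 1)" by metis
  have lsL: "L \<le> ls m" for m unfolding L_def using ls(1) bdd by (intro cInf_lower)
  have lsB: "0 < ls m" "ls m < l0" "\<not> good (ls m)" for m using ls(1)[of m] by (auto simp: Bd_def)
  have lim: "ls \<longlonglongrightarrow> L"
  proof (rule tendsto_sandwich)
    show "\<forall>\<^sub>F m in sequentially. L \<le> ls m" "\<forall>\<^sub>F m in sequentially. ls m \<le> L + 1 / (real m + 1)"
      by (intro always_eventually allI lsL less_imp_le ls(2))+
    have "(\<lambda>m. 1 / (real m + 1)) \<longlonglongrightarrow> 0"
      using LIMSEQ_inverse_real_of_nat by (simp add: inverse_eq_divide add.commute)
    from tendsto_add[OF tendsto_const this, of L] show "(\<lambda>m. L + 1 / (real m + 1)) \<longlonglongrightarrow> L" by simp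
  qed simp
  have "\<exists>y\<in>shell (ls m) \<rho>. kelvin (ls m) \<xi> y < \<xi> y" for m
    using lsB(3)[of m] by (auto simp: good_def not_le)
  then obtain ys where ys: "\<And>m. ys m \<in> shell (ls m) \<rho>" "\<And>m. kelvin (ls m) \<xi> (ys m) < \<xi> (ys m)" by metis
  have "\<exists>s. (ls m)\<^sup>2 / (norm (ys m))\<^sup>2 \<le> s \<and> s \<le> 1 \<and> \<xi> (s *\<^sub>R ys m) \<le> p (s *\<^sub>R ys m) \<bullet> (s *\<^sub>R ys m)" for m
    using bad_radial_derivative[OF lsB(1,2) ys] by metis
  then obtain ss where ss: "\<And>m. (ls m)\<^sup>2 / (norm (ys m))\<^sup>2 \<le> ss m" "\<And>m. ss m \<le> 1"
    "\<And>m. \<xi> (ss m *\<^sub>R ys m) \<le> p (ss m *\<^sub>R ys m) \<bullet> (ss m *\<^sub>R ys m)" by metis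
  have ss0: "0 \<le> ss m" for m using ss(1)[of m] by (meson divide_nonneg_nonneg order_trans zero_le_power2)
  have "ys m \<in> cball 0 \<rho>" for m using ys(1)[of m] by (simp add: shell_def)
  then obtain y \<sigma> where y: "y \<in> cball 0 \<rho>" "strict_mono \<sigma>" "(ys \<circ> \<sigma>) \<longlonglongrightarrow> y"
    using compact_cball[of "0 :: real ^ 'n" \<rho>] unfolding compact_def by metis
  have lim\<sigma>: "(\<lambda>m. ls (\<sigma> m)) \<longlonglongrightarrow> L"
    using LIMSEQ_subseq_LIMSEQ[OF lim y(2)] by (simp add: comp_def)
  have limy: "(\<lambda>m. ys (\<sigma> m)) \<longlonglongrightarrow> y" using y(3) by (simp add: comp_def)
  have ny: "norm y < \<rho>1" "norm y \<le> \<rho>" using y(1) \<rho> by auto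
  have contra: False if conv: "(\<lambda>m. ss (\<sigma> m) *\<^sub>R ys (\<sigma> m)) \<longlonglongrightarrow> y" and pos: "p y \<bullet> y < \<xi> y"
  proof -
    have "\<xi> y \<le> p y \<bullet> y"
      by (rule LIMSEQ_le[OF tendsto_ball(1)[OF conv ny(1)] tendsto_inner[OF tendsto_ball(2)[OF conv ny(1)] conv]])
        (use ss(3) in blast)
    then show False using pos by simp
  qed
  show False
  proof (cases "L = 0")
    case True
    have cont: "continuous_on (cball 0 \<rho>) \<xi>" using \<rho> by (intro continuous_on_subset[OF S(4)]) auto
    obtain a where a: "a \<in> cball 0 \<rho>" "\<And>y. y \<in> cball 0 \<rho> \<Longrightarrow> \<xi> a \<le> \<xi> y"
      using continuous_attains_inf[OF compact_cball _ cont] \<rho> by auto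
    obtain b where b: "b \<in> cball 0 \<rho>" "\<And>y. y \<in> cball 0 \<rho> \<Longrightarrow> \<xi> y \<le> \<xi> b"
      using continuous_attains_sup[OF compact_cball _ cont] \<rho> by auto
    have apos: "0 < \<xi> a" using S(5)[of a] a(1) \<rho> by simp
    \<comment> \<open>Since the Kelvin transform is at least |y|^2/l^2 times the minimum of \<xi>, a
      violation forces |y| to be at most a constant times l. As the radii tend to 0, the bad points
      tend to the origin, where the limit condition would read \<xi>(0) \<le> 0.\<close>
    have bound: "(norm (ys m))\<^sup>2 \<le> (ls m)\<^sup>2 * (\<xi> b / \<xi> a)" for m
    proof -
      have yb: "norm (ys m) \<le> \<rho>" "ls m \<le> norm (ys m)" using ys(1)[of m] by (auto simp: shell_def)
      have "norm (inversion (ls m) (ys m)) \<le> ls m"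
        using yb lsB(1)[of m] by (intro norm_inversion_le)
      then have "\<xi> a \<le> \<xi> (inversion (ls m) (ys m))" using a(2) yb by simp
      then have "(norm (ys m))\<^sup>2 / (ls m)\<^sup>2 * \<xi> a \<le> kelvin (ls m) \<xi> (ys m)"
        unfolding kelvin_def dot_square_norm by (intro mult_left_mono) auto
      also have "\<dots> \<le> \<xi> b" using ys(2)[of m] b(2)[of "ys m"] yb by simp
      finally show ?thesis using lsB(1)[of m] apos by (simp add: field_simps)
    qed
    have "(\<lambda>m. (norm (ys (\<sigma> m)))\<^sup>2) \<longlonglongrightarrow> (norm y)\<^sup>2" by (intro tendsto_intros limy)
    moreover have "(\<lambda>m. (ls (\<sigma> m))\<^sup>2 * (\<xi> b / \<xi> a)) \<longlonglongrightarrow> L\<^sup>2 * (\<xi> b / \<xi> a)" by (intro tendsto_intros lim\<sigma>)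
    ultimately have "(norm y)\<^sup>2 \<le> L\<^sup>2 * (\<xi> b / \<xi> a)" using bound by (intro LIMSEQ_le) auto
    then have y0: "y = 0" using True by simp
    have "(\<lambda>m. ss (\<sigma> m) *\<^sub>R ys (\<sigma> m)) \<longlonglongrightarrow> 0"
    proof (rule Lim_null_comparison)
      show "\<forall>\<^sub>F m in sequentially. norm (ss (\<sigma> m) *\<^sub>R ys (\<sigma> m)) \<le> norm (ys (\<sigma> m))"
        using ss(2) ss0 by (auto intro!: always_eventually mult_left_le_one_le)
      show "(\<lambda>m. norm (ys (\<sigma> m))) \<longlonglongrightarrow> 0" using tendsto_norm[OF limy] y0 by simp
    qed
    then show False using contra y0 S(5)[of 0] \<rho> by simp
  next
    case False
    then have L: "0 < L" "L < l0" "L < \<rho>" using L0 Ll assms l0 by auto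
    have gL: "good L"
      unfolding good_def
    proof
      fix z :: "real ^ 'n" assume z: "z \<in> shell L \<rho>"
      \<comment> \<open>Radii strictly below the infimum, hence good, that tend to L; the 2 keeps
        already the first one positive.\<close>
      define ms where "ms m = L - L / (real m + 2)" for m
      have ms: "0 < ms m" "ms m < L" for m using L by (auto simp: ms_def field_simps intro!: add_pos_nonneg)
      have "ms \<longlonglongrightarrow> L - L * 0"
      proof -
        have "(\<lambda>m. 1 / (real m + 2)) \<longlonglongrightarrow> 0"
          using LIMSEQ_ignore_initial_segment[OF lim_1_over_n[where 'a = real], of 2] by (simp add: add.commute)
        then have "(\<lambda>m. L - L * (1 / (real m + 2))) \<longlonglongrightarrow> L - L * 0" by (intro tendsto_intros)
        then show ?thesis by (simp add: ms_def[abs_def])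
      qed
      then have msL: "ms \<longlonglongrightarrow> L" by simp
      have le: "\<xi> z \<le> kelvin (ms m) \<xi> z" for m
      proof -
        have "ms m \<notin> Bd" using cInf_lower[OF _ bdd, of "ms m"] ms(2)[of m] by (auto simp: L_def[symmetric])
        then have "good (ms m)" using ms[of m] L by (auto simp: Bd_def)
        moreover have "z \<in> shell (ms m) \<rho>" using z ms[of m] by (auto simp: shell_def)
        ultimately show ?thesis by (simp add: good_def)
      qed
      have zL: "L \<le> norm z" using z by (simp add: shell_def)
      have "norm (inversion L z) \<le> L"
        using zL L by (intro norm_inversion_le) auto
      then have "(\<lambda>m. kelvin (ms m) \<xi> z) \<longlonglongrightarrow> kelvin L \<xi> z"
        using msL L zL \<rho> by (intro kelvin_sequence) auto
      then show "\<xi> z \<le> kelvin L \<xi> z" by (rule LIMSEQ_le_const) (use le in auto)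
    qed
    have Ly: "L \<le> norm y"
    proof (rule LIMSEQ_le[OF lim\<sigma> tendsto_norm[OF limy]])
      show "\<exists>N. \<forall>m\<ge>N. ls (\<sigma> m) \<le> norm (ys (\<sigma> m))" using ys(1) by (auto simp: shell_def)
    qed
    have y0: "y \<noteq> 0" using Ly L by auto
    have "norm (inversion L y) \<le> L"
      using Ly L by (intro norm_inversion_le) auto
    then have "(\<lambda>m. kelvin (ls (\<sigma> m)) \<xi> (ys (\<sigma> m))) \<longlonglongrightarrow> kelvin L \<xi> y"
      using L \<rho> y0 by (intro kelvin_sequence[OF lim\<sigma> _ limy]) auto
    then have kle: "kelvin L \<xi> y \<le> \<xi> y"
      using tendsto_ball(1)[OF limy ny(1)] ys(2) by (intro LIMSEQ_le) (auto intro: less_imp_le)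
    obtain \<epsilon> where \<epsilon>: "0 < \<epsilon>" "\<And>y. y \<in> shell L \<rho> \<Longrightarrow> \<epsilon> * (y \<bullet> y - L\<^sup>2) \<le> kelvin L \<xi> y - \<xi> y"
      using strict_barrier[OF L(1,2) gL] by blast
    \<comment> \<open>The strict barrier at L leaves contact only on the sphere of radius L. The
      parameters in \<open>ss\<close> are then squeezed between a sequence tending to 1 and the
      constant 1, so the wrong derivative sign is inherited by y.\<close>
    have "y \<in> shell L \<rho>" using Ly ny by (simp add: shell_def)
    then have "\<epsilon> * (y \<bullet> y - L\<^sup>2) \<le> 0" using order_trans[OF \<epsilon>(2)] kle by simp
    then have "\<not> 0 < y \<bullet> y - L\<^sup>2" using mult_pos_pos[OF \<epsilon>(1)] by (meson not_less)
    then have "(norm y)\<^sup>2 \<le> L\<^sup>2" by (simp add: dot_square_norm)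
    then have "norm y \<le> L" using L(1) by (rule power2_le_imp_le[OF _ less_imp_le])
    then have yL: "norm y = L" using Ly by simp
    have "(\<lambda>m. (ls (\<sigma> m))\<^sup>2 / (norm (ys (\<sigma> m)))\<^sup>2) \<longlonglongrightarrow> L\<^sup>2 / (norm y)\<^sup>2"
      using y0 by (intro tendsto_intros lim\<sigma> limy) auto
    then have lim1: "(\<lambda>m. (ls (\<sigma> m))\<^sup>2 / (norm (ys (\<sigma> m)))\<^sup>2) \<longlonglongrightarrow> 1" using yL L by simp
    have "(\<lambda>m. ss (\<sigma> m)) \<longlonglongrightarrow> 1"
      by (rule tendsto_sandwich[OF _ _ lim1 tendsto_const]) (use ss in auto)
    from tendsto_scaleR[OF this limy] have "(\<lambda>m. ss (\<sigma> m) *\<^sub>R ys (\<sigma> m)) \<longlonglongrightarrow> y" by simp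
    then show False using contra radial_derivative_neg[OF L(1,2) gL yL] by blast
  qed
qed

text \<open>The sphere of radius sqrt(s) |y| inverts y to s y, so this is \<open>all_good\<close>
  for that radius. Stated without the Kelvin transform, it can be used around varying
  centres.\<close>

theorem radial_monotonicity:
  assumes "0 < s" "s \<le> 1" "norm y \<le> \<rho>" "s * (norm y)\<^sup>2 < l0\<^sup>2"
  shows "s * \<xi> y \<le> \<xi> (s *\<^sub>R y)"
proof (cases "y = 0")
  case True
  then show ?thesis using assms S(5)[of 0] \<rho> by (simp add: mult_left_le_one_le)
next
  case False
  define l where "l = sqrt s * norm y"
  have l2: "l\<^sup>2 = s * (norm y)\<^sup>2" using assms by (simp add: l_def power_mult_distrib)
  have l: "0 < l" using assms False by (simp add: l_def)
  have "l < l0" using assms(4) l2 l0 l by (metis less_imp_le power2_less_imp_less)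
  moreover have "l \<le> norm y" using assms by (simp add: l_def mult_left_le_one_le)
  ultimately have "\<xi> y \<le> kelvin l \<xi> y"
    using all_good[OF l] assms(3) by (auto simp: good_def shell_def)
  also have "kelvin l \<xi> y = \<xi> (s *\<^sub>R y) / s"
    using False assms(1) by (simp add: kelvin_def inversion_def l2 dot_square_norm)
  finally show ?thesis using assms(1) by (simp add: pos_le_divide_eq mult.commute)
qed

end

section \<open>The Harnack inequality\<close>

lemma solution_shift:
  assumes "solution k S f p H"
  shows "solution k ((+) x -` S) (\<lambda>y. f (x + y)) (\<lambda>y. p (x + y)) (\<lambda>y. H (x + y))"
proof -
  note S = solutionD[OF assms]
  have "open ((+) x -` S)"
    using S(1) by (intro open_vimage continuous_intros)
  moreover have "continuous_on ((+) x -` S) (\<lambda>y. p (x + y))" "continuous_on ((+) x -` S) (\<lambda>y. H (x + y))"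
    by (intro continuous_on_compose2[OF S(2)] continuous_on_compose2[OF S(3)] continuous_intros; auto)+
  moreover have "jet2 (\<lambda>y. f (x + y)) y (p (x + y)) (H (x + y))" if "x + y \<in> S" for y
    using S(6)[OF that] by (simp add: jet2_def add.assoc)
  ultimately show ?thesis using S(5,7) by (auto simp: solution_def)
qed

text \<open>1 = sigma_k is at most the k-th power of the positive trace.\<close>

lemma trace_admissible:
  assumes "1 \<le> k" "admissible k A"
  shows "1 \<le> trace A"
proof -
  obtain l where l: "transpose A = A" "eigenvalues_of A l" "garding k (\<lambda>i. l $ i)" "esym UNIV k (\<lambda>i. l $ i) = 1"
    using assms(2) by (auto simp: admissible_def)
  obtain Q m where Q: "orthogonal_matrix Q" "transpose Q ** A ** Q = diagm m"
    using spectral_theorem[OF l(1)] .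
  have m: "eigenvalues_of A m" using Q by (rule eigenvalues_of_spectral)
  have gm: "garding k (\<lambda>i. m $ i)" using garding_cong[OF l(2) m l(3)] .
  have em: "esym UNIV k (\<lambda>i. m $ i) = 1" using esym_eigenvalues_unique[OF l(2) m, of k] l(4) by simp
  have "trace A = trace (A ** (Q ** transpose Q))" using Q(1) by (simp add: orthogonal_matrix_def)
  also have "\<dots> = trace (transpose Q ** (A ** Q))"
    by (metis matrix_mul_assoc trace_mul_sym)
  also have "\<dots> = (\<Sum>i\<in>UNIV. m $ i)"
    unfolding matrix_mul_assoc Q(2) by (simp add: trace_def diagm_def)
  also have "\<dots> = esym UNIV 1 (\<lambda>i. m $ i)" by (simp only: esym_1)
  finally have t: "trace A = esym UNIV 1 (\<lambda>i. m $ i)" .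
  have pos: "0 < esym UNIV 1 (\<lambda>i. m $ i)" using gm assms(1) unfolding garding_def by blast
  have "1 \<le> (esym UNIV 1 (\<lambda>i. m $ i)) ^ k" using esym_le_power[OF gm] em by simp
  then show ?thesis
    unfolding t using pos assms(1) by (metis not_le not_one_le_zero power_less_one_iff less_imp_le not_less_eq_eq One_nat_def)
qed

lemma trace_hessian_bound:
  assumes k: "1 \<le> k" and sol: "solution k S f p H" and y: "y \<in> S"
  shows "1 \<le> f y * trace (H y)"
proof -
  have "1 \<le> trace (schouten (f y) (p y) (H y))"
    using trace_admissible[OF k] solutionD(7)[OF sol y] by blast
  also have "trace (schouten (f y) (p y) (H y)) = f y * trace (H y) - real CARD('a) * ((p y \<bullet> p y) / 2)"
    by (simp add: schouten_def trace_def mat_def sum_subtractf sum_distrib_left)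
  also have "\<dots> \<le> f y * trace (H y)" by simp
  finally show ?thesis .
qed

text \<open>At an interior maximum of f - c |y|^2 the trace of the Hessian would be at most 2 n c =
  1/(2 M), so f times the trace would be at most 1/2, against \<open>trace_hessian_bound\<close>.
  The maximum thus lies on the boundary sphere, and comparison with the centre gives c r^2 <
  M.\<close>

lemma growth_bound:
  fixes f :: "real ^ 'n \<Rightarrow> real"
  assumes k: "1 \<le> k" and sol: "solution k (ball 0 \<rho>) f p H" and r: "0 < r" "r < \<rho>"
    and M: "\<And>y. norm y \<le> r \<Longrightarrow> f y \<le> M"
  shows "r\<^sup>2 < 4 * real CARD('n) * M\<^sup>2"
proof -
  note S = solutionD[OF sol]
  have f0: "0 < f 0" using S(5)[of 0] r by simp
  have M0: "0 < M" using f0 M[of 0] r by simp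
  define n where "n = real CARD('n)"
  have n: "0 < n" by (simp add: n_def)
  define c where "c = 1 / (4 * n * M)"
  have c: "0 < c" using n M0 by (simp add: c_def)
  define g where "g y = f y + (- c * (y \<bullet> y) + 0)" for y
  have cont: "continuous_on (cball 0 r) g"
    unfolding g_def by (intro continuous_intros continuous_on_subset[OF S(4)]) (use r in auto)
  obtain y where y: "y \<in> cball 0 r" "\<And>z. z \<in> cball 0 r \<Longrightarrow> g z \<le> g y"
    using continuous_attains_sup[OF compact_cball _ cont] r by auto
  have "norm y = r"
  proof (rule ccontr)
    assume "norm y \<noteq> r"
    then have yr: "norm y < r" using y(1) by simp
    have yb: "y \<in> ball 0 \<rho>" using yr r by simp
    have "jet2 (\<lambda>y. - c * (y \<bullet> y) + 0) y (- c *\<^sub>R (2 *\<^sub>R y)) (- c *\<^sub>R (2 *\<^sub>R mat 1) + 0 *\<^sub>R outer (2 *\<^sub>R y) (2 *\<^sub>R y))"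
      by (rule jet2_compose[OF jet2_norm_sq, where r = 1 and ?g1.0 = "\<lambda>_. - c"]) (auto intro!: derivative_eq_intros)
    from jet2_add[OF S(6)[OF yb] this]
    have jg: "jet2 g y (p y + - c *\<^sub>R (2 *\<^sub>R y)) (H y + (- c *\<^sub>R (2 *\<^sub>R mat 1) + 0 *\<^sub>R outer (2 *\<^sub>R y) (2 *\<^sub>R y)))"
      unfolding g_def[abs_def] .
    have "\<forall>\<^sub>F z in nhds y. z \<in> ball 0 r" using yr by (intro eventually_nhds_in_open) auto
    then have "\<forall>\<^sub>F z in nhds y. g z \<le> g y" by eventually_elim (auto intro: y(2))
    from jet2_touching(2)[OF jg jet2_const _ this]
    have "v \<bullet> (H y *v v) \<le> 2 * c * (v \<bullet> v)" for v
      by (simp add: matrix_vector_mult_diff_rdistrib scaleR_matrix_vector_assoc[symmetric] inner_diff_right mult.commute[of 2 c])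
    from this[of "axis _ 1"] have "H y $ i $ i \<le> 2 * c" for i
      by (simp add: inner_axis' matrix_vector_mult_basis column_def)
    then have "trace (H y) \<le> (\<Sum>i\<in>(UNIV :: 'n set). 2 * c)" unfolding trace_def by (rule sum_mono)
    also have "\<dots> = 1 / (2 * M)" using n M0 by (simp add: c_def n_def[symmetric] field_simps)
    finally have tr: "trace (H y) \<le> 1 / (2 * M)" .
    have "1 \<le> f y * trace (H y)" by (rule trace_hessian_bound[OF k sol yb])
    also have "\<dots> \<le> f y * (1 / (2 * M))" using tr S(5)[OF yb] by (intro mult_left_mono) auto
    also have "\<dots> \<le> M * (1 / (2 * M))" using M[of y] yr M0 by (intro mult_right_mono) auto
    also have "\<dots> = 1 / 2" using M0 by simp
    finally show False by simp
  qed
  then have yy: "y \<bullet> y = r\<^sup>2" by (simp add: dot_square_norm)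
  have "f 0 \<le> f y - c * r\<^sup>2" using y(2)[of 0] r by (simp add: g_def yy)
  then have "c * r\<^sup>2 < M" using M[of y] \<open>norm y = r\<close> f0 by simp
  then show ?thesis using n M0 by (simp add: c_def n_def[symmetric] power2_eq_square divide_less_eq mult_ac)
qed

theorem harnack_conformal_factor:
  fixes f :: "real ^ 'n \<Rightarrow> real"
  assumes k: "1 \<le> k" and R: "0 < R" and sol: "solution k (ball x0 (3 * R)) f p H"
    and a: "a \<in> cball x0 R" and b: "\<And>y. y \<in> cball x0 (2 * R) \<Longrightarrow> f y \<le> b"
  shows "R\<^sup>2 / (16384 * real CARD('n)) \<le> f a * b"
proof (rule ccontr)
  assume neg: "\<not> ?thesis"
  note S = solutionD[OF sol]
  define n where "n = real CARD('n)"
  have n: "1 \<le> n" by (simp add: n_def Suc_le_eq)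
  \<comment> \<open>Makes L = K m satisfy (L/2)^2 = 4 n (2 m)^2, which \<open>growth_bound\<close>
    forbids for radius L/2 and bound 2 m. Since 16384 = 256 * 64, the negated claim becomes f a * b
    < R^2 / (256 K^2).\<close>
  define K where "K = 8 * sqrt n"
  have K2: "K\<^sup>2 = 64 * n" using n by (simp add: K_def power_mult_distrib)
  have K: "0 < K" using n by (simp add: K_def)
  have pos: "0 < f y" if "dist x0 y < 3 * R" for y using S(5) that by simp
  have fa: "0 < f a" using pos[of a] a R by simp
  have ab: "f a \<le> b" using b[of a] a R by simp
  have small: "f a * b < R\<^sup>2 / (256 * K\<^sup>2)" using neg by (simp add: K2 n_def)
  have "(f a)\<^sup>2 \<le> f a * b" using ab fa by (simp add: power2_eq_square)
  also have "\<dots> < (R / (16 * K))\<^sup>2" using small by (simp add: power_divide power_mult_distrib)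
  finally have faR: "f a < R / (16 * K)" using R K by (simp add: power2_less_imp_less)
  have sub: "cball a (R / 2) \<subseteq> ball x0 (3 * R)"
  proof
    fix y assume "y \<in> cball a (R / 2)"
    then show "y \<in> ball x0 (3 * R)" using a R dist_triangle[of x0 y a] by simp
  qed
  \<comment> \<open>Maximising \<open>w\<close> selects a point near which \<open>f\<close> is at least half its value there.\<close>
  define w where "w y = (R / 2 - dist a y) / f y" for y
  have "continuous_on (cball a (R / 2)) w"
    unfolding w_def using sub S(5)
    by (intro continuous_intros continuous_on_subset[OF S(4) sub]) force
  then obtain xh where xh: "xh \<in> cball a (R / 2)" "\<And>y. y \<in> cball a (R / 2) \<Longrightarrow> w y \<le> w xh"
    using continuous_attains_sup[OF compact_cball, of a "R / 2" w] R by auto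
  define m where "m = f xh"
  define s where "s = R / 2 - dist a xh"
  have m: "0 < m" using S(5) sub xh(1) by (auto simp: m_def)
  have wa: "(R / 2) / f a \<le> s / m" using xh(2)[of a] R by (simp add: w_def s_def m_def)
  have "0 < (R / 2) / f a" using R fa by simp
  then have "0 < s / m" using wa by linarith
  then have s: "0 < s" using m by (simp add: zero_less_divide_iff)
  have sR: "s \<le> R / 2" by (simp add: s_def)
  have ms: "m * R \<le> 2 * s * f a" using wa fa m by (simp add: field_simps)
  have mfa: "m \<le> f a"
  proof -
    have "2 * s * f a \<le> R * f a" using sR fa by (intro mult_right_mono) auto
    then have "m * R \<le> f a * R" using ms by (simp add: mult.commute)
    then show ?thesis using R by simp
  qed
  \<comment> \<open>Within s/2 of \<open>xh\<close> the numerator of w is at least s/2, half of its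
    value at the maximum point, so f is at least m/2.\<close>
  have fm: "m / 2 \<le> f y" if y: "dist xh y \<le> s / 2" for y
  proof -
    have "dist a xh = R / 2 - s" by (simp add: s_def)
    then have d: "dist a y \<le> R / 2 - s / 2" using dist_triangle[of a y xh] y by linarith
    then have yb: "y \<in> cball a (R / 2)" using s by simp
    have fy: "0 < f y" using S(5) sub yb by auto
    have "(s / 2) / f y \<le> w y" unfolding w_def using d fy by (intro divide_right_mono) auto
    also have "\<dots> \<le> s / m" using xh(2)[OF yb] by (simp add: w_def s_def m_def)
    finally show ?thesis using fy m s by (simp add: field_simps)
  qed
  define L where "L = K * m"
  have L: "0 < L" using K m by (simp add: L_def)
  \<comment> \<open>Uses f a < R / (16 K) and the comparison of w at a and \<open>xh\<close>. With 8
    L \<le> s, centres within L/2 of \<open>xh\<close> and their inverted points at radius below L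
    all stay within s/2 of \<open>xh\<close>.\<close>
  have Ls: "8 * L \<le> s"
  proof -
    have "8 * L * R = 8 * K * (m * R)" by (simp add: L_def)
    also have "\<dots> \<le> 8 * K * (2 * s * f a)" using ms K by (intro mult_left_mono) auto
    also have "\<dots> = 16 * K * f a * s" by simp
    also have "\<dots> \<le> R * s" using faR K s by (intro mult_right_mono) (auto simp: field_simps)
    finally show ?thesis using R by simp
  qed
  have near: "f z \<le> 2 * m" if z: "dist xh z \<le> L / 2" for z
  proof -
    \<comment> \<open>The mirror image of z in \<open>xh\<close>. Seen from x, the point
      \<open>xh\<close> is half-way to z, so radial monotonicity with factor 1/2 gives f z \<le> 2
      f(xh). The radius involved is sqrt 2 times |z - xh|, which is below L.\<close>
    define x where "x = xh - (z - xh)"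
    have dx: "dist xh x \<le> L / 2" using z by (simp add: x_def dist_norm norm_minus_commute)
    have dax: "dist x0 x \<le> 3 * R / 2 - s + L / 2"
      using dist_triangle[of x0 x xh] dist_triangle[of x0 xh a] dx a by (simp add: s_def)
    have xin: "x + y \<in> cball x0 (2 * R)" if "norm y \<le> R / 2" for y
      using dist_triangle[of x0 "x + y" x] dax that Ls L s by (simp add: dist_norm)
    have bsub: "ball 0 R \<subseteq> (+) x -` ball x0 (3 * R)"
    proof
      fix y :: "real ^ 'n" assume "y \<in> ball 0 R"
      then show "y \<in> (+) x -` ball x0 (3 * R)"
        using dist_triangle[of x0 "x + y" x] dax Ls L s R by (simp add: dist_norm)
    qed
    have solx: "solution k (ball 0 R) (\<lambda>y. f (x + y)) (\<lambda>y. p (x + y)) (\<lambda>y. H (x + y))"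
      using solution_shift[OF sol, of x] bsub unfolding solution_def
      by (auto intro: continuous_on_subset)
    interpret moving_spheres k "R / 2" R L "\<lambda>y. f (x + y)" "\<lambda>y. p (x + y)" "\<lambda>y. H (x + y)"
    proof
      show "1 \<le> k" "0 < R / 2" "R / 2 < R" "0 < L" "L \<le> R / 2" using k R L Ls sR s by auto
      show "solution k (ball 0 R) (\<lambda>y. f (x + y)) (\<lambda>y. p (x + y)) (\<lambda>y. H (x + y))" by (rule solx)
      fix l and y :: "real ^ 'n" assume l: "0 < l" "l < L" and y: "norm y = R / 2"
      have "norm (inversion l y) \<le> l" using l y Ls sR s by (intro norm_inversion_le) auto
      then have "dist xh (x + inversion l y) \<le> s / 2"
        using dist_triangle[of xh "x + inversion l y" x] dx l Ls by (simp add: dist_norm)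
      then have lower: "m / 2 \<le> f (x + inversion l y)" by (rule fm)
      have "f (x + y) \<le> b" using xin[of y] y by (intro b) simp
      \<comment> \<open>The smallness of f a * b enters here: by m \<le> f a and L = K m the claim
        amounts to m b < R^2 / (8 K^2).\<close>
      also have "b < (R / 2)\<^sup>2 / L\<^sup>2 * (m / 2)"
      proof -
        have "m * b \<le> f a * b" using mfa fa ab by (intro mult_right_mono) auto
        also have "\<dots> < R\<^sup>2 / (256 * K\<^sup>2)" by (rule small)
        also have "\<dots> \<le> R\<^sup>2 / (8 * K\<^sup>2)" using K by (intro divide_left_mono) auto
        finally show ?thesis using m K by (simp add: L_def field_simps power2_eq_square)
      qed
      also have "\<dots> \<le> (R / 2)\<^sup>2 / l\<^sup>2 * (m / 2)"
        using l m by (intro mult_right_mono divide_left_mono power_mono) auto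
      also have "\<dots> \<le> (R / 2)\<^sup>2 / l\<^sup>2 * f (x + inversion l y)"
        using lower by (intro mult_left_mono) auto
      also have "\<dots> = kelvin l (\<lambda>y. f (x + y)) y" by (simp add: kelvin_def dot_square_norm y)
      finally show "f (x + y) < kelvin l (\<lambda>y. f (x + y)) y" .
    qed
    have nz: "norm (z - xh) \<le> L / 2" using z by (simp add: dist_norm norm_minus_commute)
    have "(1 / 2) * f (x + 2 *\<^sub>R (z - xh)) \<le> f (x + (1 / 2) *\<^sub>R (2 *\<^sub>R (z - xh)))"
    proof (rule radial_monotonicity)
      show "norm (2 *\<^sub>R (z - xh)) \<le> R / 2" using nz Ls sR s by simp
      have "(norm (z - xh))\<^sup>2 \<le> (L / 2)\<^sup>2" using nz by (intro power_mono) auto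
      then show "1 / 2 * (norm (2 *\<^sub>R (z - xh)))\<^sup>2 < L\<^sup>2" using L by (simp add: power_mult_distrib power_divide) (smt (verit) zero_less_power)
    qed auto
    moreover have "x + 2 *\<^sub>R (z - xh) = z" by (simp add: x_def scaleR_2)
    moreover have "x + (1 / 2) *\<^sub>R (2 *\<^sub>R (z - xh)) = xh"
      unfolding scaleR_scaleR by (simp add: x_def)
    ultimately have "(1 / 2) * f z \<le> f xh" by (simp only:)
    then show ?thesis by (simp add: m_def)
  qed
  have "ball 0 R \<subseteq> (+) xh -` ball x0 (3 * R)"
  proof
    fix y :: "real ^ 'n" assume "y \<in> ball 0 R"
    then show "y \<in> (+) xh -` ball x0 (3 * R)"
      using dist_triangle[of x0 "xh + y" xh] dist_triangle[of x0 xh a] a xh(1) R by (simp add: dist_norm)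
  qed
  then have "solution k (ball 0 R) (\<lambda>y. f (xh + y)) (\<lambda>y. p (xh + y)) (\<lambda>y. H (xh + y))"
    using solution_shift[OF sol, of xh] unfolding solution_def by (auto intro: continuous_on_subset)
  from growth_bound[OF k this, of "L / 2" "2 * m"] have "(L / 2)\<^sup>2 < 4 * n * (2 * m)\<^sup>2"
    using L Ls sR s near by (simp add: n_def dist_norm)
  moreover have "(L / 2)\<^sup>2 = 4 * n * (2 * m)\<^sup>2"
    by (simp add: L_def power_mult_distrib power_divide K2)
  ultimately show False by simp
qed

section \<open>Back to the function u\<close>

lemma solution_of_conformal_metric:
  fixes u :: "real ^ 'n \<Rightarrow> real"
  assumes n: "3 \<le> CARD('n)" and k: "k \<le> CARD('n)" and S: "open S" and u: "C2_on S u" "\<And>x. x \<in> S \<Longrightarrow> 0 < u x"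
    and eq: "\<And>x. x \<in> S \<Longrightarrow> \<exists>l. eigenvalues_of (A_matrix u x) l \<and> sigma_k k l = 1 \<and> l \<in> Gamma_k k"
  obtains p H where "solution k S (\<lambda>x. u x powr (- 2 / (real CARD('n) - 2))) p H"
proof -
  define d where "d = real CARD('n)"
  have d: "3 \<le> d" using n by (simp add: d_def)
  \<comment> \<open>The exponent for which \<xi>^(-2) equals u^(4/(n-2)), so that both describe the
    same conformal metric.\<close>
  define \<beta> where "\<beta> = - 2 / (d - 2)"
  define g1 where "g1 s = \<beta> * s powr (\<beta> - 1)" for s
  define g2 where "g2 s = \<beta> * ((\<beta> - 1) * s powr (\<beta> - 1 - 1))" for s
  define p where "p x = g1 (u x) *\<^sub>R grad u x" for x
  define H where "H x = g1 (u x) *\<^sub>R hess u x + g2 (u x) *\<^sub>R outer (grad u x) (grad u x)" for x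
  have diff: "u differentiable (at x)" "grad u differentiable (at x)" if "x \<in> S" for x
    using u(1) that by (auto simp: C2_on_def)
  have cu: "continuous_on S u" "continuous_on S (grad u)" "continuous_on S (hess u)"
    using diff u(1) by (auto intro!: continuous_at_imp_continuous_on differentiable_imp_continuous_within simp: C2_on_def)
  have co: "continuous_on S (\<lambda>x. outer (grad u x) (grad u x))"
    unfolding outer_def by (intro continuous_on_vec_lambda continuous_on_mult continuous_on_component cu)
  have cp: "continuous_on S p" unfolding p_def g1_def
    by (intro continuous_intros cu) (use u(2) in force)
  have cH: "continuous_on S H" unfolding H_def g1_def g2_def
    by (intro continuous_intros cu co) (use u(2) in force)+
  have sym: "transpose (hess u x) = hess u x" if "x \<in> S" for x
    using hessian_symmetric[OF S that grad_has_derivative[OF diff(1)] hess_has_derivative[OF diff(2)[OF that]]] .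
  have ju: "jet2 u x (grad u x) (hess u x)" if "x \<in> S" for x
    using jet2_of_derivatives[OF S that grad_has_derivative[OF diff(1)] hess_has_derivative[OF diff(2)[OF that]]] .
  have jet: "jet2 (\<lambda>x. u x powr \<beta>) x (p x) (H x)" if x: "x \<in> S" for x
    unfolding p_def H_def
  proof (rule jet2_compose[OF ju[OF x]])
    show "0 < u x" by (rule u(2)[OF x])
    show "((\<lambda>s. s powr \<beta>) has_real_derivative g1 y) (at y)" if "\<bar>y - u x\<bar> < u x" for y
      unfolding g1_def by (rule has_real_derivative_powr) (use that in linarith)
    show "(g1 has_real_derivative g2 (u x)) (at (u x))"
      unfolding g1_def[abs_def] g2_def
      by (intro DERIV_cmult has_real_derivative_powr u(2)[OF x])
  qed
  have A: "schouten (u x powr \<beta>) (p x) (H x) = A_matrix u x" if x: "x \<in> S" for x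
  proof -
    have ux: "0 < u x" by (rule u(2)[OF x])
    define e0 where "e0 = d - 2"
    have d2: "e0 \<noteq> 0" and de: "d = e0 + 2" using d by (simp_all add: e0_def)
    have c1: "u x powr \<beta> * g1 (u x) = - (2 / (d - 2)) * u x powr (- ((d + 2) / (d - 2)))"
    proof -
      have "\<beta> + (\<beta> - 1) = - ((d + 2) / (d - 2))" using d2 unfolding \<beta>_def de by (simp add: field_simps)
      then have "u x powr \<beta> * u x powr (\<beta> - 1) = u x powr (- ((d + 2) / (d - 2)))"
        by (simp only: powr_add[symmetric])
      then show ?thesis by (simp add: g1_def \<beta>_def)
    qed
    have e: "\<beta> + (\<beta> - 1 - 1) = - (2 * d / (d - 2))" "(\<beta> - 1) + (\<beta> - 1) = - (2 * d / (d - 2))"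
      using d2 unfolding \<beta>_def de by (simp_all add: field_simps)
    have c2: "u x powr \<beta> * g2 (u x) = 2 * d / (d - 2)\<^sup>2 * u x powr (- (2 * d / (d - 2)))"
    proof -
      have "u x powr \<beta> * u x powr (\<beta> - 1 - 1) = u x powr (- (2 * d / (d - 2)))"
        by (simp only: powr_add[symmetric] e)
      moreover have "\<beta> * (\<beta> - 1) = 2 * d / (d - 2)\<^sup>2"
        using d2 unfolding \<beta>_def de by (simp add: field_simps power2_eq_square)
      ultimately show ?thesis unfolding g2_def by (metis mult.assoc mult.left_commute)
    qed
    have c3: "(p x \<bullet> p x) / 2 = 2 / (d - 2)\<^sup>2 * u x powr (- (2 * d / (d - 2))) * (norm (grad u x))\<^sup>2"
    proof -
      have "u x powr (\<beta> - 1) * u x powr (\<beta> - 1) = u x powr (- (2 * d / (d - 2)))"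
        by (simp only: powr_add[symmetric] e)
      moreover have "\<beta> * \<beta> / 2 = 2 / (d - 2)\<^sup>2" using d2 unfolding \<beta>_def de by (simp add: field_simps power2_eq_square)
      moreover have "(p x \<bullet> p x) / 2 = (\<beta> * \<beta> / 2) * (u x powr (\<beta> - 1) * u x powr (\<beta> - 1)) * (norm (grad u x))\<^sup>2"
        by (simp add: p_def g1_def dot_square_norm power_mult_distrib power2_eq_square mult_ac)
      ultimately show ?thesis by simp
    qed
    show ?thesis
      unfolding schouten_def H_def scaleR_add_right scaleR_scaleR c1 c2 c3
      by (simp add: A_matrix_def Let_def d_def)
  qed
  have "admissible k (schouten (u x powr \<beta>) (p x) (H x))" if x: "x \<in> S" for x
  proof -
    obtain l where l: "eigenvalues_of (A_matrix u x) l" "sigma_k k l = 1" "l \<in> Gamma_k k" using eq[OF x] by blast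
    have "transpose (schouten (u x powr \<beta>) (p x) (H x)) = schouten (u x powr \<beta>) (p x) (H x)"
    proof -
      have "hess u x $ i $ j = hess u x $ j $ i" for i j
        using sym[OF x] by (metis (mono_tags, lifting) transpose_def vec_lambda_beta)
      then show ?thesis
        by (simp add: schouten_def H_def transpose_def vec_eq_iff outer_def mat_def mult.commute)
    qed
    then show ?thesis
      using l Gamma_k_garding[OF k l(3)] unfolding admissible_def A[OF x] by (auto simp: sigma_k_esym)
  qed
  then have "solution k S (\<lambda>x. u x powr \<beta>) p H"
    using S cp cH jet u(2) by (simp add: solution_def less_imp_neq[THEN not_sym])
  then show ?thesis using that by (simp add: \<beta>_def d_def)
qed

theorem theorem3:
  assumes "3 \<le> CARD('n::finite)"
  shows "\<exists>C::real. \<forall>(k::nat) (R::real) (x0::real ^ 'n) (u::real ^ 'n \<Rightarrow> real).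
           1 \<le> k \<longrightarrow> k \<le> CARD('n) \<longrightarrow> 0 < R \<longrightarrow>
           C2_on (ball x0 (3 * R)) u \<longrightarrow>
           (\<forall>x\<in>ball x0 (3 * R). 0 < u x) \<longrightarrow>
           (\<forall>x\<in>ball x0 (3 * R). \<exists>l.
              eigenvalues_of (A_matrix u x) l \<and> sigma_k k l = 1 \<and> l \<in> Gamma_k k) \<longrightarrow>
           (SUP x\<in>cball x0 R. u x) * (INF x\<in>cball x0 (2 * R). u x)
             \<le> C * R powr (2 - real CARD('n))"
proof -
  define d where "d = real CARD('n)"
  have d: "3 \<le> d" using assms by (simp add: d_def)
  \<comment> \<open>The reciprocal of the exponent -2/(d-2). Being negative, it exchanges maxima and
    minima: the bounds for u come from the minimum of f on the ball of radius R and the maximum on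
    the ball of radius 2 R.\<close>
  define \<gamma> where "\<gamma> = - (d - 2) / 2"
  define c where "c = 1 / (16384 * d)"
  have c: "0 < c" using d by (simp add: c_def)
  show ?thesis
  proof (intro exI[of _ "c powr \<gamma>"] allI impI)
    fix k :: nat and R :: real and x0 :: "real ^ 'n" and u :: "real ^ 'n \<Rightarrow> real"
    assume k: "1 \<le> k" "k \<le> CARD('n)" and R: "0 < R" and u: "C2_on (ball x0 (3 * R)) u"
      and upos: "\<forall>x\<in>ball x0 (3 * R). 0 < u x"
      and eq: "\<forall>x\<in>ball x0 (3 * R). \<exists>l. eigenvalues_of (A_matrix u x) l \<and> sigma_k k l = 1 \<and> l \<in> Gamma_k k"
    define f where "f x = u x powr (- 2 / (d - 2))" for x
    obtain p H where sol: "solution k (ball x0 (3 * R)) f p H"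
      using solution_of_conformal_metric[OF assms k(2) open_ball u] upos eq
      unfolding f_def[abs_def] d_def by blast
    have uf: "u x = f x powr \<gamma>" if "x \<in> ball x0 (3 * R)" for x
    proof -
      have "- 2 / (d - 2) * \<gamma> = 1" using d unfolding \<gamma>_def by (simp add: field_simps)
      moreover have "0 < u x" using upos that by blast
      ultimately show ?thesis by (simp add: f_def powr_powr)
    qed
    have fpos: "0 < f x" if "x \<in> ball x0 (3 * R)" for x using solutionD(5)[OF sol that] .
    have sub: "cball x0 R \<subseteq> ball x0 (3 * R)" "cball x0 (2 * R) \<subseteq> ball x0 (3 * R)" using R by auto
    have cont: "continuous_on (ball x0 (3 * R)) f" by (rule solutionD(4)[OF sol])
    obtain a where a: "a \<in> cball x0 R" "\<And>y. y \<in> cball x0 R \<Longrightarrow> f a \<le> f y"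
      using continuous_attains_inf[OF compact_cball _ continuous_on_subset[OF cont sub(1)]] R by auto
    obtain b where b: "b \<in> cball x0 (2 * R)" "\<And>y. y \<in> cball x0 (2 * R) \<Longrightarrow> f y \<le> f b"
      using continuous_attains_sup[OF compact_cball _ continuous_on_subset[OF cont sub(2)]] R by auto
    have \<gamma>: "\<gamma> \<le> 0" using d by (simp add: \<gamma>_def)
    have fab: "0 < f a" "0 < f b" using fpos a(1) b(1) sub by auto
    have sup: "(SUP x\<in>cball x0 R. u x) \<le> f a powr \<gamma>"
    proof (rule cSUP_least)
      show "cball x0 R \<noteq> {}" using R by simp
      fix x assume x: "x \<in> cball x0 R"
      then have "u x = f x powr \<gamma>" using uf sub by blast
      also have "\<dots> \<le> f a powr \<gamma>" using a(2)[OF x] fab \<gamma> by (intro powr_mono2') auto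
      finally show "u x \<le> f a powr \<gamma>" .
    qed
    have lower: "0 \<le> u x" if "x \<in> cball x0 (2 * R)" for x
      using upos subsetD[OF sub(2) that] by (meson less_imp_le)
    have "bdd_below (u ` cball x0 (2 * R))" using lower by (auto intro!: bdd_belowI[of _ 0])
    then have inf: "(INF x\<in>cball x0 (2 * R). u x) \<le> f b powr \<gamma>"
      using cINF_lower[OF _ b(1), of u] uf[of b] b(1) sub by auto
    \<comment> \<open>The upper bounds for the two factors may be multiplied once the infimum is
      known to be nonnegative.\<close>
    have inf0: "0 \<le> (INF x\<in>cball x0 (2 * R). u x)"
      using lower R by (intro cINF_greatest) auto
    have "(SUP x\<in>cball x0 R. u x) * (INF x\<in>cball x0 (2 * R). u x) \<le> f a powr \<gamma> * f b powr \<gamma>"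
      using sup inf inf0 by (intro mult_mono) auto
    also have "\<dots> = (f a * f b) powr \<gamma>" using fab by (simp add: powr_mult)
    also have "\<dots> \<le> (c * R\<^sup>2) powr \<gamma>"
    proof -
      have "c * R\<^sup>2 \<le> f a * f b"
        using harnack_conformal_factor[OF k(1) R sol a(1) b(2)] by (simp add: c_def d_def)
      then show ?thesis using c R \<gamma> by (intro powr_mono2') auto
    qed
    also have "\<dots> = c powr \<gamma> * R powr (2 - real CARD('n))"
    proof -
      have "R\<^sup>2 = R powr 2" using R by (simp add: powr_numeral)
      moreover have "2 * \<gamma> = 2 - real CARD('n)" by (simp add: \<gamma>_def d_def)
      ultimately have "(R\<^sup>2) powr \<gamma> = R powr (2 - real CARD('n))"
        by (simp only: powr_powr)
      then show ?thesis using c R by (simp add: powr_mult)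
    qed
    finally show "(SUP x\<in>cball x0 R. u x) * (INF x\<in>cball x0 (2 * R). u x)
       \<le> c powr \<gamma> * R powr (2 - real CARD('n))" .
  qed
qed

end
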